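(* Fix $\kappa>0$ in the complement of the lattices $\pi\mathbb{Z}/\Lambda_i$ ($i=0,1,2,3$) and $\epsilon>0$. The cut-off Fermi action $S^{\lambda,\mu}_{F,\kappa,\epsilon}$ gives rise to a convergent perturbation series in $\lambda$, with uniform bounds for convergence for $\mu\in\mathbb{R}$ and $\Phi\in\mathfrak{g}\otimes\mathbb{R}^3$. That is, writing the perturbation series as $\sum_{n\ge0}\Xi_n(\epsilon)\lambda^{2n}$ with $\Xi_n(\epsilon)=\Xi_n(\epsilon;\kappa,\mu,\Phi)$, there are constants $M_n\ge0$, independent of $\mu\in\mathbb{R}$ and $\Phi\in\mathfrak{g}\otimes\mathbb{R}^3$, such that $|\Xi_n(\epsilon)|\le M_n$ for all $n$, $\mu$, $\Phi$, and $\sum_{n\ge0}M_n|\lambda|^{2n}<\infty$ for every $\lambda\in\mathbb{C}$.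
   Context: **Setting.** $G$ is a compact simple Lie group with Lie algebra $\mathfrak{g}$ equipped with an invariant inner product; $e_\alpha$ ($\alpha=1,\dots,\dim\mathfrak{g}$) is an orthonormal basis and $f_{\alpha\beta\gamma}$ are the structure constants, $[e_\alpha,e_\beta]=\sum_\gamma f_{\alpha\beta\gamma}e_\gamma$. $\epsilon_{ijk}$ is the antisymmetric three-tensor on $\mathbb{R}^3$. Let $\Lambda_0,\dots,\Lambda_3>0$ and let $T^4=\prod_{i=0}^3[-\Lambda_i,\Lambda_i]$ with opposite faces identified (coordinates $x_0,x_1,x_2,x_3$). $\langle\cdot,\cdot\rangle$ and $\|\cdot\|$ are the $L_2$ inner product and norm on $\mathfrak{g}\otimes\mathbb{R}^3$-valued functions on $T^4$. For $\mathfrak{g}\otimes\mathbb{R}^3$-valued functions, $[A,B]$ is the $\mathfrak{g}\otimes\mathbb{R}^3$-valued function with components $[A,B]^k_\gamma=\sum_{i,j,\alpha,\beta}\epsilon_{ijk}f_{\alpha\beta\gamma}A^i_\alpha B^j_\beta$; $d_0A=\partial A/\partial x_0$; $\nabla\times$ is the calculus curl in $x_1,x_2,x_3$. **Bosonic fields.** $\mathcal{A}$ is the space of smooth $\mathfrak{g}$-valued one-forms $A$ on $T^4$ with $A^0=0$ (viewed as $\mathfrak{g}\otimes\mathbb{R}^3$-valued functions $(A^1,A^2,A^3)$) satisfying $A^1(0,x_1,x_2,x_3)=0$, $A^2(0,0,x_2,x_3)=0$, $A^3(0,0,0,x_3)=0$ for all $x_1,x_2,x_3$. $\mathcal{F}$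 is the space of smooth $\mathfrak{g}$-valued self-dual two-forms on $T^4$, identified with smooth $\mathfrak{g}\otimes\mathbb{R}^3$-valued functions. For a function on $T^4$, a subscript $\kappa$ denotes convolution with the function $\chi_\kappa$, i.e. the projection onto Fourier modes with momenta $p\in\prod_i(\pi/\Lambda_i)\mathbb{Z}$ satisfying $|p_i|<\kappa$ for $i=0,\dots,3$. Put $\mathcal{A}^\kappa=\{A\in\mathcal{A}:A_\kappa=A\}$ and $\mathcal{F}_0^\kappa=\{F\in\mathcal{F}:F_{2\kappa}=F,\ \int_{T^4}F=0\}$. These are finite-dimensional. **Propagators.** For $\Phi\in\mathfrak{g}\otimes\mathbb{R}^3$ (regarded as a constant function) let $$S^\mu_{0,\kappa}(A,F;\Phi)=\|F\|^2-2i\langle F,d_0A\rangle-2i\langle F,\nabla\times A\rangle-2i\mu\langle\Phi,[A_\kappa,A_\kappa]\rangle,$$ a nondegenerate complex-valued quadratic form on $\mathcal{A}^\kappa\times\mathcal{F}_0^\kappa$. Let $Q$ be the (complex symmetric) operator on the complexification of $V=\mathcal{A}^\kappa\oplus\mathcal{F}_0^\kappa$ with $S^\mu_{0,\kappa}(v)=\langle v,Qv\rangle$ for $v\in V$. $C^{A,A}_{\mu,\kappa}(\Phi)(x,y)$, $C^{A,F}_{\mu,\kappa}(\Phi)(x,y)$, $C^{F,F}_{\mu,\kappa}(\Phi)(x,y)$ are the components of the integral kernel on $T^4\times T^4$ of $Q^{-1}$ (composed with orthogonal projection onto $V$); they are smooth functions, with matrix elements $(C(x,y))_{\alpha,\beta;i,j}$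 in the standard basis of $\mathbb{R}^3$ and the basis $e_\alpha$, where $(i,\alpha)$ go with $x$ and $(j,\beta)$ with $y$. **Fermi fields and cutoffs.** $\Psi_\alpha(x),\psi_\alpha(x)$ ($\alpha=1,\dots,\dim\mathfrak{g}$) and $H_i(x),\eta_i(x)$ ($i=1,2,3$) are complex Fermi (anticommuting) fields on $T^4$, with conjugates $\bar\Psi_\alpha,\bar\psi_\alpha,\bar H_i,\bar\eta_i$. The free action is $$S_{F,0}=\int_{T^4}dx\Bigl(\sum_i|H_i|^2+\sum_i|\eta_i|^2+\sum_\alpha|\Psi_\alpha|^2+\sum_\alpha|\psi_\alpha|^2\Bigr).$$ Let $\zeta\in C^\infty(\mathbb{R})$ be even with $\zeta\ge0$, $\int\zeta=1$, $\zeta'(x)\le0$ for $x>0$, $\zeta(x)=0$ for $x\ge1$. Let $Z\in C^\infty(\mathbb{R})$ be even with $Z\ge0$, $Z=1$ on $[-1,1]$, $Z'(x)\le0$ for $x>0$, $Z(x)=0$ for $|x|\ge2$. For $\epsilon>0$ let $\delta_\epsilon(x)=(2/\epsilon)^4\prod_{i=0}^3\zeta(2x_i/\epsilon)$ and $D_\epsilon(x)=\prod_{i=0}^3Z(x_i/2\epsilon)$, periodized to functions on $T^4$. The cut-off fields are $\Psi_{\alpha,\epsilon}=\Psi_\alpha\star\delta_\epsilon$, $\bar\Psi_{\alpha,\epsilon}=\bar\Psi_\alpha\star\delta_\epsilon$, $\psi_{\alpha,\epsilon}=\psi_\alpha\star\delta_\epsilon$, $\bar\psi_{\alpha,\epsilon}=\bar\psi_\alpha\star\delta_\epsilon$,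 $H_{i,\epsilon}=H_i\star\delta_\epsilon$, $\bar H_{i,\epsilon}=\bar H_i\star D_\epsilon$, $\eta_{i,\epsilon}=\eta_i\star\delta_\epsilon$, $\bar\eta_{i,\epsilon}=\bar\eta_i\star D_\epsilon$ ($\star$ is convolution on $T^4$). **Cut-off Fermi action.** $S^{\lambda,\mu}_{F,\kappa,\epsilon}=S_{F,0}+\mathcal{Q}_\epsilon+\lambda\mathcal{V}_\epsilon$, where $$\mathcal{Q}_\epsilon=\int_{T^4\times T^4}dx\,dy\sum_{\alpha,\beta,i,j}\Bigl[H_{i,\epsilon}(x)\Psi_{\alpha,\epsilon}(x)(C^{A,A}_{\mu,\kappa}(\Phi)(x,y))_{\alpha,\beta;i,j}H_{j,\epsilon}(y)\Psi_{\beta,\epsilon}(y)+2H_{i,\epsilon}(x)\Psi_{\alpha,\epsilon}(x)(C^{A,F}_{\mu,\kappa}(\Phi)(x,y))_{\alpha,\beta;i,j}\eta_{j,\epsilon}(y)\psi_{\beta,\epsilon}(y)+\eta_{i,\epsilon}(x)\psi_{\alpha,\epsilon}(x)(C^{F,F}_{\mu,\kappa}(\Phi)(x,y))_{\alpha,\beta;i,j}\eta_{j,\epsilon}(y)\psi_{\beta,\epsilon}(y)\Bigr],$$ $$\mathcal{V}_\epsilon=-\frac{i}{2}\int_{T^4}dx\sum_{\alpha,\beta,\gamma;i,j,k}\epsilon_{ijk}f_{\alpha\beta\gamma}\bar H_{i,\epsilon}(x)\bar\Psi_{\alpha,\epsilon}(x)\bar H_{j,\epsilon}(x)\bar\Psi_{\beta,\epsilon}(x)\bar\eta_{k,\epsilon}(x)\bar\psi_{\gamma,\epsilon}(x).$$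 **Fermionic perturbation series.** $Z_{F,\kappa,\epsilon}(\lambda,\mu;\Phi)=\int\mathcal{D}(\text{all fields})\,e^{S^{\lambda,\mu}_{F,\kappa,\epsilon}}$ is expanded in $\lambda$ with $\mu,\Phi$ held constant; the resulting series is $\sum_{n\ge0}\Xi_n(\epsilon)\lambda^{2n}$ with $$\Xi_n(\epsilon)=\frac{1}{(2n)!(3n)!}\int\mathcal{D}\Psi\,\mathcal{D}H\,\mathcal{D}\psi\,\mathcal{D}\eta\,\mathcal{D}\bar\Psi\,\mathcal{D}\bar H\,\mathcal{D}\bar\psi\,\mathcal{D}\bar\eta\;e^{S_{F,0}}\,\mathcal{V}_\epsilon^{2n}\,\mathcal{Q}_\epsilon^{3n}.$$ The Berezin integral is normalized so that $\int e^{S_{F,0}}=1$ and is evaluated by the fermionic Wick theorem with the only nonzero two-point functions $\langle H_i(x)\bar H_j(y)\rangle=\langle\eta_i(x)\bar\eta_j(y)\rangle=\delta_{ij}\delta(x-y)$, $\langle\Psi_\alpha(x)\bar\Psi_\beta(y)\rangle=\langle\psi_\alpha(x)\bar\psi_\beta(y)\rangle=\delta_{\alpha\beta}\delta(x-y)$ (up to a common sign convention, which does not affect $\Xi_n$). Hence the cut-off fields have two-point functions $\delta_{ij}(\delta_\epsilon\star D_\epsilon)(x-y)$ and $\delta_{\alpha\beta}(\delta_\epsilon\star\delta_\epsilon)(x-y)$ respectively. *)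

theory Defs
  imports "HOL-Analysis.Analysis"
begin

section \<open>The Lie algebra\<close>

text \<open>The group enters only through its Lie algebra, which is a finite-dimensional real inner
  product space with a simple Lie bracket for which the inner product is invariant. Conversely,
  every such Lie algebra is the Lie algebra of a compact simple Lie group.\<close>

definition lie_ideal :: "('g::euclidean_space \<Rightarrow> 'g \<Rightarrow> 'g) \<Rightarrow> 'g set \<Rightarrow> bool" where
  "lie_ideal br I \<longleftrightarrow> subspace I \<and> (\<forall>x. \<forall>y\<in>I. br x y \<in> I)"

definition compact_simple_lie_algebra :: "('g::euclidean_space \<Rightarrow> 'g \<Rightarrow> 'g) \<Rightarrow> bool" where
  "compact_simple_lie_algebra br \<longleftrightarrow>
     bilinear br \<and> (\<forall>x. br x x = 0) \<and>
     (\<forall>x y z. br x (br y z) + br y (br z x) + br z (br x y) = 0) \<and>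
     (\<forall>x y z. br x y \<bullet> z + y \<bullet> br x z = 0) \<and>
     (\<exists>x y. br x y \<noteq> 0) \<and> (\<forall>I. lie_ideal br I \<longrightarrow> I = {0} \<or> I = UNIV)"

definition orthonormal_basis :: "('n::finite \<Rightarrow> 'g::euclidean_space) \<Rightarrow> bool" where
  "orthonormal_basis e \<longleftrightarrow>
     (\<forall>a b. e a \<bullet> e b = (if a = b then 1 else 0)) \<and> span (range e) = UNIV"

definition structure_const ::
  "('g::euclidean_space \<Rightarrow> 'g \<Rightarrow> 'g) \<Rightarrow> ('n::finite \<Rightarrow> 'g) \<Rightarrow> 'n \<Rightarrow> 'n \<Rightarrow> 'n \<Rightarrow> real" where
  "structure_const br e a b c = br (e a) (e b) \<bullet> e c"

text \<open>In the type \<open>3\<close> the elements are \<open>1\<close>, \<open>2\<close> and \<open>3 = 0\<close>; in the type \<open>4\<close> they are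
  \<open>0\<close>, \<open>1\<close>, \<open>2\<close> and \<open>3\<close>.\<close>

definition levi_civita :: "3 \<Rightarrow> 3 \<Rightarrow> 3 \<Rightarrow> real" where
  "levi_civita i j k =
     (if (i, j, k) \<in> {(1, 2, 3), (2, 3, 1), (3, 1, 2)} then 1
      else if (i, j, k) \<in> {(2, 1, 3), (1, 3, 2), (3, 2, 1)} then - 1 else 0)"

definition spatial :: "3 \<Rightarrow> 4" where
  "spatial i = (if i = 1 then 1 else if i = 2 then 2 else 3)"


section \<open>Functions on the torus\<close>

text \<open>Functions on the torus with half-periods \<open>\<Lambda>\<close> are periodic functions on \<open>real^4\<close>;
  elements of \<open>\<g> \<otimes> \<real>\<^sup>3\<close> are triples in \<open>'g^3\<close>.\<close>

definition torus :: "real^4 \<Rightarrow> (real^4) set" where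
  "torus \<Lambda> = cbox (- \<Lambda>) \<Lambda>"

definition periodic :: "real^4 \<Rightarrow> (real^4 \<Rightarrow> 'b) \<Rightarrow> bool" where
  "periodic \<Lambda> u \<longleftrightarrow> (\<forall>x i. u (x + (2 * \<Lambda> $ i) *\<^sub>R axis i 1) = u x)"

definition torus_integral ::
  "real^4 \<Rightarrow> (real^4 \<Rightarrow> 'b::{banach, second_countable_topology}) \<Rightarrow> 'b" where
  "torus_integral \<Lambda> u = (LINT x:torus \<Lambda>|lborel. u x)"

definition L2_inner :: "real^4 \<Rightarrow> (real^4 \<Rightarrow> 'b::real_inner) \<Rightarrow> (real^4 \<Rightarrow> 'b) \<Rightarrow> real" where
  "L2_inner \<Lambda> u v = torus_integral \<Lambda> (\<lambda>x. u x \<bullet> v x)"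

primrec cont_diff :: "nat \<Rightarrow> ('a::euclidean_space \<Rightarrow> 'b::real_normed_vector) \<Rightarrow> bool" where
  "cont_diff 0 u \<longleftrightarrow> continuous_on UNIV u"
| "cont_diff (Suc n) u \<longleftrightarrow> (\<forall>x. u differentiable (at x)) \<and>
     (\<forall>b\<in>Basis. cont_diff n (\<lambda>x. frechet_derivative u (at x) b))"

definition smooth :: "('a::euclidean_space \<Rightarrow> 'b::real_normed_vector) \<Rightarrow> bool" where
  "smooth u \<longleftrightarrow> (\<forall>n. cont_diff n u)"

definition partial_deriv :: "4 \<Rightarrow> (real^4 \<Rightarrow> 'b::real_normed_vector) \<Rightarrow> real^4 \<Rightarrow> 'b" where
  "partial_deriv i u x = frechet_derivative u (at x) (axis i 1)"

definition curl :: "(real^4 \<Rightarrow> 'g::euclidean_space^3) \<Rightarrow> real^4 \<Rightarrow> 'g^3" where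
  "curl A x = (\<chi> k. \<Sum>i\<in>UNIV. \<Sum>j\<in>UNIV.
     levi_civita i j k *\<^sub>R (partial_deriv (spatial i) A x $ j))"

definition field_bracket ::
  "('g::euclidean_space \<Rightarrow> 'g \<Rightarrow> 'g) \<Rightarrow> ('n::finite \<Rightarrow> 'g) \<Rightarrow>
   (real^4 \<Rightarrow> 'g^3) \<Rightarrow> (real^4 \<Rightarrow> 'g^3) \<Rightarrow> real^4 \<Rightarrow> 'g^3" where
  "field_bracket br e A B x = (\<chi> k. \<Sum>c\<in>UNIV.
     (\<Sum>i\<in>UNIV. \<Sum>j\<in>UNIV. \<Sum>a\<in>UNIV. \<Sum>b\<in>UNIV.
        levi_civita i j k * structure_const br e a b c * (A x $ i \<bullet> e a) * (B x $ j \<bullet> e b)) *\<^sub>R e c)"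

definition momenta :: "real^4 \<Rightarrow> real \<Rightarrow> (real^4) set" where
  "momenta \<Lambda> \<kappa> =
     {p. \<forall>i. \<bar>p $ i\<bar> < \<kappa> \<and> (\<exists>m::int. p $ i = pi / \<Lambda> $ i * of_int m)}"

text \<open>The momentum set is invariant under \<open>p \<mapsto> - p\<close>, so the sum of the exponentials
  \<open>exp (\<i> p \<cdot> x)\<close> is the sum of their real parts.\<close>

definition mode_kernel :: "real^4 \<Rightarrow> real \<Rightarrow> real^4 \<Rightarrow> real" where
  "mode_kernel \<Lambda> \<kappa> x = (\<Sum>p\<in>momenta \<Lambda> \<kappa>. cos (p \<bullet> x)) / (\<Prod>i\<in>UNIV. 2 * \<Lambda> $ i)"

definition mode_cutoff ::
  "real^4 \<Rightarrow> real \<Rightarrow> (real^4 \<Rightarrow> 'b::{banach, second_countable_topology}) \<Rightarrow> real^4 \<Rightarrow> 'b" where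
  "mode_cutoff \<Lambda> \<kappa> u x = torus_integral \<Lambda> (\<lambda>y. mode_kernel \<Lambda> \<kappa> (x - y) *\<^sub>R u y)"


section \<open>Bosonic fields and propagators\<close>

definition gauge_fields :: "real^4 \<Rightarrow> (real^4 \<Rightarrow> 'g::euclidean_space^3) set" where
  "gauge_fields \<Lambda> = {A. smooth A \<and> periodic \<Lambda> A \<and>
     (\<forall>x. x $ 0 = 0 \<longrightarrow> A x $ 1 = 0) \<and>
     (\<forall>x. x $ 0 = 0 \<and> x $ 1 = 0 \<longrightarrow> A x $ 2 = 0) \<and>
     (\<forall>x. x $ 0 = 0 \<and> x $ 1 = 0 \<and> x $ 2 = 0 \<longrightarrow> A x $ 3 = 0)}"

definition two_form_fields :: "real^4 \<Rightarrow> (real^4 \<Rightarrow> 'g::euclidean_space^3) set" where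
  "two_form_fields \<Lambda> = {F. smooth F \<and> periodic \<Lambda> F}"

definition cutoff_gauge_fields :: "real^4 \<Rightarrow> real \<Rightarrow> (real^4 \<Rightarrow> 'g::euclidean_space^3) set" where
  "cutoff_gauge_fields \<Lambda> \<kappa> = {A \<in> gauge_fields \<Lambda>. mode_cutoff \<Lambda> \<kappa> A = A}"

definition cutoff_two_form_fields :: "real^4 \<Rightarrow> real \<Rightarrow> (real^4 \<Rightarrow> 'g::euclidean_space^3) set" where
  "cutoff_two_form_fields \<Lambda> \<kappa> =
     {F \<in> two_form_fields \<Lambda>. mode_cutoff \<Lambda> (2 * \<kappa>) F = F \<and> torus_integral \<Lambda> F = 0}"

definition boson_space ::
  "real^4 \<Rightarrow> real \<Rightarrow> ((real^4 \<Rightarrow> 'g::euclidean_space^3) \<times> (real^4 \<Rightarrow> 'g^3)) set" where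
  "boson_space \<Lambda> \<kappa> = cutoff_gauge_fields \<Lambda> \<kappa> \<times> cutoff_two_form_fields \<Lambda> \<kappa>"

definition boson_form ::
  "('g::euclidean_space \<Rightarrow> 'g \<Rightarrow> 'g) \<Rightarrow> ('n::finite \<Rightarrow> 'g) \<Rightarrow> real^4 \<Rightarrow> real \<Rightarrow> real \<Rightarrow> 'g^3 \<Rightarrow>
   (real^4 \<Rightarrow> 'g^3) \<times> (real^4 \<Rightarrow> 'g^3) \<Rightarrow> complex" where
  "boson_form br e \<Lambda> \<kappa> \<mu> \<Phi> = (\<lambda>(A, F).
     of_real (L2_inner \<Lambda> F F)
     - 2 * \<i> * of_real (L2_inner \<Lambda> F (partial_deriv 0 A))
     - 2 * \<i> * of_real (L2_inner \<Lambda> F (curl A))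
     - 2 * \<i> * of_real \<mu> * of_real (L2_inner \<Lambda> (\<lambda>_. \<Phi>)
         (field_bracket br e (mode_cutoff \<Lambda> \<kappa> A) (mode_cutoff \<Lambda> \<kappa> A))))"

text \<open>A complexified pair \<open>(A, F)\<close> is given by its components: \<open>Inl (i, a)\<close> is the index of
  \<open>A\<close> and \<open>Inr (i, a)\<close> the index of \<open>F\<close> with spatial direction \<open>i\<close> and Lie algebra direction
  \<open>e a\<close>.\<close>

type_synonym 'n comp = "(3 \<times> 'n) + (3 \<times> 'n)"
type_synonym 'n cfield = "real^4 \<Rightarrow> complex^'n comp"

definition components ::
  "('n::finite \<Rightarrow> 'g::euclidean_space) \<Rightarrow> (real^4 \<Rightarrow> 'g^3) \<times> (real^4 \<Rightarrow> 'g^3) \<Rightarrow> 'n cfield" where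
  "components e v x = (\<chi> r. case r of
       Inl (i, a) \<Rightarrow> of_real (fst v x $ i \<bullet> e a)
     | Inr (i, a) \<Rightarrow> of_real (snd v x $ i \<bullet> e a))"

definition complexified_space ::
  "('n::finite \<Rightarrow> 'g::euclidean_space) \<Rightarrow> real^4 \<Rightarrow> real \<Rightarrow> 'n cfield set" where
  "complexified_space e \<Lambda> \<kappa> =
     {\<lambda>x. components e v x + \<i> *s components e w x | v w.
        v \<in> boson_space \<Lambda> \<kappa> \<and> w \<in> boson_space \<Lambda> \<kappa>}"

text \<open>The complex bilinear (not sesquilinear) extension of the real inner product.\<close>

definition pairing :: "real^4 \<Rightarrow> ('n::finite) cfield \<Rightarrow> 'n cfield \<Rightarrow> complex" where
  "pairing \<Lambda> w z = torus_integral \<Lambda> (\<lambda>x. \<Sum>r\<in>UNIV. w x $ r * z x $ r)"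

definition form_operator ::
  "('g::euclidean_space \<Rightarrow> 'g \<Rightarrow> 'g) \<Rightarrow> ('n::finite \<Rightarrow> 'g) \<Rightarrow> real^4 \<Rightarrow> real \<Rightarrow> real \<Rightarrow> 'g^3 \<Rightarrow>
   ('n cfield \<Rightarrow> 'n cfield) \<Rightarrow> bool" where
  "form_operator br e \<Lambda> \<kappa> \<mu> \<Phi> Q \<longleftrightarrow> (let V = complexified_space e \<Lambda> \<kappa> in
     (\<forall>w\<in>V. Q w \<in> V) \<and>
     (\<forall>w\<in>V. \<forall>z\<in>V. Q (\<lambda>x. w x + z x) = (\<lambda>x. Q w x + Q z x)) \<and>
     (\<forall>w\<in>V. \<forall>c. Q (\<lambda>x. c *s w x) = (\<lambda>x. c *s Q w x)) \<and>
     (\<forall>w\<in>V. \<forall>z\<in>V. pairing \<Lambda> w (Q z) = pairing \<Lambda> (Q w) z) \<and>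
     (\<forall>v\<in>boson_space \<Lambda> \<kappa>. boson_form br e \<Lambda> \<kappa> \<mu> \<Phi> v =
        pairing \<Lambda> (components e v) (Q (components e v))))"

text \<open>The complexified space is invariant under conjugation, so orthogonality for the bilinear
  pairing is the same as Hermitian orthogonality.\<close>

definition projection ::
  "('n::finite \<Rightarrow> 'g::euclidean_space) \<Rightarrow> real^4 \<Rightarrow> real \<Rightarrow> 'n cfield \<Rightarrow> 'n cfield" where
  "projection e \<Lambda> \<kappa> w = (THE u. u \<in> complexified_space e \<Lambda> \<kappa> \<and>
     (\<forall>z\<in>complexified_space e \<Lambda> \<kappa>. pairing \<Lambda> z (\<lambda>x. w x - u x) = 0))"

text \<open>Continuity makes the kernel unique pointwise.\<close>

definition integral_kernel ::
  "real^4 \<Rightarrow> (('n::finite) cfield \<Rightarrow> 'n cfield) \<Rightarrow>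
   (real^4 \<Rightarrow> real^4 \<Rightarrow> complex^'n comp^'n comp) \<Rightarrow> bool" where
  "integral_kernel \<Lambda> T C \<longleftrightarrow>
     continuous_on UNIV (\<lambda>(x, y). C x y) \<and>
     (\<forall>y. periodic \<Lambda> (\<lambda>x. C x y)) \<and> (\<forall>x. periodic \<Lambda> (C x)) \<and>
     (\<forall>w. continuous_on UNIV w \<and> periodic \<Lambda> w \<longrightarrow>
        T w = (\<lambda>x. torus_integral \<Lambda> (\<lambda>y. C x y *v w y)))"

definition propagator ::
  "('g::euclidean_space \<Rightarrow> 'g \<Rightarrow> 'g) \<Rightarrow> ('n::finite \<Rightarrow> 'g) \<Rightarrow> real^4 \<Rightarrow> real \<Rightarrow> real \<Rightarrow> 'g^3 \<Rightarrow>
   real^4 \<Rightarrow> real^4 \<Rightarrow> complex^'n comp^'n comp" where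
  "propagator br e \<Lambda> \<kappa> \<mu> \<Phi> = (THE C. \<exists>Q. form_operator br e \<Lambda> \<kappa> \<mu> \<Phi> Q \<and>
     integral_kernel \<Lambda> (inv_into (complexified_space e \<Lambda> \<kappa>) Q \<circ> projection e \<Lambda> \<kappa>) C)"

definition prop_AA ::
  "('g::euclidean_space \<Rightarrow> 'g \<Rightarrow> 'g) \<Rightarrow> ('n::finite \<Rightarrow> 'g) \<Rightarrow> real^4 \<Rightarrow> real \<Rightarrow> real \<Rightarrow> 'g^3 \<Rightarrow>
   real^4 \<Rightarrow> real^4 \<Rightarrow> 'n \<Rightarrow> 'n \<Rightarrow> 3 \<Rightarrow> 3 \<Rightarrow> complex" where
  "prop_AA br e \<Lambda> \<kappa> \<mu> \<Phi> x y a b i j =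
     propagator br e \<Lambda> \<kappa> \<mu> \<Phi> x y $ Inl (i, a) $ Inl (j, b)"

definition prop_AF ::
  "('g::euclidean_space \<Rightarrow> 'g \<Rightarrow> 'g) \<Rightarrow> ('n::finite \<Rightarrow> 'g) \<Rightarrow> real^4 \<Rightarrow> real \<Rightarrow> real \<Rightarrow> 'g^3 \<Rightarrow>
   real^4 \<Rightarrow> real^4 \<Rightarrow> 'n \<Rightarrow> 'n \<Rightarrow> 3 \<Rightarrow> 3 \<Rightarrow> complex" where
  "prop_AF br e \<Lambda> \<kappa> \<mu> \<Phi> x y a b i j =
     propagator br e \<Lambda> \<kappa> \<mu> \<Phi> x y $ Inl (i, a) $ Inr (j, b)"

definition prop_FF ::
  "('g::euclidean_space \<Rightarrow> 'g \<Rightarrow> 'g) \<Rightarrow> ('n::finite \<Rightarrow> 'g) \<Rightarrow> real^4 \<Rightarrow> real \<Rightarrow> real \<Rightarrow> 'g^3 \<Rightarrow>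
   real^4 \<Rightarrow> real^4 \<Rightarrow> 'n \<Rightarrow> 'n \<Rightarrow> 3 \<Rightarrow> 3 \<Rightarrow> complex" where
  "prop_FF br e \<Lambda> \<kappa> \<mu> \<Phi> x y a b i j =
     propagator br e \<Lambda> \<kappa> \<mu> \<Phi> x y $ Inr (i, a) $ Inr (j, b)"


section \<open>Fermi fields and the Berezin integral\<close>

datatype 'n species = H_sp 3 | Eta_sp 3 | Psi_sp 'n | Lpsi_sp 'n

text \<open>\<open>Fermi s h\<close> is the field of species \<open>s\<close> smeared with the test function \<open>h\<close>, and
  \<open>Fermi_bar s h\<close> the conjugate field smeared with \<open>h\<close>.\<close>

datatype 'n fermi = Fermi "'n species" "real^4 \<Rightarrow> real" | Fermi_bar "'n species" "real^4 \<Rightarrow> real"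

text \<open>The unsmeared two-point function is the delta function, so that of the smeared fields is
  the \<open>L\<^sup>2\<close> product of the test functions.\<close>

fun two_point :: "real^4 \<Rightarrow> 'n fermi \<Rightarrow> 'n fermi \<Rightarrow> complex" where
  "two_point \<Lambda> (Fermi s g) (Fermi_bar t h) = (if s = t then of_real (L2_inner \<Lambda> g h) else 0)"
| "two_point \<Lambda> (Fermi_bar s g) (Fermi t h) = (if s = t then - of_real (L2_inner \<Lambda> g h) else 0)"
| "two_point \<Lambda> (Fermi s g) (Fermi t h) = 0"
| "two_point \<Lambda> (Fermi_bar s g) (Fermi_bar t h) = 0"

text \<open>Fermionic Wick theorem: the expectation of a product of fields is the Pfaffian of the
  two-point functions, here expanded along the first field.\<close>

function wick :: "real^4 \<Rightarrow> 'n fermi list \<Rightarrow> complex" where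
  "wick \<Lambda> [] = 1"
| "wick \<Lambda> (a # l) =
     (\<Sum>k<length l. (- 1) ^ k * two_point \<Lambda> a (l ! k) * wick \<Lambda> (take k l @ drop (Suc k) l))"
  by pat_completeness auto
termination by (relation "Wellfounded.measure (\<lambda>(\<Lambda>, l). length l)") auto

text \<open>A (possibly continuous) linear combination \<open>\<integral> c(t) w(t) dt\<close> of words \<open>w(t)\<close> in the fields
  is represented by the functional \<open>G \<mapsto> \<integral> c(t) G(w(t)) dt\<close> on functions of words, the product of
  words being concatenation. The Berezin integral against \<open>exp S\<^sub>F\<^sub>,\<^sub>0\<close>, normalized to be \<open>1\<close> on
  the empty word, applies it to \<open>wick\<close>.\<close>

type_synonym 'n fermi_poly = "('n fermi list \<Rightarrow> complex) \<Rightarrow> complex"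

definition fermi_one :: "'n fermi_poly" where
  "fermi_one = (\<lambda>G. G [])"

definition fermi_mult :: "'n fermi_poly \<Rightarrow> 'n fermi_poly \<Rightarrow> 'n fermi_poly" where
  "fermi_mult X Y = (\<lambda>G. X (\<lambda>u. Y (\<lambda>v. G (u @ v))))"

primrec fermi_power :: "'n fermi_poly \<Rightarrow> nat \<Rightarrow> 'n fermi_poly" where
  "fermi_power X 0 = fermi_one"
| "fermi_power X (Suc n) = fermi_mult X (fermi_power X n)"

definition berezin :: "real^4 \<Rightarrow> 'n fermi_poly \<Rightarrow> complex" where
  "berezin \<Lambda> X = X (wick \<Lambda>)"


section \<open>The cut-off Fermi action\<close>

definition zeta_profile :: "(real \<Rightarrow> real) \<Rightarrow> bool" where
  "zeta_profile \<zeta> \<longleftrightarrow> smooth \<zeta> \<and> (\<forall>x. \<zeta> (- x) = \<zeta> x) \<and> (\<forall>x. \<zeta> x \<ge> 0) \<and>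
     integral\<^sup>L lborel \<zeta> = 1 \<and> (\<forall>x>0. deriv \<zeta> x \<le> 0) \<and> (\<forall>x\<ge>1. \<zeta> x = 0)"

definition Z_profile :: "(real \<Rightarrow> real) \<Rightarrow> bool" where
  "Z_profile Z \<longleftrightarrow> smooth Z \<and> (\<forall>x. Z (- x) = Z x) \<and> (\<forall>x. Z x \<ge> 0) \<and>
     (\<forall>x\<in>{-1..1}. Z x = 1) \<and> (\<forall>x>0. deriv Z x \<le> 0) \<and> (\<forall>x. \<bar>x\<bar> \<ge> 2 \<longrightarrow> Z x = 0)"

definition periodize :: "real^4 \<Rightarrow> (real^4 \<Rightarrow> real) \<Rightarrow> real^4 \<Rightarrow> real" where
  "periodize \<Lambda> u x = (\<Sum>\<^sub>\<infinity>m\<in>(UNIV :: (int^4) set). u (\<chi> i. x $ i + 2 * \<Lambda> $ i * of_int (m $ i)))"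

definition delta_cutoff :: "real^4 \<Rightarrow> (real \<Rightarrow> real) \<Rightarrow> real \<Rightarrow> real^4 \<Rightarrow> real" where
  "delta_cutoff \<Lambda> \<zeta> \<epsilon> = periodize \<Lambda> (\<lambda>x. (2 / \<epsilon>) ^ 4 * (\<Prod>i\<in>UNIV. \<zeta> (2 * x $ i / \<epsilon>)))"

definition D_cutoff :: "real^4 \<Rightarrow> (real \<Rightarrow> real) \<Rightarrow> real \<Rightarrow> real^4 \<Rightarrow> real" where
  "D_cutoff \<Lambda> Z \<epsilon> = periodize \<Lambda> (\<lambda>x. \<Prod>i\<in>UNIV. Z (x $ i / (2 * \<epsilon>)))"

text \<open>The value at \<open>x\<close> of the convolution of a field with \<open>h\<close> is the field smeared with
  \<open>z \<mapsto> h (x - z)\<close>.\<close>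

definition conv_field :: "'n species \<Rightarrow> (real^4 \<Rightarrow> real) \<Rightarrow> real^4 \<Rightarrow> 'n fermi" where
  "conv_field s h x = Fermi s (\<lambda>z. h (x - z))"

definition conv_field_bar :: "'n species \<Rightarrow> (real^4 \<Rightarrow> real) \<Rightarrow> real^4 \<Rightarrow> 'n fermi" where
  "conv_field_bar s h x = Fermi_bar s (\<lambda>z. h (x - z))"

text \<open>In \<open>Q_action\<close> and \<open>V_action\<close>, \<open>h\<close> stands for the cut-off \<open>\<delta>\<^sub>\<epsilon>\<close> and \<open>k\<close> for the cut-off
  \<open>D\<^sub>\<epsilon>\<close>, which smears the conjugates of \<open>H\<close> and \<open>\<eta>\<close> only. \<open>Lpsi_sp\<close> is the species \<open>\<psi>\<close>.\<close>

definition Q_action ::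
  "('g::euclidean_space \<Rightarrow> 'g \<Rightarrow> 'g) \<Rightarrow> ('n::finite \<Rightarrow> 'g) \<Rightarrow> real^4 \<Rightarrow> real \<Rightarrow> real \<Rightarrow> 'g^3 \<Rightarrow>
   (real^4 \<Rightarrow> real) \<Rightarrow> 'n fermi_poly" where
  "Q_action br e \<Lambda> \<kappa> \<mu> \<Phi> h G =
     (LINT (x, y):torus \<Lambda> \<times> torus \<Lambda>|lborel.
       (\<Sum>a\<in>UNIV. \<Sum>b\<in>UNIV. \<Sum>i\<in>UNIV. \<Sum>j\<in>UNIV.
         prop_AA br e \<Lambda> \<kappa> \<mu> \<Phi> x y a b i j *
           G [conv_field (H_sp i) h x, conv_field (Psi_sp a) h x,
              conv_field (H_sp j) h y, conv_field (Psi_sp b) h y]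
         + 2 * prop_AF br e \<Lambda> \<kappa> \<mu> \<Phi> x y a b i j *
           G [conv_field (H_sp i) h x, conv_field (Psi_sp a) h x,
              conv_field (Eta_sp j) h y, conv_field (Lpsi_sp b) h y]
         + prop_FF br e \<Lambda> \<kappa> \<mu> \<Phi> x y a b i j *
           G [conv_field (Eta_sp i) h x, conv_field (Lpsi_sp a) h x,
              conv_field (Eta_sp j) h y, conv_field (Lpsi_sp b) h y]))"

definition V_action ::
  "('g::euclidean_space \<Rightarrow> 'g \<Rightarrow> 'g) \<Rightarrow> ('n::finite \<Rightarrow> 'g) \<Rightarrow> real^4 \<Rightarrow>
   (real^4 \<Rightarrow> real) \<Rightarrow> (real^4 \<Rightarrow> real) \<Rightarrow> 'n fermi_poly" where
  "V_action br e \<Lambda> h k G = - (\<i> / 2) *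
     torus_integral \<Lambda> (\<lambda>x.
       \<Sum>a\<in>UNIV. \<Sum>b\<in>UNIV. \<Sum>c\<in>UNIV. \<Sum>i\<in>UNIV. \<Sum>j\<in>UNIV. \<Sum>l\<in>UNIV.
         of_real (levi_civita i j l * structure_const br e a b c) *
           G [conv_field_bar (H_sp i) k x, conv_field_bar (Psi_sp a) h x,
              conv_field_bar (H_sp j) k x, conv_field_bar (Psi_sp b) h x,
              conv_field_bar (Eta_sp l) k x, conv_field_bar (Lpsi_sp c) h x])"

definition Xi ::
  "('g::euclidean_space \<Rightarrow> 'g \<Rightarrow> 'g) \<Rightarrow> ('n::finite \<Rightarrow> 'g) \<Rightarrow> real^4 \<Rightarrow>
   (real \<Rightarrow> real) \<Rightarrow> (real \<Rightarrow> real) \<Rightarrow> real \<Rightarrow> real \<Rightarrow> real \<Rightarrow> 'g^3 \<Rightarrow> nat \<Rightarrow> complex" where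
  "Xi br e \<Lambda> \<zeta> Z \<kappa> \<epsilon> \<mu> \<Phi> n =
     1 / (fact (2 * n) * fact (3 * n)) *
     berezin \<Lambda> (fermi_mult
       (fermi_power (V_action br e \<Lambda> (delta_cutoff \<Lambda> \<zeta> \<epsilon>) (D_cutoff \<Lambda> Z \<epsilon>)) (2 * n))
       (fermi_power (Q_action br e \<Lambda> \<kappa> \<mu> \<Phi> (delta_cutoff \<Lambda> \<zeta> \<epsilon>)) (3 * n)))"

end

theory Submission
  imports Defs
begin

text \<open>
  The propagator is the inverse of the block operator \<open>((- i M, - i D\<^sup>T), (- i D, 1))\<close>, where \<open>D\<close> is
  \<open>\<partial>\<^sub>0\<close> plus the curl and only the real symmetric \<open>M\<close> depends on \<open>\<mu>\<close> and \<open>\<Phi>\<close>. Eliminating the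
  two-form leaves \<open>D\<^sup>T D - i M\<close>, whose real part \<open>D\<^sup>T D\<close> is positive definite: \<open>D A = 0\<close> forces
  \<open>\<partial>\<^sub>0 A = 0\<close> and vanishing curl, hence \<open>A = 0\<close> by the gauge conditions. So the propagator is bounded
  uniformly in \<open>M\<close>. The fermionic expectation is the vacuum expectation of a product of operators on a Fock
  space, annihilators plus creators, whose norms are bounded by those of the test functions, so there
  is no combinatorial growth and \<open>\<Xi>\<^sub>n\<close> is at most \<open>C\<^sup>n / ((2n)! (3n)!)\<close>.\<close>

section \<open>Periodic functions\<close>

text \<open>The obstacle is uniformity, as \<open>\<mu>\<close> and \<open>\<Phi>\<close> may be
  arbitrarily large. They enter the quadratic form with an imaginary coefficient and so cannot
  cancel its real part. The two-form space is large enough to exploit this: \<open>D A\<close> has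
  momenta below \<kappa> and mean zero, hence is itself a cut-off two-form, and vanishing pairings
  with all two-forms give \<open>D A = 0\<close>. Positivity rests on the orthogonality of
  \<open>\<partial>\<^sub>0 A\<close> and the curl of \<open>A\<close>. The propagator is given by a
  definite description, so an estimate first needs a concrete kernel: polarization pins down the
  operator and continuity the kernel. On the fermionic side a sum over Wick pairings, bounded term
  by term, has factorially many terms, more than \<open>(2n)! (3n)!\<close> compensates; operator
  norms keep the cancellations. The Fock space is built from the Gram matrix of the test functions
  of one word, so its number of modes depends on the word, but the bound on the fields does
  not.\<close>

lemma torus_compact: "compact (torus \<Lambda>)"
  by (simp add: torus_def)

lemma torus_borel [measurable]: "torus \<Lambda> \<in> sets borel"
  by (simp add: torus_def)

text \<open>The Bochner integral of a non-integrable function is 0, and \<open>B\<close> is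
  nonnegative as soon as \<open>S\<close> has a point, so both cases obey the same estimate. This
  matters because \<open>Q_action\<close> and \<open>V_action\<close> integrate values of an
  arbitrary function \<open>G\<close> of words.\<close>

lemma set_integral_norm_bound:
  fixes f :: "'a::euclidean_space \<Rightarrow> 'b::{banach, second_countable_topology}"
  assumes "S \<in> sets borel" "emeasure lborel S < \<infinity>"
    and "\<And>x. x \<in> S \<Longrightarrow> norm (f x) \<le> B"
  shows "norm (LINT x:S|lborel. f x) \<le> B * measure lborel S"
proof (cases "set_integrable lborel S f")
  case True
  have "integrable lborel (\<lambda>x. B * indicat_real S x)"
    using assms(1,2) by (intro integrable_mult_right integrable_real_indicator) auto
  moreover have "integrable lborel (\<lambda>x. indicat_real S x *\<^sub>R f x)"
    using True by (simp add: set_integrable_def)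
  ultimately have "norm (LINT x:S|lborel. f x) \<le> (LINT x|lborel. B * indicat_real S x)"
    unfolding set_lebesgue_integral_def
    by (intro Bochner_Integration.integral_norm_bound_integral) (use assms(3) in \<open>auto simp: indicator_def\<close>)
  then show ?thesis using assms(1) by simp
next
  case False
  show ?thesis
  proof (cases "S = {}")
    case False
    then obtain x where "norm (f x) \<le> B" using assms(3) by blast
    then have "0 \<le> B" using norm_ge_zero[of "f x"] by linarith
    then show ?thesis using \<open>\<not> set_integrable lborel S f\<close>
      by (simp add: set_lebesgue_integral_def set_integrable_def not_integrable_integral_eq)
  qed (simp add: set_lebesgue_integral_def)
qed

lemma torus_integral_norm_bound:
  assumes "\<And>x. x \<in> torus \<Lambda> \<Longrightarrow> norm (u x) \<le> B"
  shows "norm (torus_integral \<Lambda> u) \<le> B * measure lborel (torus \<Lambda>)"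
  unfolding torus_integral_def
  using emeasure_compact_finite[OF torus_compact, of \<Lambda>] assms
  by (intro set_integral_norm_bound) auto

lemma continuous_torus_integrable:
  fixes u :: "real^4 \<Rightarrow> 'b::{banach, second_countable_topology}"
  assumes "continuous_on UNIV u"
  shows "set_integrable lborel (torus \<Lambda>) u"
  unfolding set_integrable_def
  by (rule borel_integrable_compact[OF torus_compact]) (rule continuous_on_subset[OF assms subset_UNIV])

lemma torus_integral_eq_integral:
  fixes u :: "real^4 \<Rightarrow> 'b::euclidean_space"
  assumes "continuous_on UNIV u"
  shows "torus_integral \<Lambda> u = integral (torus \<Lambda>) u"
  unfolding torus_integral_def
  by (rule set_borel_integral_eq_integral(2)[OF continuous_torus_integrable[OF assms]])

lemma torus_integral_add:
  fixes u v :: "real^4 \<Rightarrow> 'b::{banach, second_countable_topology}"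
  assumes "continuous_on UNIV u" "continuous_on UNIV v"
  shows "torus_integral \<Lambda> (\<lambda>x. u x + v x) = torus_integral \<Lambda> u + torus_integral \<Lambda> v"
  using assms unfolding torus_integral_def
  by (intro set_integral_add continuous_torus_integrable)

lemma torus_integral_diff:
  fixes u v :: "real^4 \<Rightarrow> 'b::{banach, second_countable_topology}"
  assumes "continuous_on UNIV u" "continuous_on UNIV v"
  shows "torus_integral \<Lambda> (\<lambda>x. u x - v x) = torus_integral \<Lambda> u - torus_integral \<Lambda> v"
  using assms unfolding torus_integral_def
  by (intro set_integral_diff continuous_torus_integrable)

lemma torus_integral_zero: "torus_integral \<Lambda> (\<lambda>x. 0) = 0"
  by (simp add: torus_integral_def set_lebesgue_integral_def)

lemma torus_integral_sum:
  fixes u :: "'i \<Rightarrow> real^4 \<Rightarrow> 'b::{banach, second_countable_topology}"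
  assumes "\<And>i. i \<in> A \<Longrightarrow> continuous_on UNIV (u i)"
  shows "torus_integral \<Lambda> (\<lambda>x. \<Sum>i\<in>A. u i x) = (\<Sum>i\<in>A. torus_integral \<Lambda> (u i))"
  using assms
  by (induction A rule: infinite_finite_induct)
    (auto simp: torus_integral_zero torus_integral_add continuous_on_sum)

lemma torus_integral_bounded_linear:
  fixes u :: "real^4 \<Rightarrow> 'b::{banach, second_countable_topology}"
    and T :: "'b \<Rightarrow> 'c::{banach, second_countable_topology}"
  assumes "bounded_linear T" "continuous_on UNIV u"
  shows "torus_integral \<Lambda> (\<lambda>x. T (u x)) = T (torus_integral \<Lambda> u)"
proof -
  interpret bounded_linear T by fact
  have "integral\<^sup>L lborel (\<lambda>x. T (indicat_real (torus \<Lambda>) x *\<^sub>R u x))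
      = T (integral\<^sup>L lborel (\<lambda>x. indicat_real (torus \<Lambda>) x *\<^sub>R u x))"
    using continuous_torus_integrable[OF assms(2)] assms(1) unfolding set_integrable_def
    by (intro integral_bounded_linear)
  then show ?thesis by (simp add: torus_integral_def set_lebesgue_integral_def scaleR)
qed

lemma periodic_int_shift:
  assumes "periodic \<Lambda> u"
  shows "u (x + (2 * \<Lambda> $ i * of_int m) *\<^sub>R axis i 1) = u x"
proof -
  have step: "u (y + (2 * \<Lambda> $ i) *\<^sub>R axis i 1) = u y" for y
    using assms by (simp add: periodic_def)
  have nat: "u (y + (2 * \<Lambda> $ i * real n) *\<^sub>R axis i 1) = u y" for n y
  proof (induction n)
    case (Suc n)
    then show ?case
      using step[of "y + (2 * \<Lambda> $ i * real n) *\<^sub>R axis i 1"] by (simp add: algebra_simps)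
  qed simp
  show ?thesis
  proof (cases "m \<ge> 0")
    case True
    then show ?thesis using nat[of x "nat m"] by simp
  next
    case False
    let ?y = "x + (2 * \<Lambda> $ i * of_int m) *\<^sub>R axis i 1"
    have "?y + (2 * \<Lambda> $ i * real (nat (- m))) *\<^sub>R axis i 1 = x"
      using False by simp
    then show ?thesis using nat[of ?y "nat (- m)"] by metis
  qed
qed

lemma periodic_lattice_shift:
  assumes "periodic \<Lambda> u"
  shows "u (\<chi> i. x $ i + 2 * \<Lambda> $ i * of_int (m i)) = u x"
proof -
  have "u (x + (\<Sum>i\<in>S. (2 * \<Lambda> $ i * of_int (m i)) *\<^sub>R axis i 1)) = u x" for S :: "4 set"
  proof (induction S rule: infinite_finite_induct)
    case (insert i S)
    then show ?case
      using periodic_int_shift[OF assms, of "x + (\<Sum>i\<in>S. (2 * \<Lambda> $ i * of_int (m i)) *\<^sub>R axis i 1)" i "m i"]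
      by (simp add: algebra_simps)
  qed auto
  from this[of UNIV] have "u (x + (\<Sum>i\<in>UNIV. (2 * \<Lambda> $ i * of_int (m i)) *\<^sub>R axis i 1)) = u x" .
  moreover have "(\<Sum>i\<in>UNIV. (2 * \<Lambda> $ i * of_int (m i)) *\<^sub>R axis i 1)
      = (\<chi> i. 2 * \<Lambda> $ i * of_int (m i))"
    using basis_expansion[of "\<chi> i. 2 * \<Lambda> $ i * real_of_int (m i)"]
    by (simp add: scalar_mult_eq_scaleR)
  moreover have "x + (\<chi> i. 2 * \<Lambda> $ i * real_of_int (m i)) = (\<chi> i. x $ i + 2 * \<Lambda> $ i * of_int (m i))"
    by (simp add: vec_eq_iff)
  ultimately show ?thesis by simp
qed

text \<open>Whole periods are subtracted in each coordinate. The point \<open>y\<close> depends on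
  \<open>x\<close> alone, so one representative serves all periodic functions at once.\<close>

lemma torus_representative:
  assumes "\<And>i. \<Lambda> $ i > 0"
  shows "\<exists>y\<in>torus \<Lambda>. \<forall>u :: real^4 \<Rightarrow> 'b. periodic \<Lambda> u \<longrightarrow> u y = u x"
proof -
  define m where "m i = - \<lfloor>(x $ i + \<Lambda> $ i) / (2 * \<Lambda> $ i)\<rfloor>" for i
  define y where "y = (\<chi> i. x $ i + 2 * \<Lambda> $ i * of_int (m i))"
  have "- \<Lambda> $ i \<le> y $ i \<and> y $ i \<le> \<Lambda> $ i" for i
  proof -
    define r where "r = (x $ i + \<Lambda> $ i) / (2 * \<Lambda> $ i)"
    have x: "x $ i = 2 * \<Lambda> $ i * r - \<Lambda> $ i" using assms[of i] by (simp add: r_def)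
    have "y $ i = 2 * \<Lambda> $ i * (r - of_int \<lfloor>r\<rfloor>) - \<Lambda> $ i"
      by (simp add: y_def m_def r_def[symmetric]) (simp add: x algebra_simps)
    moreover have "0 \<le> r - of_int \<lfloor>r\<rfloor>" "r - of_int \<lfloor>r\<rfloor> \<le> 1" by linarith+
    ultimately show ?thesis using assms[of i] by (simp add: mult_left_le)
  qed
  then have "y \<in> torus \<Lambda>" by (simp add: torus_def mem_box_cart)
  then show ?thesis
    by (rule bexI[rotated]) (simp add: y_def periodic_lattice_shift)
qed

lemma periodic_bounded:
  fixes u :: "real^4 \<Rightarrow> 'b::real_normed_vector"
  assumes "\<And>i. \<Lambda> $ i > 0" "continuous_on UNIV u" "periodic \<Lambda> u"
  shows "\<exists>K. \<forall>x. norm (u x) \<le> K"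
proof -
  have "bounded (u ` torus \<Lambda>)"
    by (intro compact_imp_bounded compact_continuous_image torus_compact
        continuous_on_subset[OF assms(2) subset_UNIV])
  then obtain K where K: "\<And>x. x \<in> torus \<Lambda> \<Longrightarrow> norm (u x) \<le> K" by (auto simp: bounded_iff)
  have "norm (u x) \<le> K" for x
  proof -
    obtain y where "y \<in> torus \<Lambda>" "\<And>v :: real^4 \<Rightarrow> 'b. periodic \<Lambda> v \<Longrightarrow> v y = v x"
      using torus_representative[OF assms(1), of x] by blast
    then show ?thesis using K[of y] assms(3) by metis
  qed
  then show ?thesis by blast
qed

section \<open>Translation invariance and vanishing integrals of derivatives\<close>

lemma integral_translation:
  fixes f :: "'a::euclidean_space \<Rightarrow> 'b::euclidean_space"
  assumes "continuous_on UNIV f"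
  shows "integral (cbox (a + c) (b + c)) f = integral (cbox a b) (\<lambda>x. f (x + c))"
proof -
  have "f integrable_on cbox (a + c) (b + c)"
    by (intro integrable_continuous continuous_on_subset[OF assms]) simp
  then have "(f has_integral integral (cbox (a + c) (b + c)) f) (cbox (a + c) (b + c))" by blast
  from has_integral_affinity[OF this, of 1 c]
  have "((\<lambda>x. f (x + c)) has_integral integral (cbox (a + c) (b + c)) f)
      ((\<lambda>x. x - c) ` cbox (a + c) (b + c))" by simp
  moreover have "(\<lambda>x. x - c) ` cbox (a + c) (b + c) = cbox a b"
    using cbox_translation[of "- c" "a + c" "b + c"] by simp
  ultimately show ?thesis by (metis integral_unique)
qed

text \<open>The box extended by \<open>s\<close> in direction \<open>i\<close> contains both the
  torus box and its translate. Removing an end slab of width \<open>s\<close> leaves one or the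
  other, and the two end slabs differ by a full period, so \<open>u\<close> has the same integral
  over both.\<close>

lemma torus_integral_shift:
  fixes u :: "real^4 \<Rightarrow> 'b::euclidean_space"
  assumes cont: "continuous_on UNIV u" and per: "periodic \<Lambda> u" and s: "0 \<le> s" "s \<le> 2 * \<Lambda> $ i"
  shows "integral (torus \<Lambda>) (\<lambda>x. u (x + s *\<^sub>R axis i 1)) = integral (torus \<Lambda>) u"
proof -
  let ?e = "axis i 1 :: real^4"
  let ?L = "cbox (- \<Lambda>) (\<Lambda> + s *\<^sub>R ?e)"
  have int: "u integrable_on cbox a b" for a b
    by (intro integrable_continuous continuous_on_subset[OF cont]) simp
  have e: "?e \<in> Basis" by simp
  have e_nth: "?e $ j = (if j = i then 1 else 0)" for j by (simp add: axis_def)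
  have box: "x \<in> cbox a b \<longleftrightarrow> (a $ i \<le> x $ i \<and> x $ i \<le> b $ i)
      \<and> (\<forall>j. j \<noteq> i \<longrightarrow> a $ j \<le> x $ j \<and> x $ j \<le> b $ j)" for a b x :: "real^4"
    unfolding mem_box_cart by (metis (full_types))
  \<comment> \<open>The cut at \<open>\<Lambda> $ i\<close> splits off the torus box, the cut at
    \<open>s - \<Lambda> $ i\<close> splits off its translate. The far slab is written as the near
    one moved by one period.\<close>
  have box1: "?L \<inter> {x. x \<bullet> ?e \<le> \<Lambda> $ i} = cbox (- \<Lambda>) \<Lambda>"
    "?L \<inter> {x. \<Lambda> $ i \<le> x \<bullet> ?e}
      = cbox (- \<Lambda> + (2 * \<Lambda> $ i) *\<^sub>R ?e) (\<Lambda> + (s - 2 * \<Lambda> $ i) *\<^sub>R ?e + (2 * \<Lambda> $ i) *\<^sub>R ?e)"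
    "?L \<inter> {x. x \<bullet> ?e \<le> s - \<Lambda> $ i} = cbox (- \<Lambda>) (\<Lambda> + (s - 2 * \<Lambda> $ i) *\<^sub>R ?e)"
    "?L \<inter> {x. s - \<Lambda> $ i \<le> x \<bullet> ?e} = cbox (- \<Lambda> + s *\<^sub>R ?e) (\<Lambda> + s *\<^sub>R ?e)"
    using s by (auto simp: set_eq_iff box e_nth) (auto simp: inner_axis)
  let ?slab = "integral (cbox (- \<Lambda>) (\<Lambda> + (s - 2 * \<Lambda> $ i) *\<^sub>R ?e))"
  have "integral (cbox (- \<Lambda>) \<Lambda>) u = integral ?L u - ?slab (\<lambda>x. u (x + (2 * \<Lambda> $ i) *\<^sub>R ?e))"
    using integral_split[OF int e, of "- \<Lambda>" "\<Lambda> + s *\<^sub>R ?e" "\<Lambda> $ i"]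
    unfolding box1 integral_translation[OF cont] by simp
  also have "(\<lambda>x. u (x + (2 * \<Lambda> $ i) *\<^sub>R ?e)) = u" using per by (simp add: periodic_def)
  also have "integral ?L u - ?slab u = integral (cbox (- \<Lambda>) \<Lambda>) (\<lambda>x. u (x + s *\<^sub>R ?e))"
    using integral_split[OF int e, of "- \<Lambda>" "\<Lambda> + s *\<^sub>R ?e" "s - \<Lambda> $ i"]
    unfolding box1 integral_translation[OF cont] by simp
  finally show ?thesis by (simp add: torus_def)
qed

text \<open>By translation invariance the integral of \<open>u (x + s *\<^sub>R axis i 1)\<close>
  does not depend on \<open>s\<close>, and differentiating under the integral at
  \<open>s = 0\<close> produces the integral of \<open>u'\<close>. The parameter runs over one
  period starting at 0, so the derivative compared with 0 is one-sided.\<close>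

lemma torus_integral_partial_zero:
  fixes u u' :: "real^4 \<Rightarrow> 'b::euclidean_space"
  assumes pos: "\<Lambda> $ i > 0"
    and cont: "continuous_on UNIV u" "continuous_on UNIV u'" and per: "periodic \<Lambda> u"
    and deriv: "\<And>x. ((\<lambda>t. u (x + t *\<^sub>R axis i 1)) has_vector_derivative u' x) (at 0)"
  shows "torus_integral \<Lambda> u' = 0"
proof -
  let ?e = "axis i 1 :: real^4"
  let ?U = "{0..2 * \<Lambda> $ i}"
  have d: "((\<lambda>t. u (x + t *\<^sub>R ?e)) has_vector_derivative u' (x + s *\<^sub>R ?e)) (at s within ?U)" for x s
  proof -
    have "((\<lambda>t. t - s) has_vector_derivative 1) (at s)"
      by (auto intro!: derivative_eq_intros)
    then have "(((\<lambda>t. u (x + s *\<^sub>R ?e + t *\<^sub>R ?e)) \<circ> (\<lambda>t. t - s))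
        has_vector_derivative 1 *\<^sub>R u' (x + s *\<^sub>R ?e)) (at s)"
      by (intro vector_diff_chain_at) (use deriv[of "x + s *\<^sub>R ?e"] in auto)
    then show ?thesis
      by (simp add: o_def algebra_simps has_vector_derivative_at_within)
  qed
  have c: "continuous_on UNIV (\<lambda>x. u (x + s *\<^sub>R ?e))" for s
    by (rule continuous_on_compose2[OF cont(1)]) (auto intro!: continuous_intros)
  have "((\<lambda>s. integral (cbox (- \<Lambda>) \<Lambda>) (\<lambda>x. u (x + s *\<^sub>R ?e))) has_vector_derivative
      integral (cbox (- \<Lambda>) \<Lambda>) (\<lambda>x. u' (x + 0 *\<^sub>R ?e))) (at 0 within ?U)"
    by (rule leibniz_rule_vector_derivative)
      (use d pos in \<open>auto intro!: integrable_continuous continuous_on_subset[OF c]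
        simp: case_prod_unfold intro!: continuous_on_compose2[OF cont(2)] continuous_intros\<close>)
  then have "((\<lambda>s. integral (torus \<Lambda>) u) has_vector_derivative integral (torus \<Lambda>) u') (at 0 within ?U)"
    by (intro has_vector_derivative_transform[of 0 ?U "\<lambda>s. integral (torus \<Lambda>) u"])
      (use pos torus_integral_shift[OF cont(1) per] in \<open>auto simp: torus_def\<close>)
  moreover have "((\<lambda>s. integral (torus \<Lambda>) u) has_vector_derivative 0) (at 0 within ?U)" by simp
  ultimately have "integral (torus \<Lambda>) u' = 0"
    using pos by (intro vector_derivative_unique_within_closed_interval[of 0 "2 * \<Lambda> $ i" 0]) auto
  then show ?thesis by (simp add: torus_integral_eq_integral cont)
qed

lemma torus_integral_nonneg_eq_0:
  fixes f :: "real^4 \<Rightarrow> real"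
  assumes "\<And>i. \<Lambda> $ i > 0" "continuous_on UNIV f" "periodic \<Lambda> f" "\<And>x. f x \<ge> 0"
    and "torus_integral \<Lambda> f = 0"
  shows "f x = 0"
proof -
  obtain y where "y \<in> torus \<Lambda>" "\<And>v :: real^4 \<Rightarrow> real. periodic \<Lambda> v \<Longrightarrow> v y = v x"
    using torus_representative[OF assms(1), of x] by blast
  then have y: "y \<in> torus \<Lambda>" "f y = f x" using assms(3) by auto
  have "f integrable_on cbox (- \<Lambda>) \<Lambda>"
    by (intro integrable_continuous continuous_on_subset[OF assms(2)]) simp
  then have "(f has_integral 0) (cbox (- \<Lambda>) \<Lambda>)"
    using assms(5) by (simp add: torus_integral_eq_integral[OF assms(2)] torus_def has_integral_iff)
  moreover have "0 \<in> box (- \<Lambda>) \<Lambda>" using assms(1) by (simp add: mem_box_cart)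
  ultimately have "f y = 0"
    using has_integral_0_cbox_imp_0[of "- \<Lambda>" \<Lambda> f y] y assms(2,4)
    by (auto simp: torus_def intro: continuous_on_subset)
  then show ?thesis using y by simp
qed

section \<open>Linear algebra over arbitrary finite index sets\<close>

text \<open>Gaussian elimination, by induction on the equations: an equation with a nonzero
  coefficient expresses one unknown through the others and leaves a smaller system. The indices are
  kept arbitrary because later they are functions.\<close>

lemma homogeneous_system_nontrivial:
  fixes M :: "'i \<Rightarrow> 'j \<Rightarrow> 'a::field"
  assumes "finite I" "finite J" "card I < card J"
  shows "\<exists>x. (\<exists>j\<in>J. x j \<noteq> 0) \<and> (\<forall>i\<in>I. (\<Sum>j\<in>J. M i j * x j) = 0)"
  using assms
proof (induction I arbitrary: J M rule: finite_induct)
  case empty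
  then have "J \<noteq> {}" by auto
  then show ?case by (intro exI[of _ "\<lambda>_. 1"]) auto
next
  case (insert i I)
  show ?case
  proof (cases "\<forall>j\<in>J. M i j = 0")
    case True
    have "card I < card J" using insert by auto
    from insert.IH[OF insert.prems(1) this] True show ?thesis by auto
  next
    case False
    then obtain j0 where j0: "j0 \<in> J" "M i j0 \<noteq> 0" by auto
    let ?J = "J - {j0}"
    have c: "card I < card ?J" using insert j0 by auto
    obtain x where x: "\<exists>j\<in>?J. x j \<noteq> 0"
      "\<forall>i'\<in>I. (\<Sum>j\<in>?J. (M i' j - M i' j0 * M i j / M i j0) * x j) = 0"
      using insert.IH[of ?J "\<lambda>i' j. M i' j - M i' j0 * M i j / M i j0"] c insert.prems(1) by auto
    \<comment> \<open>The eliminated unknown is recovered by solving equation \<open>i\<close> for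
      it.\<close>
    define y where "y = x(j0 := - (\<Sum>j\<in>?J. M i j * x j) / M i j0)"
    have s: "(\<Sum>j\<in>J. M i' j * y j)
        = (\<Sum>j\<in>?J. M i' j * x j) - M i' j0 / M i j0 * (\<Sum>j\<in>?J. M i j * x j)" for i'
      by (subst sum.remove[OF insert.prems(1) j0(1)]) (simp add: y_def)
    have "(\<Sum>j\<in>J. M i j * y j) = 0" using j0 by (simp add: s)
    moreover have "(\<Sum>j\<in>J. M i' j * y j) = 0" if "i' \<in> I" for i'
    proof -
      have "(\<Sum>j\<in>J. M i' j * y j)
          = (\<Sum>j\<in>?J. (M i' j - M i' j0 * M i j / M i j0) * x j)"
        unfolding s sum_distrib_left sum_subtractf[symmetric]
        by (intro sum.cong refl) (simp add: algebra_simps)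
      then show ?thesis using x(2) that by simp
    qed
    moreover have "\<exists>j\<in>J. y j \<noteq> 0" using x(1) by (auto simp: y_def)
    ultimately show ?thesis by (intro exI[of _ y]) auto
  qed
qed

text \<open>Appending the negative of the \<open>k\<close>-th unit vector as a column gives one
  unknown more than equations. Injectivity excludes a nontrivial solution whose extra component is
  0, and dividing by that component gives column \<open>k\<close> of the inverse.\<close>

lemma injective_matrix_right_inverse:
  fixes M :: "'i \<Rightarrow> 'i \<Rightarrow> 'a::field"
  assumes fin: "finite I"
    and inj: "\<And>x. (\<And>i. i \<in> I \<Longrightarrow> (\<Sum>j\<in>I. M i j * x j) = 0) \<Longrightarrow> \<forall>i\<in>I. x i = 0"
  shows "\<exists>R. \<forall>i\<in>I. \<forall>k\<in>I. (\<Sum>j\<in>I. M i j * R j k) = (if i = k then 1 else 0)"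
proof -
  have "\<exists>x. \<forall>i\<in>I. (\<Sum>j\<in>I. M i j * x j) = (if i = k then 1 else 0)" for k
  proof -
    define N where "N i c = (case c of Some j \<Rightarrow> M i j | None \<Rightarrow> if i = k then - 1 else 0)" for i c
    define J where "J = insert None (Some ` I)"
    have "card I < card J" using fin by (simp add: J_def card_image)
    then obtain x where x: "\<exists>j\<in>J. x j \<noteq> 0" "\<forall>i\<in>I. (\<Sum>j\<in>J. N i j * x j) = 0"
      using homogeneous_system_nontrivial[of I J N] fin by (auto simp: J_def)
    have eq: "(\<Sum>j\<in>I. M i j * x (Some j)) = (if i = k then x None else 0)" if "i \<in> I" for i
      using x(2) that fin by (auto simp: J_def N_def sum.reindex split: if_splits)
    have nz: "x None \<noteq> 0"
    proof
      assume "x None = 0"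
      then have "\<forall>i\<in>I. x (Some i) = 0" using eq by (intro inj) auto
      with \<open>x None = 0\<close> x(1) show False by (auto simp: J_def)
    qed
    show ?thesis
      using eq nz by (intro exI[of _ "\<lambda>j. x (Some j) / x None"]) (auto simp flip: sum_divide_distrib)
  qed
  then obtain R where "\<forall>k. \<forall>i\<in>I. (\<Sum>j\<in>I. M i j * R k j) = (if i = k then 1 else 0)"
    by metis
  then show ?thesis by (intro exI[of _ "\<lambda>j k. R k j"]) auto
qed

text \<open>Normal equations: \<open>D\<^sup>T D\<close> inherits injectivity from \<open>D\<close>,
  since its quadratic form is the squared length of \<open>D x\<close>, and the inverse of
  \<open>D\<^sup>T D\<close> followed after \<open>D\<^sup>T\<close> inverts \<open>D\<close> from
  the left.\<close>

lemma injective_matrix_left_inverse: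
  fixes D :: "'j \<Rightarrow> 'i \<Rightarrow> real"
  assumes fin: "finite I" "finite J"
    and inj: "\<And>x. (\<And>j. j \<in> J \<Longrightarrow> (\<Sum>i\<in>I. D j i * x i) = 0) \<Longrightarrow> \<forall>i\<in>I. x i = 0"
  shows "\<exists>L. \<forall>i\<in>I. \<forall>k\<in>I. (\<Sum>j\<in>J. L i j * D j k) = (if i = k then 1 else 0)"
proof -
  define G where "G i k = (\<Sum>j\<in>J. D j i * D j k)" for i k
  have G: "\<forall>i\<in>I. x i = 0" if "\<And>i. i \<in> I \<Longrightarrow> (\<Sum>k\<in>I. G i k * x k) = 0" for x
  proof (rule inj)
    have "(\<Sum>j\<in>J. (\<Sum>i\<in>I. D j i * x i)\<^sup>2) = (\<Sum>i\<in>I. x i * (\<Sum>k\<in>I. G i k * x k))"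
      unfolding G_def power2_eq_square sum_product sum_distrib_left sum_distrib_right
      apply (subst sum.swap, rule sum.cong[OF refl])
      apply (subst sum.swap, rule sum.cong[OF refl])
      apply (rule sum.cong[OF refl])
      by (simp add: mult_ac)
    also have "\<dots> = 0" using that by simp
    finally show "(\<Sum>i\<in>I. D j i * x i) = 0" if "j \<in> J" for j
      using that fin by (subst (asm) sum_nonneg_eq_0_iff) auto
  qed
  obtain R where R: "\<forall>i\<in>I. \<forall>k\<in>I. (\<Sum>j\<in>I. G i j * R j k) = (if i = k then 1 else 0)"
    using injective_matrix_right_inverse[OF fin(1), of G] G by blast
  \<comment> \<open>\<open>R\<close> occurs transposed: it is known as a right inverse of
    \<open>G\<close>, and since \<open>G\<close> is symmetric its transpose is a left
    inverse.\<close>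
  have "(\<Sum>j\<in>J. (\<Sum>m\<in>I. R m i * D j m) * D j k) = (if i = k then 1 else 0)"
    if "i \<in> I" "k \<in> I" for i k
  proof -
    have "(\<Sum>j\<in>J. (\<Sum>m\<in>I. R m i * D j m) * D j k) = (\<Sum>m\<in>I. G k m * R m i)"
      unfolding G_def sum_distrib_right
      by (subst sum.swap) (simp add: mult_ac)
    then show ?thesis using R that by auto
  qed
  then show ?thesis by (intro exI[of _ "\<lambda>i j. \<Sum>m\<in>I. R m i * D j m"]) auto
qed

text \<open>The constant does not depend on \<open>M\<close>: pairing the first equation with the conjugate of \<open>x\<close> and
  taking real parts removes \<open>M\<close> and leaves an estimate of \<open>D x\<close>, which controls \<open>x\<close>.\<close>

lemma saddle_point_bound:
  fixes D :: "'j \<Rightarrow> 'i \<Rightarrow> real"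
  assumes fin: "finite I" "finite J"
    and inj: "\<And>x. (\<And>j. j \<in> J \<Longrightarrow> (\<Sum>i\<in>I. D j i * x i) = 0) \<Longrightarrow> \<forall>i\<in>I. x i = 0"
  shows "\<exists>c. \<forall>M :: 'i \<Rightarrow> 'i \<Rightarrow> real. \<forall>x y a f t.
    (\<forall>i\<in>I. \<forall>k\<in>I. M i k = M k i) \<longrightarrow>
    (\<forall>i\<in>I. - \<i> * (\<Sum>k\<in>I. of_real (M i k) * x k) - \<i> * (\<Sum>j\<in>J. of_real (D j i) * y j) = a i) \<longrightarrow>
    (\<forall>j\<in>J. - \<i> * (\<Sum>i\<in>I. of_real (D j i) * x i) + y j = f j) \<longrightarrow>
    (\<forall>i\<in>I. cmod (a i) \<le> t) \<longrightarrow> (\<forall>j\<in>J. cmod (f j) \<le> t) \<longrightarrow> 0 \<le> t \<longrightarrow>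
    (\<forall>i\<in>I. cmod (x i) \<le> c * t) \<and> (\<forall>j\<in>J. cmod (y j) \<le> c * t)"
proof -
  obtain L where L: "\<forall>i\<in>I. \<forall>k\<in>I. (\<Sum>j\<in>J. L i j * D j k) = (if i = k then 1 else 0)"
    using injective_matrix_left_inverse[OF fin inj] by blast
  \<comment> \<open>\<open>l\<close> controls the recovery of \<open>x\<close> from
    \<open>D x\<close> in the 1-norm. \<open>S * t\<close> will bound \<open>P\<close>, the 1-norm
    of \<open>D x\<close>.\<close>
  define l where "l = (\<Sum>i\<in>I. \<Sum>j\<in>J. \<bar>L i j\<bar>)"
  define S where "S = real (card J) * (l + 1)"
  have l0: "l \<ge> 0" unfolding l_def by (intro sum_nonneg) auto
  \<comment> \<open>The entries of \<open>x\<close> turn out to be at most \<open>l * S * t\<close>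
    and those of \<open>y\<close>, which is \<open>f\<close> plus \<open>\<i>\<close> times
    \<open>D x\<close>, at most \<open>(1 + S) * t\<close>; the constant is the sum of both
    coefficients.\<close>
  show ?thesis
  proof (rule exI[of _ "l * S + 1 + S"], intro allI impI)
    fix M :: "'i \<Rightarrow> 'i \<Rightarrow> real" and x y a f and t :: real
    assume sym: "\<forall>i\<in>I. \<forall>k\<in>I. M i k = M k i"
      and ax: "\<forall>i\<in>I. - \<i> * (\<Sum>k\<in>I. of_real (M i k) * x k)
        - \<i> * (\<Sum>j\<in>J. of_real (D j i) * y j) = a i"
      and fx: "\<forall>j\<in>J. - \<i> * (\<Sum>i\<in>I. of_real (D j i) * x i) + y j = f j"
      and at: "\<forall>i\<in>I. cmod (a i) \<le> t" and ft: "\<forall>j\<in>J. cmod (f j) \<le> t" and t: "0 \<le> t"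
    define p where "p j = (\<Sum>i\<in>I. of_real (D j i) * x i)" for j
    define P where "P = (\<Sum>j\<in>J. cmod (p j))"
    have P0: "P \<ge> 0" unfolding P_def by (intro sum_nonneg) auto
    have y: "y j = f j + \<i> * p j" if "j \<in> J" for j
      using fx that by (auto simp: p_def algebra_simps)
    have xL: "x i = (\<Sum>j\<in>J. of_real (L i j) * p j)" if "i \<in> I" for i
    proof -
      have "(\<Sum>j\<in>J. of_real (L i j) * p j) = (\<Sum>k\<in>I. of_real (\<Sum>j\<in>J. L i j * D j k) * x k)"
        unfolding p_def sum_distrib_left of_real_sum sum_distrib_right
        by (subst sum.swap) (simp add: mult_ac)
      also have "\<dots> = (\<Sum>k\<in>I. if i = k then x k else 0)"
        using L that by (intro sum.cong) auto
      finally show ?thesis using that fin by simp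
    qed
    have p1: "cmod (p j) \<le> P" if "j \<in> J" for j
      unfolding P_def using that fin by (intro member_le_sum) auto
    have "(\<Sum>i\<in>I. cmod (x i)) \<le> (\<Sum>i\<in>I. \<Sum>j\<in>J. \<bar>L i j\<bar> * P)"
      by (intro sum_mono) (auto simp: xL norm_mult intro!: sum_norm_le mult_left_mono p1)
    then have xs: "(\<Sum>i\<in>I. cmod (x i)) \<le> l * P"
      by (simp add: l_def sum_distrib_right)
    define s where "s = (\<Sum>i\<in>I. \<Sum>k\<in>I. cnj (x i) * of_real (M i k) * x k)"
    \<comment> \<open>Symmetry of the real \<open>M\<close> makes its Hermitian form real, so
      \<open>- \<i> * s\<close> is purely imaginary and disappears from the real part, whatever the
      size of \<open>M\<close>.\<close>
    have "cnj s = s"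
      unfolding s_def
      by (subst (2) sum.swap) (use sym in \<open>auto intro!: sum.cong simp: mult_ac\<close>)
    then have s: "Im s = 0" by (simp add: complex_eq_iff)
    have cp: "(\<Sum>i\<in>I. cnj (x i) * (\<Sum>j\<in>J. of_real (D j i) * g j)) = (\<Sum>j\<in>J. cnj (p j) * g j)" for g
      unfolding p_def sum_distrib_left cnj_sum sum_distrib_right
      by (subst sum.swap) (simp add: mult_ac)
    have "(\<Sum>i\<in>I. cnj (x i) * a i)
       = (\<Sum>i\<in>I. - \<i> * (cnj (x i) * (\<Sum>k\<in>I. of_real (M i k) * x k)) 
            - \<i> * (cnj (x i) * (\<Sum>j\<in>J. of_real (D j i) * (f j + \<i> * p j))))"
    proof (rule sum.cong[OF refl])
      fix i assume "i \<in> I"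
      then have "a i = - \<i> * (\<Sum>k\<in>I. of_real (M i k) * x k)
          - \<i> * (\<Sum>j\<in>J. of_real (D j i) * (f j + \<i> * p j))"
        using ax y by auto
      then show "cnj (x i) * a i = - \<i> * (cnj (x i) * (\<Sum>k\<in>I. of_real (M i k) * x k))
          - \<i> * (cnj (x i) * (\<Sum>j\<in>J. of_real (D j i) * (f j + \<i> * p j)))"
        by (simp add: right_diff_distrib mult_ac)
    qed
    also have "\<dots> = - \<i> * s - \<i> * (\<Sum>j\<in>J. cnj (p j) * (f j + \<i> * p j))"
      by (simp only: sum_subtractf sum_distrib_left[symmetric] cp)
        (simp add: s_def sum_distrib_left mult_ac)
    also have "\<dots> = - \<i> * s - \<i> * (\<Sum>j\<in>J. cnj (p j) * f j) + (\<Sum>j\<in>J. of_real ((cmod (p j))\<^sup>2))"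
    proof -
      have "(\<Sum>j\<in>J. cnj (p j) * (f j + \<i> * p j))
          = (\<Sum>j\<in>J. cnj (p j) * f j) + \<i> * (\<Sum>j\<in>J. of_real ((cmod (p j))\<^sup>2))"
        unfolding sum_distrib_left sum.distrib[symmetric]
        by (intro sum.cong refl, unfold complex_norm_square) (simp add: algebra_simps)
      then show ?thesis by (simp add: algebra_simps)
    qed
    finally have "(\<Sum>j\<in>J. (cmod (p j))\<^sup>2)
        = Re ((\<Sum>i\<in>I. cnj (x i) * a i) + \<i> * (\<Sum>j\<in>J. cnj (p j) * f j))"
      using s by (simp flip: of_real_sum)
    also have "\<dots> \<le> cmod ((\<Sum>i\<in>I. cnj (x i) * a i) + \<i> * (\<Sum>j\<in>J. cnj (p j) * f j))"
      by (rule complex_Re_le_cmod)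
    also have "\<dots> \<le> cmod (\<Sum>i\<in>I. cnj (x i) * a i) + cmod (\<Sum>j\<in>J. cnj (p j) * f j)"
      by (rule order_trans[OF norm_triangle_ineq]) (simp add: norm_mult)
    also have "\<dots> \<le> (\<Sum>i\<in>I. cmod (x i) * t) + (\<Sum>j\<in>J. cmod (p j) * t)"
      using at ft by (intro add_mono sum_norm_le) (auto simp: norm_mult intro!: mult_left_mono)
    also have "\<dots> \<le> (l * P + P) * t"
      using xs t by (simp add: P_def flip: sum_distrib_right distrib_right)
        (auto intro!: mult_right_mono)
    finally have sq: "(\<Sum>j\<in>J. (cmod (p j))\<^sup>2) \<le> (l + 1) * P * t" by (simp add: algebra_simps)
    \<comment> \<open>Cauchy-Schwarz. The sum of squares is bounded linearly in \<open>P\<close>, so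
      one factor \<open>P\<close> cancels from the resulting inequality.\<close>
    have "P\<^sup>2 \<le> real (card J) * (\<Sum>j\<in>J. (cmod (p j))\<^sup>2)"
      unfolding P_def using sum_squared_le_sum_of_squares[of "\<lambda>j. cmod (p j)" J] fin
      by (simp add: mult_ac)
    also have "\<dots> \<le> real (card J) * ((l + 1) * P * t)" using sq by (intro mult_left_mono) auto
    finally have "P * P \<le> (S * t) * P" by (simp add: S_def power2_eq_square algebra_simps)
    then have PS: "P \<le> S * t"
      using P0 t l0 by (cases "P = 0") (auto simp: S_def)
    have "cmod (x i) \<le> (l * S + 1 + S) * t" if "i \<in> I" for i
    proof -
      have "cmod (x i) \<le> (\<Sum>i\<in>I. cmod (x i))" using that fin by (intro member_le_sum) auto
      also have "\<dots> \<le> l * (S * t)" using xs PS l0 by (meson mult_left_mono order_trans)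
      finally have "cmod (x i) \<le> l * S * t" by simp
      moreover have "0 \<le> S * t" using PS P0 by linarith
      ultimately show ?thesis using t by (simp add: algebra_simps)
    qed
    moreover have "cmod (y j) \<le> (l * S + 1 + S) * t" if "j \<in> J" for j
    proof -
      have "cmod (y j) \<le> cmod (f j) + cmod (p j)"
        using norm_triangle_ineq[of "f j" "\<i> * p j"] by (simp add: y[OF that] norm_mult)
      also have "\<dots> \<le> t + S * t" using ft p1[OF that] PS that by (intro add_mono) auto
      finally have "cmod (y j) \<le> t + S * t" .
      moreover have "0 \<le> l * (S * t)" using PS P0 l0 by simp
      ultimately show ?thesis by (simp add: algebra_simps)
    qed
    ultimately show "(\<forall>i\<in>I. cmod (x i) \<le> (l * S + 1 + S) * t)
        \<and> (\<forall>j\<in>J. cmod (y j) \<le> (l * S + 1 + S) * t)" by blast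
  qed
qed

section \<open>A Fock space bound for the fermionic expectation\<close>

lemma quadratic_form_insert:
  fixes G :: "'a \<Rightarrow> 'a \<Rightarrow> real"
  assumes "finite T" "t \<notin> T" "\<And>a. a \<in> T \<Longrightarrow> G t a = G a t"
  shows "(\<Sum>a\<in>insert t T. \<Sum>b\<in>insert t T. x a * x b * G a b)
    = (x t)\<^sup>2 * G t t + 2 * x t * (\<Sum>a\<in>T. x a * G a t) + (\<Sum>a\<in>T. \<Sum>b\<in>T. x a * x b * G a b)"
proof -
  have "(\<Sum>b\<in>T. x t * x b * G t b) = x t * (\<Sum>a\<in>T. x a * G a t)"
    using assms(3) by (simp add: sum_distrib_left mult_ac)
  moreover have "(\<Sum>a\<in>T. x a * x t * G a t) = x t * (\<Sum>a\<in>T. x a * G a t)"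
    by (simp add: sum_distrib_left mult_ac)
  ultimately show ?thesis
    using assms(1,2) by (simp add: sum.distrib power2_eq_square)
qed

text \<open>Cholesky decomposition, stated for a form because the test functions are only a semi-inner
  product space.\<close>

lemma gram_vectors:
  fixes G :: "'a \<Rightarrow> 'a \<Rightarrow> real"
  assumes "finite T" "\<And>x. 0 \<le> (\<Sum>a\<in>T. \<Sum>b\<in>T. x a * x b * G a b)"
    and "\<And>a b. a \<in> T \<Longrightarrow> b \<in> T \<Longrightarrow> G a b = G b a"
  shows "\<exists>(m::nat) v. \<forall>a\<in>T. \<forall>b\<in>T. (\<Sum>k<m. v a k * v b k) = G a b"
  using assms
proof (induction T arbitrary: G rule: finite_induct)
  case empty
  then show ?case by simp
next
  case (insert t T)
  have sym: "G t a = G a t" if "a \<in> T" for a using insert.prems(2)[of t a] that by auto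
  have quad: "0 \<le> (x t)\<^sup>2 * G t t + 2 * x t * (\<Sum>a\<in>T. x a * G a t)
      + (\<Sum>a\<in>T. \<Sum>b\<in>T. x a * x b * G a b)" for x
    using insert.prems(1)[of x] quadratic_form_insert[OF insert.hyps(1,2), of G x] sym by simp
  have same: "(\<Sum>a\<in>T. (x(t := s)) a * G a t) = (\<Sum>a\<in>T. x a * G a t)"
    "(\<Sum>a\<in>T. \<Sum>b\<in>T. (x(t := s)) a * (x(t := s)) b * G a b) = (\<Sum>a\<in>T. \<Sum>b\<in>T. x a * x b * G a b)"
    for x s using insert.hyps(2) by (auto intro!: sum.cong)
  have quad': "0 \<le> s\<^sup>2 * G t t + 2 * s * (\<Sum>a\<in>T. x a * G a t)
      + (\<Sum>a\<in>T. \<Sum>b\<in>T. x a * x b * G a b)" for x s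
    using quad[of "x(t := s)"] by (simp only: same fun_upd_same)
  have tt: "0 \<le> G t t" using quad'[of 1 "\<lambda>_. 0"] by simp
  show ?case
  proof (cases "G t t = 0")
    case True
    \<comment> \<open>With a zero pivot the form on the directions \<open>t\<close> and
      \<open>b\<close> is affine in the coefficient \<open>s\<close> of \<open>t\<close>. A nonzero
      slope is impossible: the value of \<open>s\<close> chosen below would make the form equal to
      -1.\<close>
    have z: "G b t = 0" if b: "b \<in> T" for b
    proof (rule ccontr)
      assume nz: "G b t \<noteq> 0"
      define x where "x = (\<lambda>a. if a = b then 1::real else 0)"
      have "(\<Sum>a\<in>T. x a * G a t) = G b t"
        using b insert.hyps(1) by (simp add: x_def if_distrib[of "\<lambda>z. z * _"] sum.delta' cong: if_cong)
      moreover have "(\<Sum>a\<in>T. \<Sum>b\<in>T. x a * x b * G a b) = G b b"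
        using b insert.hyps(1)
        by (simp add: x_def if_distrib[of "\<lambda>z. z * _"] if_distrib[of "\<lambda>z. _ * z"] cong: if_cong)
      ultimately have "0 \<le> 2 * s * G b t + G b b" for s
        using quad'[of s x] True by simp
      from this[of "- (G b b + 1) / (2 * G b t)"] nz show False by (simp add: field_simps)
    qed
    have "\<exists>(m::nat) v. \<forall>a\<in>T. \<forall>b\<in>T. (\<Sum>k<m. v a k * v b k) = G a b"
      using quad'[of 0] insert.prems(2) by (intro insert.IH) auto
    then obtain m :: nat and v where v: "\<forall>a\<in>T. \<forall>b\<in>T. (\<Sum>k<m. v a k * v b k) = G a b" by blast
    show ?thesis
      using v z sym True insert.hyps(2)
      by (intro exI[of _ m] exI[of _ "v(t := \<lambda>_. 0)"]) auto
  next
    case False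
    with tt have pos: "G t t > 0" by simp
    \<comment> \<open>The Schur complement of the pivot. Its form is the original form minimized
      over the coefficient of \<open>t\<close>, hence nonnegative.\<close>
    define H where "H a b = G a b - G a t * G b t / G t t" for a b
    have "0 \<le> (\<Sum>a\<in>T. \<Sum>b\<in>T. x a * x b * H a b)" for x
    proof -
      define s where "s = (\<Sum>a\<in>T. x a * G a t)"
      have "(\<Sum>a\<in>T. \<Sum>b\<in>T. x a * x b * H a b)
          = (\<Sum>a\<in>T. \<Sum>b\<in>T. x a * x b * G a b) - s * s / G t t"
        unfolding s_def sum_product sum_divide_distrib
        by (simp add: H_def algebra_simps sum_subtractf)
      moreover have "(- s / G t t)\<^sup>2 * G t t + 2 * (- s / G t t) * s = - (s * s / G t t)"
        using pos by (simp add: power2_eq_square field_simps)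
      ultimately show ?thesis
        using quad'[of "- s / G t t" x] unfolding s_def[symmetric] by linarith
    qed
    moreover have "H a b = H b a" if "a \<in> T" "b \<in> T" for a b
      using insert.prems(2) that by (simp add: H_def)
    ultimately obtain m :: nat and v where v: "\<forall>a\<in>T. \<forall>b\<in>T. (\<Sum>k<m. v a k * v b k) = H a b"
      using insert.IH[of H] by blast
    \<comment> \<open>The new coordinate \<open>m\<close> holds the Cholesky column of the pivot,
      and \<open>t\<close> has no other coordinate.\<close>
    define w where "w a k = (if a = t then (if k = m then sqrt (G t t) else 0)
      else if k = m then G a t / sqrt (G t t) else v a k)" for a k
    have wT: "(\<Sum>k<m. w a k * w b k) = (if a = t \<or> b = t then 0 else (\<Sum>k<m. v a k * v b k))" for a b
      by (auto simp: w_def intro!: sum.neutral)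
    have "(\<Sum>k<Suc m. w a k * w b k) = G a b" if "a \<in> insert t T" "b \<in> insert t T" for a b
      using that v pos sym insert.hyps(2) tt
      by (auto simp: wT) (auto simp: w_def H_def)
    then show ?thesis by blast
  qed
qed

text \<open>Vectors of the Fock space with \<open>m\<close> modes are functions on the lists of length \<open>m\<close>; the head
  of the list is the occupation number of the mode \<open>m - 1\<close>.\<close>

primrec annih :: "nat \<Rightarrow> (nat \<Rightarrow> real) \<Rightarrow> (bool list \<Rightarrow> real) \<Rightarrow> bool list \<Rightarrow> real" where
  "annih 0 c f s = 0"
| "annih (Suc m) c f s = (case s of [] \<Rightarrow> 0 | b # t \<Rightarrow>
     if b then - annih m c (\<lambda>t. f (True # t)) t
     else c m * f (True # t) + annih m c (\<lambda>t. f (False # t)) t)"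

text \<open>The minus for an occupied head is the Jordan-Wigner sign: reaching a lower mode past an
  occupied one costs a sign, in \<open>annih\<close> as well, which makes operators on different
  modes anticommute.\<close>

primrec create :: "nat \<Rightarrow> (nat \<Rightarrow> real) \<Rightarrow> (bool list \<Rightarrow> real) \<Rightarrow> bool list \<Rightarrow> real" where
  "create 0 c f s = 0"
| "create (Suc m) c f s = (case s of [] \<Rightarrow> 0 | b # t \<Rightarrow>
     if b then c m * f (False # t) - create m c (\<lambda>t. f (True # t)) t
     else create m c (\<lambda>t. f (False # t)) t)"

primrec fock_inner :: "nat \<Rightarrow> (bool list \<Rightarrow> real) \<Rightarrow> (bool list \<Rightarrow> real) \<Rightarrow> real" where
  "fock_inner 0 f g = f [] * g []"
| "fock_inner (Suc m) f g = fock_inner m (\<lambda>t. f (True # t)) (\<lambda>t. g (True # t))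
     + fock_inner m (\<lambda>t. f (False # t)) (\<lambda>t. g (False # t))"

lemma annih_linear:
  "annih m c (\<lambda>s. f s + g s) s = annih m c f s + annih m c g s"
  "annih m c (\<lambda>s. f s - g s) s = annih m c f s - annih m c g s"
  "annih m c (\<lambda>s. - f s) s = - annih m c f s"
  "annih m c (\<lambda>s. r * f s) s = r * annih m c f s"
  by (induction m arbitrary: f g s) (auto split: list.split simp: algebra_simps)

lemma create_linear:
  "create m c (\<lambda>s. f s + g s) s = create m c f s + create m c g s"
  "create m c (\<lambda>s. f s - g s) s = create m c f s - create m c g s"
  "create m c (\<lambda>s. - f s) s = - create m c f s"
  "create m c (\<lambda>s. r * f s) s = r * create m c f s"
  by (induction m arbitrary: f g s) (auto split: list.split simp: algebra_simps)

lemma fock_inner_linear: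
  "fock_inner m (\<lambda>s. f s + g s) h = fock_inner m f h + fock_inner m g h"
  "fock_inner m (\<lambda>s. f s - g s) h = fock_inner m f h - fock_inner m g h"
  "fock_inner m (\<lambda>s. - f s) h = - fock_inner m f h"
  "fock_inner m (\<lambda>s. r * f s) h = r * fock_inner m f h"
  by (induction m arbitrary: f g h) (auto simp: algebra_simps)

lemma fock_inner_commute: "fock_inner m f g = fock_inner m g f"
  by (induction m arbitrary: f g) (auto simp: mult.commute)

lemma fock_inner_linear_right:
  "fock_inner m h (\<lambda>s. f s + g s) = fock_inner m h f + fock_inner m h g"
  "fock_inner m h (\<lambda>s. f s - g s) = fock_inner m h f - fock_inner m h g"
  "fock_inner m h (\<lambda>s. - f s) = - fock_inner m h f"
  "fock_inner m h (\<lambda>s. r * f s) = r * fock_inner m h f"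
  by (simp_all add: fock_inner_commute[of m h] fock_inner_linear)

lemma fock_inner_nonneg: "fock_inner m f f \<ge> 0"
  by (induction m arbitrary: f) auto

text \<open>States are functions on all lists, but only lists of length \<open>m\<close> are
  configurations of \<open>m\<close> modes, and the anticommutation relations are stated there. The
  congruence allows such equations to be substituted under an operator.\<close>

lemma fock_cong:
  assumes "\<And>s. length s = m \<Longrightarrow> f s = g s" and "length s = m"
  shows annih_cong: "annih m c f s = annih m c g s"
    and create_cong: "create m c f s = create m c g s"
proof -
  have *: "\<forall>s. length s = m \<longrightarrow> f s = g s \<Longrightarrow> length s = m \<Longrightarrow>
      annih m c f s = annih m c g s \<and> create m c f s = create m c g s" for f g
  proof (induction m arbitrary: f g s)
    case (Suc m)
    show ?case
    proof (cases s)
      case (Cons b t)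
      then show ?thesis
        using Suc.IH[of "\<lambda>t. f (True # t)" "\<lambda>t. g (True # t)" t]
          Suc.IH[of "\<lambda>t. f (False # t)" "\<lambda>t. g (False # t)" t] Suc.prems by auto
    qed (use Suc in auto)
  qed auto
  show "annih m c f s = annih m c g s" "create m c f s = create m c g s"
    using * assms by auto
qed

lemma annih_annih:
  "length s = m \<Longrightarrow> annih m c (annih m d f) s = - annih m d (annih m c f) s"
proof (induction m arbitrary: f s)
  case (Suc m)
  then obtain b t where s: "s = b # t" "length t = m" by (cases s) auto
  show ?case using Suc.IH[OF s(2)] by (auto simp: s annih_linear algebra_simps)
qed auto

text \<open>Canonical anticommutation relation. In each mode the product of coefficients comes from
  \<open>annih\<close> after \<open>create\<close> when the mode is empty and from the opposite
  order when it is occupied; terms mixing two modes cancel by the Jordan-Wigner sign.\<close>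

lemma annih_create:
  "length s = m \<Longrightarrow>
    annih m c (create m d f) s = (\<Sum>k<m. c k * d k) * f s - create m d (annih m c f) s"
proof (induction m arbitrary: f s)
  case (Suc m)
  then obtain b t where s: "s = b # t" "length t = m" by (cases s) auto
  show ?case using Suc.IH[OF s(2)] by (auto simp: s annih_linear create_linear algebra_simps)
qed auto

lemma fock_adjoint: "fock_inner m (create m c f) g = fock_inner m f (annih m c g)"
  by (induction m arbitrary: f g)
    (auto simp: fock_inner_linear fock_inner_linear_right algebra_simps)

text \<open>The anticommutation relation paired with \<open>f\<close>. Both summands are
  nonnegative, so each operator is bounded by the Euclidean norm of \<open>c\<close>, with no
  dependence on the number of modes. This replaces the counting of pairings.\<close>

lemma annih_create_norm:
  "fock_inner m (annih m c f) (annih m c f) + fock_inner m (create m c f) (create m c f)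
    = (\<Sum>k<m. (c k)\<^sup>2) * fock_inner m f f"
proof (induction m arbitrary: f)
  case (Suc m)
  let ?t = "\<lambda>t. f (True # t)" and ?f = "\<lambda>t. f (False # t)"
  have adj: "fock_inner m (annih m c ?f) ?t = fock_inner m (create m c ?t) ?f"
    by (metis fock_adjoint fock_inner_commute)
  show ?case using Suc.IH[of ?t] Suc.IH[of ?f] adj
    by (simp add: fock_inner_linear fock_inner_linear_right power2_eq_square
        fock_inner_commute[of m ?t "annih m c ?f"] fock_inner_commute[of m ?f "create m c ?t"]
        algebra_simps)
qed auto

definition fock_vacuum :: "bool list \<Rightarrow> real" where
  "fock_vacuum s = (if True \<in> set s then 0 else 1)"

lemma annih_zero: "annih m c (\<lambda>_. 0) s = 0"
  by (induction m arbitrary: s) (auto split: list.split)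

lemma annih_vacuum: "annih m c fock_vacuum s = 0"
proof (induction m arbitrary: s)
  case (Suc m)
  have "(\<lambda>t. fock_vacuum (True # t)) = (\<lambda>_. 0)" "(\<lambda>t. fock_vacuum (False # t)) = fock_vacuum"
    by (auto simp: fock_vacuum_def)
  then show ?case using Suc by (auto split: list.split simp: annih_zero fock_vacuum_def)
qed auto

lemma fock_inner_zero: "fock_inner m (\<lambda>_. 0) f = 0"
  by (induction m arbitrary: f) auto

lemma fock_vacuum_norm: "fock_inner m fock_vacuum fock_vacuum = 1"
proof (induction m)
  case (Suc m)
  have "(\<lambda>t. fock_vacuum (True # t)) = (\<lambda>_. 0)" "(\<lambda>t. fock_vacuum (False # t)) = fock_vacuum"
    by (auto simp: fock_vacuum_def)
  then show ?case using Suc by (simp add: fock_inner_zero)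
qed (auto simp: fock_vacuum_def)

lemma create_empty: "create m c f (replicate m False) = 0"
  by (induction m arbitrary: f) auto

lemma fock_component_bound: "(f (replicate m False))\<^sup>2 \<le> fock_inner m f f"
proof (induction m arbitrary: f)
  case (Suc m)
  show ?case
    using Suc.IH[of "\<lambda>t. f (False # t)"] fock_inner_nonneg[of m "\<lambda>t. f (True # t)"] by auto
qed (auto simp: power2_eq_square)

text \<open>Annihilation and creation coefficients are chosen separately: the contraction of a field
  with a later one pairs the \<open>c\<close> of the first with the \<open>d\<close> of the second,
  so antisymmetric two-point functions can be realized.\<close>

definition fock_field ::
  "nat \<Rightarrow> (nat \<Rightarrow> real) \<Rightarrow> (nat \<Rightarrow> real) \<Rightarrow> (bool list \<Rightarrow> real) \<Rightarrow> bool list \<Rightarrow> real" where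
  "fock_field m c d f s = annih m c f s + create m d f s"

text \<open>By the parallelogram identity the squared norm of a sum is at most twice the sum of the
  squared norms; each of the two parts then contributes \<open>2 * K\<close>.\<close>

lemma fock_field_norm:
  assumes "(\<Sum>k<m. (c k)\<^sup>2) \<le> K" "(\<Sum>k<m. (d k)\<^sup>2) \<le> K"
  shows "fock_inner m (fock_field m c d f) (fock_field m c d f) \<le> 4 * K * fock_inner m f f"
proof -
  let ?a = "annih m c f" and ?b = "create m d f"
  have e: "fock_field m c d f = (\<lambda>s. ?a s + ?b s)" by (simp add: fock_field_def fun_eq_iff)
  have "fock_inner m (\<lambda>s. ?a s + ?b s) (\<lambda>s. ?a s + ?b s)
      + fock_inner m (\<lambda>s. ?a s - ?b s) (\<lambda>s. ?a s - ?b s)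
      = 2 * fock_inner m ?a ?a + 2 * fock_inner m ?b ?b"
    by (simp add: fock_inner_linear fock_inner_linear_right)
  moreover have "fock_inner m ?a ?a \<le> K * fock_inner m f f"
    using annih_create_norm[of m c f] fock_inner_nonneg[of m "create m c f"]
      mult_right_mono[OF assms(1) fock_inner_nonneg[of m f]] by linarith
  moreover have "fock_inner m ?b ?b \<le> K * fock_inner m f f"
    using annih_create_norm[of m d f] fock_inner_nonneg[of m "annih m d f"]
      mult_right_mono[OF assms(2) fock_inner_nonneg[of m f]] by linarith
  ultimately show ?thesis
    using fock_inner_nonneg[of m "\<lambda>s. ?a s - ?b s"] by (simp add: e)
qed

lemma fock_field_sum:
  "fock_field m c d (\<lambda>s. \<Sum>k\<in>A. r k * f k s) s = (\<Sum>k\<in>A. r k * fock_field m c d (f k) s)"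
proof (induction A rule: infinite_finite_induct)
  case (insert a A)
  then show ?case by (simp add: fock_field_def annih_linear create_linear algebra_simps)
qed (use annih_linear(4)[of m c 0] create_linear(4)[of m d 0] in \<open>simp_all add: fock_field_def\<close>)

lemma fock_field_cong:
  "(\<And>s. length s = m \<Longrightarrow> f s = g s) \<Longrightarrow> length s = m \<Longrightarrow> fock_field m c d f s = fock_field m c d g s"
  by (simp add: fock_field_def annih_cong[of m f g] create_cong[of m f g])

context
  fixes m :: nat and p q :: "'a \<Rightarrow> nat \<Rightarrow> real"
begin

definition fock_state :: "'a list \<Rightarrow> bool list \<Rightarrow> real" where
  "fock_state l = foldr (\<lambda>a. fock_field m (p a) (q a)) l fock_vacuum"

lemma fock_state_simps:
  "fock_state [] = fock_vacuum"
  "fock_state (a # l) = fock_field m (p a) (q a) (fock_state l)"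
  by (simp_all add: fock_state_def)

text \<open>Anticommuting the annihilator to the right reproduces the recursion of \<open>wick\<close>.\<close>

lemma annih_fock_state:
  "length s = m \<Longrightarrow> annih m (p a) (fock_state l) s =
    (\<Sum>k<length l. (- 1) ^ k * (\<Sum>j<m. p a j * q (l ! k) j)
      * fock_state (take k l @ drop (Suc k) l) s)"
proof (induction l arbitrary: s)
  case Nil
  then show ?case by (simp add: fock_state_simps annih_vacuum)
next
  case (Cons b l)
  let ?c = "\<lambda>k. (- 1) ^ k * (\<Sum>j<m. p a j * q (l ! k) j)"
  have "annih m (p a) (fock_state (b # l)) s
      = annih m (p a) (annih m (p b) (fock_state l)) s + annih m (p a) (create m (q b) (fock_state l)) s"
    by (simp add: fock_state_simps fock_field_def[abs_def] annih_linear)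
  also have "\<dots> = (\<Sum>j<m. p a j * q b j) * fock_state l s
      - fock_field m (p b) (q b) (annih m (p a) (fock_state l)) s"
    by (simp add: annih_annih[OF Cons.prems, of "p a"] annih_create[OF Cons.prems] fock_field_def)
  also have "fock_field m (p b) (q b) (annih m (p a) (fock_state l)) s
      = fock_field m (p b) (q b)
          (\<lambda>s. \<Sum>k<length l. ?c k * fock_state (take k l @ drop (Suc k) l) s) s"
    by (rule fock_field_cong) (use Cons in auto)
  also have "\<dots> = (\<Sum>k<length l. ?c k * fock_state (b # take k l @ drop (Suc k) l) s)"
    by (simp add: fock_field_sum fock_state_simps)
  finally show ?case
    by (simp add: sum.lessThan_Suc_shift sum_negf del: sum.lessThan_Suc)
qed

lemma fock_state_norm:
  assumes "\<And>a. a \<in> set l \<Longrightarrow> (\<Sum>k<m. (p a k)\<^sup>2) \<le> K \<and> (\<Sum>k<m. (q a k)\<^sup>2) \<le> K" and "K \<ge> 0"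
  shows "fock_inner m (fock_state l) (fock_state l) \<le> (4 * K) ^ length l"
  using assms(1)
proof (induction l)
  case Nil
  then show ?case by (simp add: fock_state_simps fock_vacuum_norm)
next
  case (Cons a l)
  have "fock_inner m (fock_state (a # l)) (fock_state (a # l))
      \<le> 4 * K * fock_inner m (fock_state l) (fock_state l)"
    using Cons.prems[of a] by (simp add: fock_state_simps fock_field_norm)
  also have "\<dots> \<le> 4 * K * (4 * K) ^ length l"
    using Cons assms(2) by (intro mult_left_mono) auto
  finally show ?case by simp
qed

end

text \<open>The value at the all-empty list is the vacuum expectation. The creator in the first
  field contributes nothing to it, and moving the annihilator to the right gives exactly the
  expansion along the first field. Only contractions among fields of \<open>T\<close> have to be
  realized, so finitely many modes suffice for a word.\<close>

lemma wick_eq_fock: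
  assumes "\<And>a b. a \<in> T \<Longrightarrow> b \<in> T \<Longrightarrow> two_point \<Lambda> a b = of_real (\<Sum>k<m. p a k * q b k)"
    and "set l \<subseteq> T"
  shows "wick \<Lambda> l = of_real (fock_state m p q l (replicate m False))"
  using assms(2)
proof (induction \<Lambda>\<equiv>\<Lambda> l rule: wick.induct)
  case 1
  then show ?case by (simp add: fock_state_simps fock_vacuum_def)
next
  case (2 a l)
  have sub: "set (take k l @ drop (Suc k) l) \<subseteq> T" for k
    using 2(2) set_take_subset[of k l] set_drop_subset[of "Suc k" l] by auto
  have "fock_state m p q (a # l) (replicate m False)
      = annih m (p a) (fock_state m p q l) (replicate m False)"
    by (simp add: fock_state_simps fock_field_def create_empty)
  moreover have "wick \<Lambda> (a # l) = of_real (\<Sum>k<length l. (- 1) ^ k * (\<Sum>j<m. p a j * q (l ! k) j)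
      * fock_state m p q (take k l @ drop (Suc k) l) (replicate m False))"
  proof -
    have "two_point \<Lambda> a (l ! k) = of_real (\<Sum>j<m. p a j * q (l ! k) j)" if "k < length l" for k
      using 2(2) that nth_mem[OF that] by (intro assms(1)) auto
    then show ?thesis using 2(1) sub by simp
  qed
  ultimately show ?case by (simp add: annih_fock_state)
qed

section \<open>Convergence of the fermionic perturbation series\<close>

definition bounded_test :: "real \<Rightarrow> (real^4 \<Rightarrow> real) \<Rightarrow> bool" where
  "bounded_test K g \<longleftrightarrow> g \<in> borel_measurable borel \<and> (\<forall>x. \<bar>g x\<bar> \<le> K)"

primrec fermi_test :: "'n fermi \<Rightarrow> real^4 \<Rightarrow> real" where
  "fermi_test (Fermi s g) = g"
| "fermi_test (Fermi_bar s g) = g"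

primrec fermi_kind :: "'n fermi \<Rightarrow> bool \<times> 'n species" where
  "fermi_kind (Fermi s g) = (False, s)"
| "fermi_kind (Fermi_bar s g) = (True, s)"

primrec fermi_conj :: "'n fermi \<Rightarrow> 'n fermi" where
  "fermi_conj (Fermi s g) = Fermi_bar s g"
| "fermi_conj (Fermi_bar s g) = Fermi s g"

lemma bounded_test_product_integrable:
  assumes "bounded_test K g" "bounded_test K h"
  shows "set_integrable lborel (torus \<Lambda>) (\<lambda>z. g z * h z)"
  unfolding set_integrable_def
proof (rule integrableI_bounded_set_indicator[where B = "K * K"])
  show "torus \<Lambda> \<in> sets lborel" by simp
  show "(\<lambda>z. g z * h z) \<in> borel_measurable lborel" using assms by (auto simp: bounded_test_def)
  show "emeasure lborel (torus \<Lambda>) < \<infinity>" using emeasure_compact_finite[OF torus_compact] by simp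
  have "0 \<le> K" using assms abs_ge_zero[of "g 0"] unfolding bounded_test_def by (meson order_trans)
  then show "AE x in lborel. x \<in> torus \<Lambda> \<longrightarrow> norm (g x * h x) \<le> K * K"
    using assms by (auto simp: bounded_test_def abs_mult intro!: mult_mono)
qed

text \<open>Moving the sums under the integral gives the integral of a square. Boundedness and
  measurability of the test functions justify the exchange.\<close>

lemma L2_inner_quadratic_form:
  assumes "finite S" "\<And>a. a \<in> S \<Longrightarrow> bounded_test K (g a)"
  shows "0 \<le> (\<Sum>a\<in>S. \<Sum>b\<in>S. x a * x b * L2_inner \<Lambda> (g a) (g b))"
proof -
  have int: "set_integrable lborel (torus \<Lambda>) (\<lambda>z. x a * x b * (g a z * g b z))"
    if "a \<in> S" "b \<in> S" for a b
    using bounded_test_product_integrable[of K "g a" "g b"] assms(2) that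
    by (intro set_integrable_mult_right) auto
  have "(\<Sum>a\<in>S. \<Sum>b\<in>S. x a * x b * L2_inner \<Lambda> (g a) (g b))
      = (\<Sum>a\<in>S. \<Sum>b\<in>S. LINT z:torus \<Lambda>|lborel. x a * x b * (g a z * g b z))"
    by (simp add: L2_inner_def torus_integral_def)
  also have "\<dots> = (LINT z:torus \<Lambda>|lborel. \<Sum>a\<in>S. \<Sum>b\<in>S. x a * x b * (g a z * g b z))"
    using int unfolding set_integrable_def set_lebesgue_integral_def scaleR_sum_right
    by (subst Bochner_Integration.integral_sum, force)
      (auto intro!: sum.cong Bochner_Integration.integral_sum[symmetric])
  also have "\<dots> = (LINT z:torus \<Lambda>|lborel. (\<Sum>a\<in>S. x a * g a z)\<^sup>2)"
    by (simp add: power2_eq_square sum_product mult_ac)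
  also have "\<dots> \<ge> 0"
    by (simp add: set_lebesgue_integral_def integral_nonneg_AE)
  finally show ?thesis .
qed

lemma L2_inner_self_bound:
  assumes "bounded_test K g"
  shows "L2_inner \<Lambda> g g \<le> K\<^sup>2 * measure lborel (torus \<Lambda>)"
proof -
  have "norm (g x \<bullet> g x) \<le> K\<^sup>2" for x
    using assms power_mono[of "\<bar>g x\<bar>" K 2] by (simp add: bounded_test_def power2_eq_square)
  then show ?thesis
    unfolding L2_inner_def
    using torus_integral_norm_bound[of \<Lambda> "\<lambda>x. g x \<bullet> g x" "K\<^sup>2"] by auto
qed

text \<open>Two-point functions are, up to sign, entries of a Gram matrix of test functions, so Gram
  vectors supply the coefficients of Fock space fields with these contractions. The number of modes
  depends on \<open>l\<close>, but each coefficient vector has squared length at most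
  \<open>K\<^sup>2\<close> times the volume, and the field norms see only this.\<close>

lemma wick_bound:
  fixes l :: "'n fermi list"
  assumes "\<And>a. a \<in> set l \<Longrightarrow> bounded_test K (fermi_test a)"
  shows "cmod (wick \<Lambda> l) \<le> sqrt (4 * (K\<^sup>2 * measure lborel (torus \<Lambda>))) ^ length l"
proof -
  define c where "c = K\<^sup>2 * measure lborel (torus \<Lambda>)"
  \<comment> \<open>Closed under conjugation, since the annihilation part of a field will use the
    Gram vector of its conjugate.\<close>
  define T where "T = set l \<union> fermi_conj ` set l"
  \<comment> \<open>Fields of different kinds are declared orthogonal. The matrix is then block
    diagonal with one Gram matrix of test functions per kind, hence positive semidefinite.\<close>
  define G where "G a b = (if fermi_kind a = fermi_kind b
    then L2_inner \<Lambda> (fermi_test a) (fermi_test b) else 0)" for a b :: "'n fermi"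
  have cc: "fermi_conj (fermi_conj a) = a" "fermi_test (fermi_conj a) = fermi_test a" for a :: "'n fermi"
    by (cases a; simp)+
  have fin: "finite T" by (simp add: T_def)
  have T: "bounded_test K (fermi_test a)" if "a \<in> T" for a
    using that assms by (auto simp: T_def cc)
  have conjT: "fermi_conj a \<in> T" if "a \<in> T" for a using that by (auto simp: T_def cc)
  have psd: "0 \<le> (\<Sum>a\<in>T. \<Sum>b\<in>T. x a * x b * G a b)" for x
  proof -
    have "(\<Sum>a\<in>T. \<Sum>b\<in>T. x a * x b * G a b)
        = (\<Sum>a\<in>T. \<Sum>b\<in>{b\<in>T. fermi_kind b = fermi_kind a}.
            x a * x b * L2_inner \<Lambda> (fermi_test a) (fermi_test b))"
      unfolding sum.inter_filter[OF fin] by (intro sum.cong refl) (auto simp: G_def)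
    also have "\<dots> = (\<Sum>c\<in>fermi_kind ` T. \<Sum>a\<in>{a\<in>T. fermi_kind a = c}.
        \<Sum>b\<in>{b\<in>T. fermi_kind b = fermi_kind a}. x a * x b * L2_inner \<Lambda> (fermi_test a) (fermi_test b))"
      by (rule sum.group[symmetric]) (use fin in auto)
    also have "\<dots> = (\<Sum>c\<in>fermi_kind ` T. \<Sum>a\<in>{a\<in>T. fermi_kind a = c}.
        \<Sum>b\<in>{b\<in>T. fermi_kind b = c}. x a * x b * L2_inner \<Lambda> (fermi_test a) (fermi_test b))"
      by (intro sum.cong refl) auto
    also have "\<dots> \<ge> 0"
      using fin T by (intro sum_nonneg L2_inner_quadratic_form[where K = K]) auto
    finally show ?thesis .
  qed
  have sym: "G a b = G b a" for a b
    by (simp add: G_def L2_inner_def mult.commute)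
  obtain m :: nat and v where v: "\<And>a b. a \<in> T \<Longrightarrow> b \<in> T \<Longrightarrow> (\<Sum>k<m. v a k * v b k) = G a b"
    using gram_vectors[OF fin, of G] psd sym by blast
  \<comment> \<open>A field contracts exactly with fields of the kind of its own conjugate. The
    minus sign for \<open>Fermi_bar\<close> is the antisymmetry of \<open>two_point\<close>.\<close>
  define p where "p a k = (case a of Fermi _ _ \<Rightarrow> v (fermi_conj a) k
    | Fermi_bar _ _ \<Rightarrow> - v (fermi_conj a) k)" for a k
  have tp: "two_point \<Lambda> a b = of_real (\<Sum>k<m. p a k * v b k)" if "a \<in> T" "b \<in> T" for a b
  proof -
    have "(\<Sum>k<m. p a k * v b k)
        = (case a of Fermi _ _ \<Rightarrow> G (fermi_conj a) b | Fermi_bar _ _ \<Rightarrow> - G (fermi_conj a) b)"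
      using v[OF conjT[OF that(1)] that(2)] by (cases a) (simp_all add: p_def sum_negf)
    then show ?thesis by (cases a; cases b) (auto simp: G_def)
  qed
  have v2: "(\<Sum>k<m. (v a k)\<^sup>2) \<le> c" if "a \<in> T" for a
    using v[OF that that] L2_inner_self_bound[OF T[OF that], of \<Lambda>]
    by (simp add: G_def c_def power2_eq_square)
  have p2: "(\<Sum>k<m. (p a k)\<^sup>2) \<le> c" if "a \<in> T" for a
    using v2[OF conjT[OF that]] by (cases a) (simp_all add: p_def)
  have c0: "c \<ge> 0" by (simp add: c_def)
  let ?f = "fock_state m p v l"
  have "(?f (replicate m False))\<^sup>2 \<le> fock_inner m ?f ?f" by (rule fock_component_bound)
  also have "\<dots> \<le> (4 * c) ^ length l"
    by (rule fock_state_norm) (use v2 p2 c0 in \<open>auto simp: T_def\<close>)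
  also have "\<dots> = (sqrt (4 * c) ^ length l)\<^sup>2"
    using c0 power_mult[of "sqrt (4 * c)" 2 "length l"] power_mult[of "sqrt (4 * c)" "length l" 2]
    by (simp add: mult.commute)
  finally have "\<bar>?f (replicate m False)\<bar> \<le> sqrt (4 * c) ^ length l"
    using c0 by (simp add: power2_le_iff_abs_le)
  moreover have "wick \<Lambda> l = of_real (?f (replicate m False))"
    by (rule wick_eq_fock[where T = T]) (use tp in \<open>auto simp: T_def\<close>)
  ultimately show ?thesis by (simp add: c_def)
qed

section \<open>Norms of functionals on words\<close>

text \<open>A dual norm: \<open>X\<close> is measured against the supremum of \<open>G\<close> over
  words of length \<open>l\<close> with letters in \<open>F\<close>. Products of functionals are
  compositions, so their bounds multiply and their word lengths add.\<close>

definition poly_bound :: "'n fermi set \<Rightarrow> nat \<Rightarrow> real \<Rightarrow> 'n fermi_poly \<Rightarrow> bool" where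
  "poly_bound F l K X \<longleftrightarrow> (\<forall>G B. 0 \<le> B \<longrightarrow>
     (\<forall>w. length w = l \<and> set w \<subseteq> F \<longrightarrow> cmod (G w) \<le> B) \<longrightarrow> cmod (X G) \<le> K * B)"

lemma poly_boundD:
  "poly_bound F l K X \<Longrightarrow> 0 \<le> B \<Longrightarrow> (\<And>w. length w = l \<Longrightarrow> set w \<subseteq> F \<Longrightarrow> cmod (G w) \<le> B)
    \<Longrightarrow> cmod (X G) \<le> K * B"
  unfolding poly_bound_def by blast

lemma poly_bound_mult:
  assumes "poly_bound F l K X" "poly_bound F l' K' Y" "K' \<ge> 0"
  shows "poly_bound F (l + l') (K * K') (fermi_mult X Y)"
  unfolding poly_bound_def
proof (intro allI impI)
  fix G and B :: real
  assume B: "0 \<le> B" "\<forall>w. length w = l + l' \<and> set w \<subseteq> F \<longrightarrow> cmod (G w) \<le> B"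
  have "cmod (Y (\<lambda>v. G (u @ v))) \<le> K' * B" if "length u = l" "set u \<subseteq> F" for u
    by (rule poly_boundD[OF assms(2) B(1)]) (use B(2) that in auto)
  then have "cmod (X (\<lambda>u. Y (\<lambda>v. G (u @ v)))) \<le> K * (K' * B)"
    using B(1) assms(3) by (intro poly_boundD[OF assms(1)]) auto
  then show "cmod (fermi_mult X Y G) \<le> K * K' * B" by (simp add: fermi_mult_def)
qed

lemma poly_bound_power:
  assumes "poly_bound F l K X" "K \<ge> 0"
  shows "poly_bound F (n * l) (K ^ n) (fermi_power X n)"
proof (induction n)
  case 0
  then show ?case by (simp add: poly_bound_def fermi_one_def)
next
  case (Suc n)
  then show ?case using poly_bound_mult[OF assms(1) Suc] assms(2) by (simp add: add.commute)
qed

lemma V_action_bound: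
  assumes "\<And>s x. conv_field_bar s h x \<in> F" "\<And>s x. conv_field_bar s k x \<in> F"
  shows "\<exists>K\<ge>0. poly_bound F 6 K (V_action br e \<Lambda> h k)"
proof -
  define S where "S = (\<Sum>a\<in>UNIV. \<Sum>b\<in>UNIV. \<Sum>c\<in>UNIV. \<Sum>i\<in>UNIV. \<Sum>j\<in>UNIV. \<Sum>l\<in>UNIV.
    \<bar>levi_civita i j l * structure_const br e a b c\<bar>)"
  have S0: "0 \<le> S" unfolding S_def by (intro sum_nonneg) auto
  have "poly_bound F 6 (1 / 2 * (S * measure lborel (torus \<Lambda>))) (V_action br e \<Lambda> h k)"
    unfolding poly_bound_def
  proof (intro allI impI)
    fix G and B :: real
    assume B: "0 \<le> B" "\<forall>w. length w = 6 \<and> set w \<subseteq> F \<longrightarrow> cmod (G w) \<le> B"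
    have G: "cmod (G [conv_field_bar s1 k x, conv_field_bar s2 h x, conv_field_bar s3 k x,
        conv_field_bar s4 h x, conv_field_bar s5 k x, conv_field_bar s6 h x]) \<le> B"
      for s1 s2 s3 s4 s5 s6 x
      using B(2) assms by auto
    have "cmod (V_action br e \<Lambda> h k G) \<le> 1 / 2 * ((S * B) * measure lborel (torus \<Lambda>))"
      unfolding V_action_def norm_mult
      apply (rule mult_mono)
         apply (simp add: norm_divide)
        apply (rule torus_integral_norm_bound)
      unfolding S_def sum_distrib_right
        apply (intro sum_norm_le)
        apply (use G in \<open>auto simp: norm_mult abs_mult intro!: mult_left_mono\<close>)
      done
    then show "cmod (V_action br e \<Lambda> h k G) \<le> 1 / 2 * (S * measure lborel (torus \<Lambda>)) * B"
      by (simp add: mult_ac)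
  qed
  then show ?thesis using S0 by (intro exI conjI) auto
qed

text \<open>\<open>K\<close> precedes \<open>\<mu>\<close> and \<open>\<Phi>\<close> in the
  conclusion: these parameters enter only through the propagator, whose entries are at most
  \<open>P\<close>. The summand \<open>2 * P\<close> in \<open>S\<close> accounts for the doubled
  mixed term.\<close>

lemma Q_action_bound:
  fixes e :: "'n::finite \<Rightarrow> 'g::euclidean_space"
  assumes F: "\<And>s x. conv_field s h x \<in> F"
    and P: "\<And>\<mu> \<Phi> x y r s. x \<in> torus \<Lambda> \<Longrightarrow> y \<in> torus \<Lambda>
      \<Longrightarrow> cmod (propagator br e \<Lambda> \<kappa> \<mu> \<Phi> x y $ r $ s) \<le> P"
    and P0: "P \<ge> 0"
  shows "\<exists>K\<ge>0. \<forall>\<mu> \<Phi>. poly_bound F 4 K (Q_action br e \<Lambda> \<kappa> \<mu> \<Phi> h)"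
proof -
  define S where "S = (\<Sum>a\<in>(UNIV::'n set). \<Sum>b\<in>(UNIV::'n set). \<Sum>i\<in>(UNIV::3 set). \<Sum>j\<in>(UNIV::3 set).
    P + 2 * P + P)"
  have S0: "0 \<le> S" unfolding S_def using P0 by (intro sum_nonneg) auto
  let ?m = "measure lborel (torus \<Lambda> \<times> torus \<Lambda>)"
  have cmp: "compact (torus \<Lambda> \<times> torus \<Lambda>)" by (intro compact_Times torus_compact)
  have "poly_bound F 4 (S * ?m) (Q_action br e \<Lambda> \<kappa> \<mu> \<Phi> h)" for \<mu> \<Phi>
    unfolding poly_bound_def
  proof (intro allI impI)
    fix G and B :: real
    assume B: "0 \<le> B" "\<forall>w. length w = 4 \<and> set w \<subseteq> F \<longrightarrow> cmod (G w) \<le> B"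
    have G: "cmod (G [conv_field s1 h x, conv_field s2 h x, conv_field s3 h y, conv_field s4 h y]) \<le> B"
      for s1 s2 s3 s4 x y
      using B(2) F by auto
    have "cmod (Q_action br e \<Lambda> \<kappa> \<mu> \<Phi> h G) \<le> (S * B) * ?m"
      unfolding Q_action_def
    proof (rule set_integral_norm_bound)
      show "torus \<Lambda> \<times> torus \<Lambda> \<in> sets borel" using cmp by (simp add: compact_imp_closed)
      show "emeasure lborel (torus \<Lambda> \<times> torus \<Lambda>) < \<infinity>"
        using emeasure_compact_finite[OF cmp] by simp
      fix z assume "z \<in> torus \<Lambda> \<times> torus \<Lambda>"
      then obtain x y where z: "z = (x, y)" "x \<in> torus \<Lambda>" "y \<in> torus \<Lambda>" by auto
      show "norm (case z of (x, y) \<Rightarrow> \<Sum>a\<in>UNIV. \<Sum>b\<in>UNIV. \<Sum>i\<in>UNIV. \<Sum>j\<in>UNIV.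
         prop_AA br e \<Lambda> \<kappa> \<mu> \<Phi> x y a b i j *
           G [conv_field (H_sp i) h x, conv_field (Psi_sp a) h x,
              conv_field (H_sp j) h y, conv_field (Psi_sp b) h y]
         + 2 * prop_AF br e \<Lambda> \<kappa> \<mu> \<Phi> x y a b i j *
           G [conv_field (H_sp i) h x, conv_field (Psi_sp a) h x,
              conv_field (Eta_sp j) h y, conv_field (Lpsi_sp b) h y]
         + prop_FF br e \<Lambda> \<kappa> \<mu> \<Phi> x y a b i j *
           G [conv_field (Eta_sp i) h x, conv_field (Lpsi_sp a) h x,
              conv_field (Eta_sp j) h y, conv_field (Lpsi_sp b) h y]) \<le> S * B"
        unfolding z(1) prod.case S_def sum_distrib_right distrib_right
        by (intro sum_norm_le norm_triangle_mono)
          (use P[OF z(2,3)] G B(1) P0 in \<open>auto simp: norm_mult prop_AA_def prop_AF_def prop_FF_def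
            intro!: mult_mono\<close>)
    qed
    then show "cmod (Q_action br e \<Lambda> \<kappa> \<mu> \<Phi> h G) \<le> S * ?m * B" by (simp add: mult_ac)
  qed
  then show ?thesis using S0 by (intro exI[of _ "S * ?m"]) auto
qed

text \<open>Of the denominator \<open>fact (2 * n) * fact (3 * n)\<close> the proof keeps
  \<open>fact n\<close>, so the series is dominated by the exponential series at
  \<open>C * (cmod lam)\<^sup>2\<close>.\<close>

lemma Xi_series_bound:
  fixes e :: "'n::finite \<Rightarrow> 'g::euclidean_space"
  assumes h: "bounded_test K (delta_cutoff \<Lambda> \<zeta> \<epsilon>)" and k: "bounded_test K (D_cutoff \<Lambda> Z \<epsilon>)"
    and P: "\<And>\<mu> \<Phi> x y r s. x \<in> torus \<Lambda> \<Longrightarrow> y \<in> torus \<Lambda>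
      \<Longrightarrow> cmod (propagator br e \<Lambda> \<kappa> \<mu> \<Phi> x y $ r $ s) \<le> P"
    and P0: "P \<ge> 0"
  shows "\<exists>M :: nat \<Rightarrow> real.
    (\<forall>n. M n \<ge> 0) \<and>
    (\<forall>n (\<mu>::real) (\<Phi>::'g^3). cmod (Xi br e \<Lambda> \<zeta> Z \<kappa> \<epsilon> \<mu> \<Phi> n) \<le> M n) \<and>
    (\<forall>lam::complex. summable (\<lambda>n. M n * cmod lam ^ (2 * n)))"
proof -
  let ?h = "delta_cutoff \<Lambda> \<zeta> \<epsilon>" and ?k = "D_cutoff \<Lambda> Z \<epsilon>"
  define F where "F = {a :: 'n fermi. bounded_test K (fermi_test a)}"
  have shift: "bounded_test K (\<lambda>z. g (x - z))" if "bounded_test K g" for g and x :: "real^4"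
    using that unfolding bounded_test_def by (auto intro: measurable_compose[rotated])
  have F: "conv_field s ?h x \<in> F" "conv_field_bar s ?h x \<in> F" "conv_field_bar s ?k x \<in> F" for s x
    using shift h k by (auto simp: F_def conv_field_def conv_field_bar_def)
  obtain V where V: "V \<ge> 0" "poly_bound F 6 V (V_action br e \<Lambda> ?h ?k)"
    using V_action_bound[of ?h F ?k] F by blast
  obtain Q where Q: "Q \<ge> 0" "\<And>\<mu> \<Phi>. poly_bound F 4 Q (Q_action br e \<Lambda> \<kappa> \<mu> \<Phi> ?h)"
    using Q_action_bound[OF F(1) P P0] by blast
  define R where "R = sqrt (4 * (K\<^sup>2 * measure lborel (torus \<Lambda>)))"
  have R0: "R \<ge> 0" by (simp add: R_def)
  \<comment> \<open>The cost of raising \<open>n\<close> by one: two cubic vertices, three quadratic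
    terms, and 2 * 6 + 3 * 4 = 24 more fields in the word.\<close>
  define C where "C = V ^ 2 * Q ^ 3 * R ^ 24"
  have C0: "C \<ge> 0" using V(1) Q(1) R0 by (simp add: C_def)
  have bound: "cmod (Xi br e \<Lambda> \<zeta> Z \<kappa> \<epsilon> \<mu> \<Phi> n) \<le> C ^ n / fact n" for n \<mu> \<Phi>
  proof -
    have "poly_bound F (2 * n * 6 + 3 * n * 4) (V ^ (2 * n) * Q ^ (3 * n)) (fermi_mult
       (fermi_power (V_action br e \<Lambda> ?h ?k) (2 * n)) (fermi_power (Q_action br e \<Lambda> \<kappa> \<mu> \<Phi> ?h) (3 * n)))"
      using V Q by (intro poly_bound_mult poly_bound_power) auto
    from poly_boundD[OF this, of "R ^ (24 * n)" "wick \<Lambda>"]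
    have "cmod (berezin \<Lambda> (fermi_mult (fermi_power (V_action br e \<Lambda> ?h ?k) (2 * n))
        (fermi_power (Q_action br e \<Lambda> \<kappa> \<mu> \<Phi> ?h) (3 * n)))) \<le> V ^ (2 * n) * Q ^ (3 * n) * R ^ (24 * n)"
      unfolding berezin_def R_def
      using wick_bound[of _ K \<Lambda>] by (fastforce simp: F_def)
    also have "\<dots> = C ^ n" by (simp add: C_def power_mult power_mult_distrib)
    finally have *: "cmod (Xi br e \<Lambda> \<zeta> Z \<kappa> \<epsilon> \<mu> \<Phi> n) \<le> 1 / (fact (2 * n) * fact (3 * n)) * C ^ n"
      unfolding Xi_def norm_mult
      by (auto simp: norm_divide norm_mult norm_fact intro!: divide_right_mono)
    have "fact n \<le> (fact (2 * n) :: real)" by (rule fact_mono) simp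
    also have "\<dots> \<le> fact (2 * n) * fact (3 * n)" by simp
    finally have "1 / (fact (2 * n) * fact (3 * n)) * C ^ n \<le> 1 / fact n * C ^ n"
      using C0 by (intro mult_right_mono divide_left_mono) auto
    with * show ?thesis by simp
  qed
  have "summable (\<lambda>n. C ^ n / fact n * cmod lam ^ (2 * n))" for lam :: complex
  proof -
    have "(\<lambda>n. C ^ n / fact n * cmod lam ^ (2 * n)) = (\<lambda>n. inverse (fact n) * (C * (cmod lam)\<^sup>2) ^ n)"
      unfolding power_mult power_mult_distrib by (simp add: divide_inverse mult_ac)
    then show ?thesis using summable_exp[of "C * (cmod lam)\<^sup>2"] by simp
  qed
  then show ?thesis using bound C0 by (intro exI[of _ "\<lambda>n. C ^ n / fact n"]) auto
qed

section \<open>Periodized cut-off functions\<close>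

lemma finite_bounded_int_vectors: "finite {m :: int^'k. \<forall>i. \<bar>m $ i\<bar> \<le> B}"
proof -
  have "finite (vec_lambda ` (Pi\<^sub>E (UNIV :: 'k set) (\<lambda>_. {- B..B})))"
    by (intro finite_imageI finite_PiE) auto
  moreover have "{m :: int^'k. \<forall>i. \<bar>m $ i\<bar> \<le> B} \<subseteq> vec_lambda ` (Pi\<^sub>E UNIV (\<lambda>_. {- B..B}))"
  proof
    fix m :: "int^'k" assume "m \<in> {m. \<forall>i. \<bar>m $ i\<bar> \<le> B}"
    then have "vec_nth m \<in> Pi\<^sub>E UNIV (\<lambda>_. {- B..B})" by (auto simp: PiE_iff abs_le_iff minus_le_iff)
    then show "m \<in> vec_lambda ` (Pi\<^sub>E UNIV (\<lambda>_. {- B..B}))"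
      by (intro image_eqI[of _ _ "vec_nth m"]) (auto simp: vec_nth_inverse)
  qed
  ultimately show ?thesis by (rule finite_subset[rotated])
qed

context
  fixes \<Lambda> :: "real^4" and f :: "real^4 \<Rightarrow> real" and R :: real
  assumes pos: "\<And>i. \<Lambda> $ i > 0"
    and cont: "continuous_on UNIV f"
    and supp: "\<And>x i. \<bar>x $ i\<bar> \<ge> R \<Longrightarrow> f x = 0"
begin

text \<open>For \<open>x\<close> in a ball of radius \<open>N\<close> every translate with a large
  index lies outside the support of \<open>f\<close>, so on the ball the infinite sum is a fixed
  finite sum of continuous functions.\<close>

lemma periodize_continuous: "continuous_on UNIV (periodize \<Lambda> f)"
proof -
  have "continuous_on (ball 0 N) (periodize \<Lambda> f)" for N
  proof -
    \<comment> \<open>Summing nonnegative bounds over the directions gives one bound for all. An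
      index above \<open>B\<close> in direction \<open>i\<close> moves that coordinate by at least
      \<open>\<bar>R + N\<bar>\<close>, which leaves it at absolute value at least
      \<open>R\<close>.\<close>
    define B where "B = (\<Sum>i\<in>UNIV. \<lceil>\<bar>R + N\<bar> / (2 * \<Lambda> $ i)\<rceil>)"
    let ?S = "{m :: int^4. \<forall>i. \<bar>m $ i\<bar> \<le> B}"
    have eq: "periodize \<Lambda> f x = (\<Sum>m\<in>?S. f (\<chi> i. x $ i + 2 * \<Lambda> $ i * of_int (m $ i)))"
      if "x \<in> ball 0 N" for x
    proof -
      have "f (\<chi> i. x $ i + 2 * \<Lambda> $ i * of_int (m $ i)) = 0" if m: "m \<notin> ?S" for m
      proof -
        obtain i where i: "\<bar>m $ i\<bar> > B" using m by (auto simp: not_le)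
        have nn: "0 \<le> \<bar>R + N\<bar> / (2 * \<Lambda> $ i)" for i using pos[of i] by simp
        have "\<lceil>\<bar>R + N\<bar> / (2 * \<Lambda> $ i)\<rceil> \<le> B"
          unfolding B_def using less_le_trans[of "- 1 :: real", OF _ nn] by (intro member_le_sum) auto
        then have "\<bar>R + N\<bar> / (2 * \<Lambda> $ i) \<le> \<bar>of_int (m $ i)\<bar>"
          using i by linarith
        then have "\<bar>R + N\<bar> \<le> \<bar>of_int (m $ i)\<bar> * (2 * \<Lambda> $ i)"
          using pos[of i] by (simp add: pos_divide_le_eq)
        also have "\<dots> = \<bar>2 * \<Lambda> $ i * of_int (m $ i)\<bar>"
          using pos[of i] by (simp add: abs_mult)
        finally have "\<bar>R + N\<bar> \<le> \<bar>2 * \<Lambda> $ i * of_int (m $ i)\<bar>" .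
        moreover have "\<bar>x $ i\<bar> \<le> N"
          using \<open>x \<in> ball 0 N\<close> component_le_norm_cart[of x i] by simp
        ultimately show ?thesis by (intro supp[of _ i]) simp
      qed
      then have "periodize \<Lambda> f x = (\<Sum>\<^sub>\<infinity>m\<in>?S. f (\<chi> i. x $ i + 2 * \<Lambda> $ i * of_int (m $ i)))"
        unfolding periodize_def by (intro infsum_cong_neutral) auto
      then show ?thesis by (simp add: infsum_finite[OF finite_bounded_int_vectors])
    qed
    have "continuous_on (ball 0 N) (\<lambda>x. \<Sum>m\<in>?S. f (\<chi> i. x $ i + 2 * \<Lambda> $ i * of_int (m $ i)))"
      by (intro continuous_on_sum continuous_on_compose2[OF cont] continuous_intros) auto
    then show ?thesis using eq by (subst continuous_on_cong) auto
  qed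
  then have "continuous_on (\<Union>n::nat. ball 0 (real n)) (periodize \<Lambda> f)"
    by (intro continuous_on_open_UN) auto
  moreover have "(\<Union>n::nat. ball (0 :: real^4) (real n)) = UNIV"
    by (auto simp: reals_Archimedean2)
  ultimately show ?thesis by simp
qed

lemma periodize_periodic: "periodic \<Lambda> (periodize \<Lambda> f)"
  unfolding periodic_def
proof (intro allI)
  fix x :: "real^4" and i :: 4
  have "bij_betw (\<lambda>m :: int^4. m + axis i 1) UNIV UNIV"
    by (rule bij_betw_byWitness[where f' = "\<lambda>m. m - axis i 1"]) auto
  from infsum_reindex_bij_betw[OF this, of "\<lambda>m. f (\<chi> j. x $ j + 2 * \<Lambda> $ j * of_int (m $ j))"]
  have "(\<Sum>\<^sub>\<infinity>m\<in>UNIV. f (\<chi> j. x $ j + 2 * \<Lambda> $ j * of_int ((m + axis i 1) $ j))) = periodize \<Lambda> f x"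
    by (simp add: periodize_def)
  moreover have "(\<chi> j. x $ j + 2 * \<Lambda> $ j * of_int ((m + axis i 1) $ j))
      = (\<chi> j. (x + (2 * \<Lambda> $ i) *\<^sub>R axis i 1) $ j + 2 * \<Lambda> $ j * of_int (m $ j))" for m :: "int^4"
    by (auto simp: vec_eq_iff axis_def algebra_simps)
  ultimately show "periodize \<Lambda> f (x + (2 * \<Lambda> $ i) *\<^sub>R axis i 1) = periodize \<Lambda> f x"
    by (simp add: periodize_def)
qed

lemma periodize_bounded_test: "\<exists>K. bounded_test K (periodize \<Lambda> f)"
  using periodic_bounded[OF pos periodize_continuous periodize_periodic]
    borel_measurable_continuous_onI[OF periodize_continuous]
  by (auto simp: bounded_test_def)

end

lemma smooth_continuous: "smooth u \<Longrightarrow> continuous_on UNIV u"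
  unfolding smooth_def by (metis cont_diff.simps(1))

text \<open>Before periodization the supports lie in cubes of half-side
  \<open>\<epsilon> / 2\<close> and \<open>4 * \<epsilon>\<close>. Such a cube may exceed the torus,
  so translates may overlap; the bound comes from continuity and periodicity of the periodized
  function instead of from the profile.\<close>

lemma cutoffs_bounded_test:
  assumes "\<And>i. \<Lambda> $ i > 0" "zeta_profile \<zeta>" "Z_profile Z" "\<epsilon> > 0"
  shows "\<exists>K. bounded_test K (delta_cutoff \<Lambda> \<zeta> \<epsilon>) \<and> bounded_test K (D_cutoff \<Lambda> Z \<epsilon>)"
proof -
  have c: "continuous_on UNIV \<zeta>" "continuous_on UNIV Z"
    using assms(2,3) by (auto simp: zeta_profile_def Z_profile_def smooth_continuous)
  \<comment> \<open>The profile is prescribed to vanish only from 1 on to the right; evenness gives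
    the left side.\<close>
  have \<zeta>0: "\<zeta> t = 0" if "\<bar>t\<bar> \<ge> 1" for t
    using that assms(2) unfolding zeta_profile_def by (metis abs_if)
  have "(2 / \<epsilon>) ^ 4 * (\<Prod>i\<in>UNIV. \<zeta> (2 * x $ i / \<epsilon>)) = 0" if "\<epsilon> / 2 \<le> \<bar>x $ i\<bar>" for x :: "real^4" and i
    using \<zeta>0[of "2 * x $ i / \<epsilon>"] that assms(4)
    by (intro mult_eq_0_iff[THEN iffD2] disjI2 prod_zero) (auto simp: abs_mult field_simps)
  then have "\<exists>K. bounded_test K (delta_cutoff \<Lambda> \<zeta> \<epsilon>)"
    unfolding delta_cutoff_def
    by (intro periodize_bounded_test[of _ _ "\<epsilon> / 2"])
      (use assms in \<open>auto intro!: continuous_intros continuous_on_compose2[OF c(1)]\<close>)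
  then obtain K where K: "bounded_test K (delta_cutoff \<Lambda> \<zeta> \<epsilon>)" by blast
  have Z0: "Z t = 0" if "\<bar>t\<bar> \<ge> 2" for t
    using that assms(3) unfolding Z_profile_def by blast
  have "(\<Prod>i\<in>UNIV. Z (x $ i / (2 * \<epsilon>))) = 0" if "4 * \<epsilon> \<le> \<bar>x $ i\<bar>" for x :: "real^4" and i
    using Z0[of "x $ i / (2 * \<epsilon>)"] that assms(4)
    by (intro prod_zero) (auto simp: abs_mult field_simps)
  then have "\<exists>K. bounded_test K (D_cutoff \<Lambda> Z \<epsilon>)"
    unfolding D_cutoff_def
    by (intro periodize_bounded_test[of _ _ "4 * \<epsilon>"])
      (use assms in \<open>auto intro!: continuous_intros continuous_on_compose2[OF c(2)]\<close>)
  then obtain K' where K': "bounded_test K' (D_cutoff \<Lambda> Z \<epsilon>)" by blast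
  have "bounded_test (max K K') (delta_cutoff \<Lambda> \<zeta> \<epsilon>)" "bounded_test (max K K') (D_cutoff \<Lambda> Z \<epsilon>)"
    using K K' by (auto simp: bounded_test_def max.coboundedI1 max.coboundedI2)
  then show ?thesis by blast
qed

section \<open>Trigonometric polynomials\<close>

definition dual_lattice :: "real^4 \<Rightarrow> (real^4) set" where
  "dual_lattice \<Lambda> = {p. \<forall>i. \<exists>m::int. p $ i = pi / \<Lambda> $ i * of_int m}"

lemma momenta_subset_lattice: "momenta \<Lambda> \<kappa> \<subseteq> dual_lattice \<Lambda>"
  unfolding momenta_def dual_lattice_def by blast

lemma dual_lattice_diff:
  assumes "p \<in> dual_lattice \<Lambda>" "q \<in> dual_lattice \<Lambda>"
  shows "p - q \<in> dual_lattice \<Lambda>"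
  unfolding dual_lattice_def
proof (clarify)
  fix i
  obtain m n :: int where "p $ i = pi / \<Lambda> $ i * of_int m" "q $ i = pi / \<Lambda> $ i * of_int n"
    using assms unfolding dual_lattice_def by blast
  then show "\<exists>m::int. (p - q) $ i = pi / \<Lambda> $ i * of_int m"
    by (intro exI[of _ "m - n"]) (simp add: algebra_simps diff_divide_distrib)
qed

lemma zero_dual_lattice: "0 \<in> dual_lattice \<Lambda>"
  unfolding dual_lattice_def by (auto intro: exI[of _ 0])

lemma momenta_alt: "momenta \<Lambda> \<kappa> = dual_lattice \<Lambda> \<inter> {p. \<forall>i. \<bar>p $ i\<bar> < \<kappa>}"
  unfolding momenta_def dual_lattice_def by blast

lemma momenta_uminus: "p \<in> momenta \<Lambda> \<kappa> \<Longrightarrow> - p \<in> momenta \<Lambda> \<kappa>"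
  using dual_lattice_diff[OF zero_dual_lattice, of p \<Lambda>] by (simp add: momenta_alt)

lemma momenta_mono: "\<kappa> \<le> \<kappa>' \<Longrightarrow> momenta \<Lambda> \<kappa> \<subseteq> momenta \<Lambda> \<kappa>'"
  unfolding momenta_alt by (auto intro: less_le_trans)

lemma inner_lattice_shift:
  assumes "\<Lambda> $ i > 0" "p \<in> dual_lattice \<Lambda>"
  shows "\<exists>m::int. p \<bullet> (x + (2 * \<Lambda> $ i) *\<^sub>R axis i 1) = p \<bullet> x + 2 * pi * of_int m"
proof -
  obtain m :: int where "p $ i = pi / \<Lambda> $ i * of_int m" using assms(2) by (auto simp: dual_lattice_def)
  then show ?thesis using assms(1) by (intro exI[of _ m]) (simp add: inner_add_right inner_axis)
qed

text \<open>Cosines and sines with vector coefficients, because the fields are real. As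
  \<open>P\<close> may contain both \<open>p\<close> and \<open>- p\<close>, coefficients are not
  unique, and later statements only assert that some exist.\<close>

definition trig_poly :: "(real^4) set \<Rightarrow> (real^4 \<Rightarrow> 'b) \<Rightarrow> (real^4 \<Rightarrow> 'b) \<Rightarrow> real^4 \<Rightarrow> 'b::real_normed_vector" where
  "trig_poly P \<alpha> \<beta> x = (\<Sum>p\<in>P. cos (p \<bullet> x) *\<^sub>R \<alpha> p + sin (p \<bullet> x) *\<^sub>R \<beta> p)"

lemma trig_poly_has_derivative:
  "(trig_poly P \<alpha> \<beta> has_derivative
    (\<lambda>h. trig_poly P (\<lambda>p. (p \<bullet> h) *\<^sub>R \<beta> p) (\<lambda>p. - (p \<bullet> h) *\<^sub>R \<alpha> p) x)) (at x)"
  unfolding trig_poly_def[abs_def]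
  by (rule has_derivative_sum) (auto intro!: derivative_eq_intros simp: fun_eq_iff mult.commute)

lemma trig_poly_frechet:
  "frechet_derivative (trig_poly P \<alpha> \<beta>) (at x) h
    = trig_poly P (\<lambda>p. (p \<bullet> h) *\<^sub>R \<beta> p) (\<lambda>p. - (p \<bullet> h) *\<^sub>R \<alpha> p) x"
  by (rule fun_cong[OF frechet_derivative_at[OF trig_poly_has_derivative], symmetric])

lemma trig_poly_continuous: "continuous_on UNIV (trig_poly P \<alpha> \<beta>)"
  unfolding trig_poly_def[abs_def] by (intro continuous_intros)

lemma trig_poly_smooth: "smooth (trig_poly P \<alpha> \<beta>)"
proof -
  have "cont_diff n (trig_poly P \<alpha> \<beta>)" for n
  proof (induction n arbitrary: \<alpha> \<beta>)
    case 0
    then show ?case by (simp add: trig_poly_continuous)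
  next
    case (Suc n)
    have "trig_poly P \<alpha> \<beta> differentiable at x" for x
      unfolding differentiable_def by (rule exI) (rule trig_poly_has_derivative)
    moreover have "cont_diff n (\<lambda>x. frechet_derivative (trig_poly P \<alpha> \<beta>) (at x) b)" for b
      unfolding trig_poly_frechet by (rule Suc)
    ultimately show ?case by simp
  qed
  then show ?thesis by (simp add: smooth_def)
qed

lemma trig_poly_partial:
  "partial_deriv i (trig_poly P \<alpha> \<beta>)
    = trig_poly P (\<lambda>p. (p $ i) *\<^sub>R \<beta> p) (\<lambda>p. - (p $ i) *\<^sub>R \<alpha> p)"
  by (rule ext) (simp add: partial_deriv_def trig_poly_frechet inner_axis)

lemma trig_poly_add:
  "trig_poly P \<alpha> \<beta> x + trig_poly P \<alpha>' \<beta>' x = trig_poly P (\<lambda>p. \<alpha> p + \<alpha>' p) (\<lambda>p. \<beta> p + \<beta>' p) x"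
  by (simp add: trig_poly_def sum.distrib algebra_simps)

lemma trig_poly_linear:
  assumes "linear T"
  shows "T (trig_poly P \<alpha> \<beta> x) = trig_poly P (\<lambda>p. T (\<alpha> p)) (\<lambda>p. T (\<beta> p)) x"
  by (simp add: trig_poly_def linear_sum[OF assms] linear_add[OF assms] linear_cmul[OF assms])

lemma trig_poly_sum:
  "(\<Sum>i\<in>I. trig_poly P (\<alpha> i) (\<beta> i) x) = trig_poly P (\<lambda>p. \<Sum>i\<in>I. \<alpha> i p) (\<lambda>p. \<Sum>i\<in>I. \<beta> i p) x"
  unfolding trig_poly_def sum.distrib scaleR_sum_right
  by (subst (1 2) sum.swap) simp

lemma trig_poly_mono:
  assumes "finite P'" "P \<subseteq> P'"
  shows "trig_poly P \<alpha> \<beta> = trig_poly P' (\<lambda>p. if p \<in> P then \<alpha> p else 0) (\<lambda>p. if p \<in> P then \<beta> p else 0)"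
  unfolding trig_poly_def[abs_def] fun_eq_iff using assms
  by (auto intro!: sum.mono_neutral_cong_left)

text \<open>Exhibits a finite, possibly redundant, spanning family. Its size later bounds that of
  any orthonormal family.\<close>

lemma trig_poly_basis_expansion:
  fixes \<alpha> \<beta> :: "real^4 \<Rightarrow> 'b::euclidean_space"
  shows "trig_poly P \<alpha> \<beta> = (\<lambda>x. \<Sum>(p, b, s)\<in>P \<times> Basis \<times> UNIV.
    (if s then \<alpha> p \<bullet> b else \<beta> p \<bullet> b) *\<^sub>R ((if s then cos (p \<bullet> x) else sin (p \<bullet> x)) *\<^sub>R b))"
proof
  fix x
  have "cos (p \<bullet> x) *\<^sub>R \<alpha> p + sin (p \<bullet> x) *\<^sub>R \<beta> p = (\<Sum>b\<in>Basis. \<Sum>s\<in>(UNIV::bool set).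
      (if s then \<alpha> p \<bullet> b else \<beta> p \<bullet> b) *\<^sub>R ((if s then cos (p \<bullet> x) else sin (p \<bullet> x)) *\<^sub>R b))" for p
  proof -
    have "v = (\<Sum>b\<in>Basis. (v \<bullet> b) *\<^sub>R b)" for v :: 'b by (simp add: euclidean_representation)
    then have "cos (p \<bullet> x) *\<^sub>R \<alpha> p + sin (p \<bullet> x) *\<^sub>R \<beta> p
        = cos (p \<bullet> x) *\<^sub>R (\<Sum>b\<in>Basis. (\<alpha> p \<bullet> b) *\<^sub>R b) + sin (p \<bullet> x) *\<^sub>R (\<Sum>b\<in>Basis. (\<beta> p \<bullet> b) *\<^sub>R b)"
      by (simp add: euclidean_representation)
    then show ?thesis
      by (simp add: UNIV_bool scaleR_sum_right sum.distrib mult_ac add.commute)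
  qed
  then show "trig_poly P \<alpha> \<beta> x = (\<Sum>(p, b, s)\<in>P \<times> Basis \<times> UNIV.
    (if s then \<alpha> p \<bullet> b else \<beta> p \<bullet> b) *\<^sub>R ((if s then cos (p \<bullet> x) else sin (p \<bullet> x)) *\<^sub>R b))"
    by (simp add: trig_poly_def sum.cartesian_product[symmetric])
qed

lemma torus_measure:
  assumes "\<And>i. \<Lambda> $ i > 0"
  shows "measure lborel (torus \<Lambda>) = (\<Prod>i\<in>UNIV. 2 * \<Lambda> $ i)"
proof -
  have "0 \<in> torus \<Lambda>" using assms by (simp add: torus_def mem_box_cart less_imp_le)
  then show ?thesis unfolding torus_def by (subst content_cbox_cart) auto
qed

context
  fixes \<Lambda> :: "real^4"
  assumes pos: "\<And>i. \<Lambda> $ i > 0"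
begin

lemma finite_momenta: "finite (momenta \<Lambda> \<kappa>)"
proof -
  define B where "B = (\<Sum>i\<in>UNIV. \<lceil>\<bar>\<kappa>\<bar> * \<Lambda> $ i / pi\<rceil>)"
  have "momenta \<Lambda> \<kappa> \<subseteq> (\<lambda>m. \<chi> i. pi / \<Lambda> $ i * of_int (m $ i)) ` {m :: int^4. \<forall>i. \<bar>m $ i\<bar> \<le> B}"
  proof
    fix p assume p: "p \<in> momenta \<Lambda> \<kappa>"
    then have "\<forall>i. \<exists>m::int. p $ i = pi / \<Lambda> $ i * of_int m" unfolding momenta_def by blast
    from choice[OF this] obtain m where m: "\<And>i. p $ i = pi / \<Lambda> $ i * of_int (m i)" by blast
    have "\<bar>m i\<bar> \<le> B" for i
    proof -
      have nn: "0 \<le> \<bar>\<kappa>\<bar> * \<Lambda> $ i / pi" for i using pos[of i] by simp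
      have "\<bar>p $ i\<bar> < \<kappa>" using p unfolding momenta_def by blast
      then have "\<bar>p $ i\<bar> \<le> \<bar>\<kappa>\<bar>" by linarith
      then have "\<bar>of_int (m i)\<bar> \<le> \<bar>\<kappa>\<bar> * \<Lambda> $ i / pi"
        using pos[of i] by (simp add: m abs_mult field_simps)
      moreover have "\<lceil>\<bar>\<kappa>\<bar> * \<Lambda> $ i / pi\<rceil> \<le> B"
        unfolding B_def using less_le_trans[of "- 1 :: real", OF _ nn] by (intro member_le_sum) auto
      ultimately show ?thesis by linarith
    qed
    then show "p \<in> (\<lambda>m. \<chi> i. pi / \<Lambda> $ i * of_int (m $ i)) ` {m :: int^4. \<forall>i. \<bar>m $ i\<bar> \<le> B}"
      by (intro image_eqI[of _ _ "\<chi> i. m i"]) (auto simp: vec_eq_iff m)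
  qed
  then show ?thesis by (rule finite_surj[OF finite_bounded_int_vectors])
qed

lemma trig_poly_periodic:
  assumes "P \<subseteq> dual_lattice \<Lambda>"
  shows "periodic \<Lambda> (trig_poly P \<alpha> \<beta>)"
  unfolding periodic_def trig_poly_def
proof (intro allI sum.cong refl)
  fix x :: "real^4" and i p assume "p \<in> P"
  then obtain m :: int where "p \<bullet> (x + (2 * \<Lambda> $ i) *\<^sub>R axis i 1) = p \<bullet> x + 2 * pi * of_int m"
    using inner_lattice_shift[OF pos, of p] assms by blast
  then show "cos (p \<bullet> (x + (2 * \<Lambda> $ i) *\<^sub>R axis i 1)) *\<^sub>R \<alpha> p
      + sin (p \<bullet> (x + (2 * \<Lambda> $ i) *\<^sub>R axis i 1)) *\<^sub>R \<beta> p
      = cos (p \<bullet> x) *\<^sub>R \<alpha> p + sin (p \<bullet> x) *\<^sub>R \<beta> p"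
    by (simp add: cos_add sin_add)
qed

text \<open>If \<open>p $ i\<close> is nonzero, the integrand is the derivative in direction
  \<open>i\<close> of the periodic function \<open>sin (p \<bullet> x + c) / p $ i\<close>. The
  phase \<open>c\<close> covers sines as well.\<close>

lemma cos_mode_integral:
  assumes "p \<in> dual_lattice \<Lambda>"
  shows "torus_integral \<Lambda> (\<lambda>x. cos (p \<bullet> x + c))
    = (if p = 0 then measure lborel (torus \<Lambda>) * cos c else 0)"
proof (cases "p = 0")
  case True
  then show ?thesis
    using emeasure_compact_finite[OF torus_compact, of \<Lambda>]
    by (simp add: torus_integral_def set_integral_const)
next
  case False
  then obtain i where i: "p $ i \<noteq> 0" by (auto simp: vec_eq_iff)
  have "torus_integral \<Lambda> (\<lambda>x. cos (p \<bullet> x + c)) = 0"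
  proof (rule torus_integral_partial_zero[OF pos])
    show "continuous_on UNIV (\<lambda>x. sin (p \<bullet> x + c) / p $ i)" using i by (intro continuous_intros) auto
    show "continuous_on UNIV (\<lambda>x. cos (p \<bullet> x + c))" by (intro continuous_intros)
    show "periodic \<Lambda> (\<lambda>x. sin (p \<bullet> x + c) / p $ i)"
      unfolding periodic_def
    proof (intro allI)
      fix x :: "real^4" and j
      obtain m :: int where "p \<bullet> (x + (2 * \<Lambda> $ j) *\<^sub>R axis j 1) = p \<bullet> x + 2 * pi * of_int m"
        using inner_lattice_shift[OF pos assms] by blast
      moreover have "sin (p \<bullet> x + 2 * pi * of_int m + c) = sin (p \<bullet> x + c)"
        using sin_add[of "p \<bullet> x + c" "2 * pi * of_int m"] by (simp add: add_ac)
      ultimately show "sin (p \<bullet> (x + (2 * \<Lambda> $ j) *\<^sub>R axis j 1) + c) / p $ i = sin (p \<bullet> x + c) / p $ i"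
        by (simp only:)
    qed
    show "((\<lambda>t. sin (p \<bullet> (x + t *\<^sub>R axis i 1) + c) / p $ i) has_vector_derivative cos (p \<bullet> x + c)) (at 0)" for x
      using i unfolding has_real_derivative_iff_has_vector_derivative[symmetric]
      by (auto intro!: derivative_eq_intros simp: inner_add_right inner_axis)
  qed
  with False show ?thesis by simp
qed

text \<open>Modes with nonzero momentum integrate to 0, and at \<open>p = 0\<close> the sine
  vanishes whatever \<open>\<beta> 0\<close> is, so the mean is decided by
  \<open>\<alpha> 0\<close>.\<close>

lemma trig_poly_integral:
  fixes \<alpha> \<beta> :: "real^4 \<Rightarrow> 'b::euclidean_space"
  assumes "P \<subseteq> dual_lattice \<Lambda>" "\<alpha> 0 = 0"
  shows "torus_integral \<Lambda> (trig_poly P \<alpha> \<beta>) = 0"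
proof -
  have "torus_integral \<Lambda> (\<lambda>x. cos (p \<bullet> x) *\<^sub>R \<alpha> p + sin (p \<bullet> x) *\<^sub>R \<beta> p) = 0" if "p \<in> P" for p
  proof -
    have "torus_integral \<Lambda> (\<lambda>x. cos (p \<bullet> x) *\<^sub>R \<alpha> p) = torus_integral \<Lambda> (\<lambda>x. cos (p \<bullet> x + 0)) *\<^sub>R \<alpha> p"
      "torus_integral \<Lambda> (\<lambda>x. sin (p \<bullet> x) *\<^sub>R \<beta> p) = torus_integral \<Lambda> (\<lambda>x. cos (p \<bullet> x + - (pi / 2))) *\<^sub>R \<beta> p"
      by (subst torus_integral_bounded_linear[symmetric, OF bounded_linear_scaleR_left];
          auto intro!: continuous_intros simp: cos_diff)+
    moreover have "p \<in> dual_lattice \<Lambda>" using that assms by auto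
    ultimately show ?thesis
      using assms(2)
      by (subst torus_integral_add) (auto intro!: continuous_intros simp: cos_mode_integral simp del: add_0_right add_uminus_conv_diff)
  qed
  then show ?thesis
    unfolding trig_poly_def[abs_def] by (subst torus_integral_sum) (auto intro!: continuous_intros)
qed

text \<open>The product formula for cosines leaves the momenta \<open>p - q\<close> and
  \<open>- q - p\<close>, so only \<open>q = p\<close> and \<open>q = - p\<close> contribute, each
  with weight one half. For \<open>p = 0\<close> they are the same mode, counted twice.\<close>

lemma mode_kernel_convolution:
  assumes "p \<in> momenta \<Lambda> \<kappa>"
  shows "torus_integral \<Lambda> (\<lambda>y. mode_kernel \<Lambda> \<kappa> (x - y) * cos (p \<bullet> y + c)) = cos (p \<bullet> x + c)"
proof -
  let ?V = "measure lborel (torus \<Lambda>)"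
  have V: "?V = (\<Prod>i\<in>UNIV. 2 * \<Lambda> $ i)" "?V > 0"
    using pos by (auto simp: torus_measure prod_pos)
  have pL: "p \<in> dual_lattice \<Lambda>" using assms momenta_subset_lattice by blast
  have "torus_integral \<Lambda> (\<lambda>y. cos (q \<bullet> (x - y)) * cos (p \<bullet> y + c))
      = ?V / 2 * ((if q = p then cos (p \<bullet> x + c) else 0) + (if q = - p then cos (p \<bullet> x + c) else 0))"
    if "q \<in> momenta \<Lambda> \<kappa>" for q
  proof -
    have qL: "q \<in> dual_lattice \<Lambda>" "- q \<in> dual_lattice \<Lambda>"
      using that momenta_uminus momenta_subset_lattice by blast+
    have "(\<lambda>y. cos (q \<bullet> (x - y)) * cos (p \<bullet> y + c))
        = (\<lambda>y. (1 / 2) * (cos ((p - q) \<bullet> y + (q \<bullet> x + c)) + cos ((- q - p) \<bullet> y + (q \<bullet> x - c))))"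
    proof
      fix y
      have half: "(b + a) / 2 = 1 / 2 * (a + b)" for a b :: real by simp
      have arg: "q \<bullet> (x - y) - (p \<bullet> y + c) = (- q - p) \<bullet> y + (q \<bullet> x - c)"
        "q \<bullet> (x - y) + (p \<bullet> y + c) = (p - q) \<bullet> y + (q \<bullet> x + c)"
        by (simp_all add: inner_diff_left inner_diff_right)
      show "cos (q \<bullet> (x - y)) * cos (p \<bullet> y + c)
          = 1 / 2 * (cos ((p - q) \<bullet> y + (q \<bullet> x + c)) + cos ((- q - p) \<bullet> y + (q \<bullet> x - c)))"
        by (simp only: cos_times_cos arg half)
    qed
    then have "torus_integral \<Lambda> (\<lambda>y. cos (q \<bullet> (x - y)) * cos (p \<bullet> y + c))
        = (1 / 2) * (torus_integral \<Lambda> (\<lambda>y. cos ((p - q) \<bullet> y + (q \<bullet> x + c)))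
          + torus_integral \<Lambda> (\<lambda>y. cos ((- q - p) \<bullet> y + (q \<bullet> x - c))))"
      by (simp only: torus_integral_bounded_linear[OF bounded_linear_mult_right] torus_integral_add
          continuous_intros)
    also have "\<dots> = (1 / 2) * ((if p - q = 0 then ?V * cos (q \<bullet> x + c) else 0)
        + (if - q - p = 0 then ?V * cos (q \<bullet> x - c) else 0))"
      using qL pL by (simp only: cos_mode_integral dual_lattice_diff)
    also have "\<dots> = ?V / 2 * ((if q = p then cos (p \<bullet> x + c) else 0) + (if q = - p then cos (p \<bullet> x + c) else 0))"
    proof -
      have "p - q = 0 \<longleftrightarrow> q = p" "- q - p = 0 \<longleftrightarrow> q = - p" by (auto simp: eq_neg_iff_add_eq_0 neg_eq_iff_add_eq_0 algebra_simps)
      moreover have "cos (- p \<bullet> x - c) = cos (p \<bullet> x + c)"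
        using cos_minus[of "p \<bullet> x + c"] by simp
      ultimately show ?thesis by (auto simp: algebra_simps)
    qed
    finally show ?thesis .
  qed
  then have "(\<Sum>q\<in>momenta \<Lambda> \<kappa>. torus_integral \<Lambda> (\<lambda>y. cos (q \<bullet> (x - y)) * cos (p \<bullet> y + c)))
      = ?V / 2 * (\<Sum>q\<in>momenta \<Lambda> \<kappa>.
        (if q = p then cos (p \<bullet> x + c) else 0) + (if q = - p then cos (p \<bullet> x + c) else 0))"
    unfolding sum_distrib_left by (rule sum.cong[OF refl])
  also have "\<dots> = ?V * cos (p \<bullet> x + c)"
    using assms momenta_uminus[OF assms] finite_momenta by (simp add: sum.distrib)
  finally have "torus_integral \<Lambda> (\<lambda>y. \<Sum>q\<in>momenta \<Lambda> \<kappa>. cos (q \<bullet> (x - y)) * cos (p \<bullet> y + c))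
      = ?V * cos (p \<bullet> x + c)"
    by (subst torus_integral_sum) (auto intro!: continuous_intros)
  moreover have "(\<lambda>y. mode_kernel \<Lambda> \<kappa> (x - y) * cos (p \<bullet> y + c))
      = (\<lambda>y. (1 / ?V) * (\<Sum>q\<in>momenta \<Lambda> \<kappa>. cos (q \<bullet> (x - y)) * cos (p \<bullet> y + c)))"
    by (simp add: mode_kernel_def V(1) sum_distrib_right)
  ultimately show ?thesis
    using V(2)
    by (simp only:) (subst torus_integral_bounded_linear[OF bounded_linear_mult_right];
      auto intro!: continuous_intros)
qed

lemma mode_kernel_continuous: "continuous_on UNIV (\<lambda>y. mode_kernel \<Lambda> \<kappa> (x - y))"
  unfolding mode_kernel_def using pos
  by (intro continuous_intros) (auto simp: prod_zero_iff less_imp_neq[symmetric])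

lemma mode_cutoff_trig_poly:
  fixes \<alpha> \<beta> :: "real^4 \<Rightarrow> 'b::euclidean_space"
  assumes "P \<subseteq> momenta \<Lambda> \<kappa>"
  shows "mode_cutoff \<Lambda> \<kappa> (trig_poly P \<alpha> \<beta>) = trig_poly P \<alpha> \<beta>"
proof
  fix x
  let ?K = "\<lambda>y. mode_kernel \<Lambda> \<kappa> (x - y)"
  note c = mode_kernel_continuous[of \<kappa> x]
  have "torus_integral \<Lambda> (\<lambda>y. ?K y *\<^sub>R (cos (p \<bullet> y) *\<^sub>R \<alpha> p + sin (p \<bullet> y) *\<^sub>R \<beta> p))
      = cos (p \<bullet> x) *\<^sub>R \<alpha> p + sin (p \<bullet> x) *\<^sub>R \<beta> p" if "p \<in> P" for p
  proof -
    have p: "p \<in> momenta \<Lambda> \<kappa>" using that assms by blast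
    have "torus_integral \<Lambda> (\<lambda>y. (?K y * cos (p \<bullet> y)) *\<^sub>R \<alpha> p) = cos (p \<bullet> x) *\<^sub>R \<alpha> p"
      using mode_kernel_convolution[OF p, of x 0] c
      by (subst torus_integral_bounded_linear[OF bounded_linear_scaleR_left])
        (auto intro!: continuous_intros)
    moreover have "torus_integral \<Lambda> (\<lambda>y. (?K y * sin (p \<bullet> y)) *\<^sub>R \<beta> p) = sin (p \<bullet> x) *\<^sub>R \<beta> p"
      using mode_kernel_convolution[OF p, of x "- pi / 2"] c
      by (subst torus_integral_bounded_linear[OF bounded_linear_scaleR_left])
        (auto intro!: continuous_intros simp: cos_diff)
    ultimately show ?thesis
      using c by (simp add: scaleR_add_right) (subst torus_integral_add; auto intro!: continuous_intros)
  qed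
  then show "mode_cutoff \<Lambda> \<kappa> (trig_poly P \<alpha> \<beta>) x = trig_poly P \<alpha> \<beta> x"
    unfolding mode_cutoff_def trig_poly_def scaleR_sum_right using c
    by (subst torus_integral_sum) (auto intro!: continuous_intros)
qed

text \<open>Expanding \<open>cos (p \<bullet> (x - y))\<close> separates the variables, and the
  coefficients are the Fourier integrals of \<open>u\<close>.\<close>

lemma mode_cutoff_is_trig_poly:
  fixes u :: "real^4 \<Rightarrow> 'b::euclidean_space"
  assumes "continuous_on UNIV u"
  shows "\<exists>\<alpha> \<beta>. mode_cutoff \<Lambda> \<kappa> u = trig_poly (momenta \<Lambda> \<kappa>) \<alpha> \<beta>"
proof -
  let ?V = "\<Prod>i\<in>UNIV. 2 * \<Lambda> $ i"
  define \<alpha> where "\<alpha> p = torus_integral \<Lambda> (\<lambda>y. (cos (p \<bullet> y) / ?V) *\<^sub>R u y)" for p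
  define \<beta> where "\<beta> p = torus_integral \<Lambda> (\<lambda>y. (sin (p \<bullet> y) / ?V) *\<^sub>R u y)" for p
  have V: "?V \<noteq> 0" using pos by (simp add: prod_zero_iff less_imp_neq[symmetric])
  have "mode_cutoff \<Lambda> \<kappa> u x = trig_poly (momenta \<Lambda> \<kappa>) \<alpha> \<beta> x" for x
  proof -
    have "(\<lambda>y. mode_kernel \<Lambda> \<kappa> (x - y) *\<^sub>R u y)
        = (\<lambda>y. \<Sum>p\<in>momenta \<Lambda> \<kappa>. cos (p \<bullet> x) *\<^sub>R ((cos (p \<bullet> y) / ?V) *\<^sub>R u y)
            + sin (p \<bullet> x) *\<^sub>R ((sin (p \<bullet> y) / ?V) *\<^sub>R u y))"
      by (simp add: mode_kernel_def inner_diff_right cos_diff sum_divide_distrib scaleR_sum_left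
          add_divide_distrib scaleR_add_left)
    then have "mode_cutoff \<Lambda> \<kappa> u x = (\<Sum>p\<in>momenta \<Lambda> \<kappa>.
        torus_integral \<Lambda> (\<lambda>y. cos (p \<bullet> x) *\<^sub>R ((cos (p \<bullet> y) / ?V) *\<^sub>R u y)
            + sin (p \<bullet> x) *\<^sub>R ((sin (p \<bullet> y) / ?V) *\<^sub>R u y)))"
      unfolding mode_cutoff_def using V
      by (simp only:) (rule torus_integral_sum, intro continuous_intros assms, auto)
    also have "\<dots> = trig_poly (momenta \<Lambda> \<kappa>) \<alpha> \<beta> x"
      unfolding trig_poly_def
    proof (rule sum.cong[OF refl])
      fix p
      have c: "continuous_on UNIV (\<lambda>y. (cos (p \<bullet> y) / ?V) *\<^sub>R u y)"
        "continuous_on UNIV (\<lambda>y. (sin (p \<bullet> y) / ?V) *\<^sub>R u y)"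
        using V by (intro continuous_intros assms; auto)+
      show "torus_integral \<Lambda> (\<lambda>y. cos (p \<bullet> x) *\<^sub>R ((cos (p \<bullet> y) / ?V) *\<^sub>R u y)
            + sin (p \<bullet> x) *\<^sub>R ((sin (p \<bullet> y) / ?V) *\<^sub>R u y))
          = cos (p \<bullet> x) *\<^sub>R \<alpha> p + sin (p \<bullet> x) *\<^sub>R \<beta> p"
        unfolding \<alpha>_def \<beta>_def
        by (subst torus_integral_add)
          (intro continuous_on_scaleR continuous_on_const c
            | simp only: torus_integral_bounded_linear[OF bounded_linear_scaleR_right c(1)]
              torus_integral_bounded_linear[OF bounded_linear_scaleR_right c(2)])+
    qed
    finally show ?thesis .
  qed
  then show ?thesis by blast
qed

end

section \<open>The bosonic spaces\<close>

lemma L2_inner_commute: "L2_inner \<Lambda> u v = L2_inner \<Lambda> v u"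
  by (simp add: L2_inner_def inner_commute)

lemma L2_inner_sum_right:
  fixes u :: "real^4 \<Rightarrow> 'b::euclidean_space"
  assumes "continuous_on UNIV u" "\<And>j. j \<in> J \<Longrightarrow> continuous_on UNIV (v j)"
  shows "L2_inner \<Lambda> u (\<lambda>x. \<Sum>j\<in>J. c j *\<^sub>R v j x) = (\<Sum>j\<in>J. c j * L2_inner \<Lambda> u (v j))"
proof -
  have c: "continuous_on UNIV (\<lambda>x. u x \<bullet> v j x)" if "j \<in> J" for j
    using assms that by (intro continuous_intros) auto
  have "torus_integral \<Lambda> (\<lambda>x. \<Sum>j\<in>J. c j * (u x \<bullet> v j x))
      = (\<Sum>j\<in>J. torus_integral \<Lambda> (\<lambda>x. c j * (u x \<bullet> v j x)))"
    by (intro torus_integral_sum continuous_intros c)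
  also have "\<dots> = (\<Sum>j\<in>J. c j * torus_integral \<Lambda> (\<lambda>x. u x \<bullet> v j x))"
    by (intro sum.cong refl torus_integral_bounded_linear[OF bounded_linear_mult_right] c)
  finally show ?thesis by (simp add: L2_inner_def inner_sum_right)
qed

lemma L2_inner_sum_left:
  fixes u :: "real^4 \<Rightarrow> 'b::euclidean_space"
  assumes "continuous_on UNIV u" "\<And>j. j \<in> J \<Longrightarrow> continuous_on UNIV (v j)"
  shows "L2_inner \<Lambda> (\<lambda>x. \<Sum>j\<in>J. c j *\<^sub>R v j x) u = (\<Sum>j\<in>J. c j * L2_inner \<Lambda> (v j) u)"
  unfolding L2_inner_commute[of \<Lambda> _ u] by (rule L2_inner_sum_right[OF assms])

lemma L2_inner_diff_right:
  fixes u :: "real^4 \<Rightarrow> 'b::euclidean_space"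
  assumes "continuous_on UNIV u" "continuous_on UNIV v" "continuous_on UNIV w"
  shows "L2_inner \<Lambda> u (\<lambda>x. v x - w x) = L2_inner \<Lambda> u v - L2_inner \<Lambda> u w"
  unfolding L2_inner_def inner_diff_right
  by (intro torus_integral_diff continuous_on_inner assms)

lemma L2_inner_scale_right:
  fixes u :: "real^4 \<Rightarrow> 'b::euclidean_space"
  assumes "continuous_on UNIV u" "continuous_on UNIV v"
  shows "L2_inner \<Lambda> u (\<lambda>x. c *\<^sub>R v x) = c * L2_inner \<Lambda> u v"
  using L2_inner_sum_right[of u "{()}" "\<lambda>_. v" \<Lambda> "\<lambda>_. c"] assms by simp

lemma L2_inner_eq_0:
  fixes u :: "real^4 \<Rightarrow> 'b::euclidean_space"
  assumes "\<And>i. \<Lambda> $ i > 0" "continuous_on UNIV u" "periodic \<Lambda> u" "L2_inner \<Lambda> u u = 0"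
  shows "u x = 0"
proof -
  have "continuous_on UNIV (\<lambda>x. u x \<bullet> u x)" using assms(2) by (intro continuous_intros)
  moreover have "periodic \<Lambda> (\<lambda>x. u x \<bullet> u x)" using assms(3) by (simp add: periodic_def)
  ultimately have "u x \<bullet> u x = 0"
    using torus_integral_nonneg_eq_0[of \<Lambda> "\<lambda>x. u x \<bullet> u x" x] assms(1,4) by (simp add: L2_inner_def)
  then show ?thesis by simp
qed

lemma L2_inner_nonneg: "L2_inner \<Lambda> u u \<ge> 0"
  by (simp add: L2_inner_def torus_integral_def set_lebesgue_integral_def integral_nonneg_AE)

definition L2_orthonormal :: "real^4 \<Rightarrow> (real^4 \<Rightarrow> 'b::real_inner) set \<Rightarrow> bool" where
  "L2_orthonormal \<Lambda> B \<longleftrightarrow> finite B \<and>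
     (\<forall>u\<in>B. \<forall>v\<in>B. L2_inner \<Lambda> u v = (if u = v then 1 else 0))"

lemma L2_orthonormal_coefficient:
  fixes B :: "(real^4 \<Rightarrow> 'b::euclidean_space) set"
  assumes "L2_orthonormal \<Lambda> B" "\<And>v. v \<in> B \<Longrightarrow> continuous_on UNIV v" "u \<in> B"
  shows "L2_inner \<Lambda> u (\<lambda>x. \<Sum>v\<in>B. c v *\<^sub>R v x) = c u"
proof -
  have "L2_inner \<Lambda> u (\<lambda>x. \<Sum>v\<in>B. c v *\<^sub>R v x) = (\<Sum>v\<in>B. c v * L2_inner \<Lambda> u v)"
    using assms(2,3) by (intro L2_inner_sum_right) auto
  also have "\<dots> = (\<Sum>v\<in>B. if v = u then c v else 0)"
    using assms by (intro sum.cong) (auto simp: L2_orthonormal_def)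
  finally show ?thesis using assms by (simp add: L2_orthonormal_def)
qed

definition L2_basis :: "real^4 \<Rightarrow> (real^4 \<Rightarrow> 'b::real_inner) set \<Rightarrow> (real^4 \<Rightarrow> 'b) set \<Rightarrow> bool" where
  "L2_basis \<Lambda> S B \<longleftrightarrow> L2_orthonormal \<Lambda> B \<and> B \<subseteq> S \<and>
     (\<forall>u\<in>S. u = (\<lambda>x. \<Sum>v\<in>B. L2_inner \<Lambda> v u *\<^sub>R v x))"

definition function_subspace :: "(real^4 \<Rightarrow> 'b::real_vector) set \<Rightarrow> bool" where
  "function_subspace S \<longleftrightarrow> (\<lambda>x. 0) \<in> S \<and> (\<forall>u\<in>S. \<forall>v\<in>S. \<forall>a b. (\<lambda>x. a *\<^sub>R u x + b *\<^sub>R v x) \<in> S)"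

lemma function_subspace_lincomb:
  assumes "function_subspace S" "u \<in> S" "v \<in> S"
  shows "(\<lambda>x. a *\<^sub>R u x + b *\<^sub>R v x) \<in> S"
proof -
  have "\<forall>u\<in>S. \<forall>v\<in>S. \<forall>a b. (\<lambda>x. a *\<^sub>R u x + b *\<^sub>R v x) \<in> S"
    using assms(1) unfolding function_subspace_def by (rule conjunct2)
  from this[rule_format, OF assms(2,3), of a b] show ?thesis .
qed

lemma function_subspace_sum:
  assumes "function_subspace S" "\<And>j. j \<in> J \<Longrightarrow> v j \<in> S"
  shows "(\<lambda>x. \<Sum>j\<in>J. c j *\<^sub>R v j x) \<in> S"
  using assms(2)
proof (induction J rule: infinite_finite_induct)
  case (insert j J)
  have "(\<lambda>x. c j *\<^sub>R v j x + 1 *\<^sub>R (\<Sum>j\<in>J. c j *\<^sub>R v j x)) \<in> S"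
    by (rule function_subspace_lincomb[OF assms(1)]) (use insert in auto)
  then show ?case using insert.hyps by simp
next
  case empty
  then show ?case using assms(1) unfolding function_subspace_def by simp
next
  case (infinite J)
  then show ?case using assms(1) unfolding function_subspace_def by simp
qed

text \<open>A maximal orthonormal family is a basis; its size is bounded by that of a spanning family.\<close>

lemma L2_basis_exists:
  fixes S :: "(real^4 \<Rightarrow> 'b::euclidean_space) set"
  assumes pos: "\<And>i. \<Lambda> $ i > 0" and sub: "function_subspace S"
    and cp: "\<And>u. u \<in> S \<Longrightarrow> continuous_on UNIV u \<and> periodic \<Lambda> u"
    and fin: "finite J" and spn: "\<And>u. u \<in> S \<Longrightarrow> \<exists>c. u = (\<lambda>x. \<Sum>j\<in>J. c j *\<^sub>R g j x)"
  shows "\<exists>B. L2_basis \<Lambda> S B"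
proof -
  define good where "good B \<longleftrightarrow> L2_orthonormal \<Lambda> B \<and> B \<subseteq> S" for B
  have cont: "continuous_on UNIV v" if "good B" "v \<in> B" for B v using cp that by (auto simp: good_def)
  \<comment> \<open>More than \<open>card J\<close> functions in the span of the \<open>g j\<close>
    satisfy a nontrivial linear relation; pairing it with each member of an orthonormal family makes
    all its coefficients vanish.\<close>
  have le: "card B \<le> card J" if B: "good B" for B
  proof (rule ccontr)
    assume "\<not> card B \<le> card J"
    then have less: "card J < card B" by simp
    obtain c where c: "\<And>u. u \<in> S \<Longrightarrow> u = (\<lambda>x. \<Sum>j\<in>J. c u j *\<^sub>R g j x)" using spn by metis
    have finB: "finite B" using B by (simp add: good_def L2_orthonormal_def)
    obtain x where x: "\<exists>u\<in>B. x u \<noteq> 0" "\<forall>j\<in>J. (\<Sum>u\<in>B. c u j * x u) = 0"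
      using homogeneous_system_nontrivial[OF fin finB less, of "\<lambda>j u. c u j"] by blast
    have "(\<Sum>u\<in>B. x u *\<^sub>R u y) = 0" for y
    proof -
      have "(\<Sum>u\<in>B. x u *\<^sub>R u y) = (\<Sum>u\<in>B. x u *\<^sub>R (\<Sum>j\<in>J. c u j *\<^sub>R g j y))"
      proof (rule sum.cong[OF refl])
        fix u assume "u \<in> B"
        then have "u y = (\<Sum>j\<in>J. c u j *\<^sub>R g j y)" using fun_cong[OF c] B by (auto simp: good_def)
        then show "x u *\<^sub>R u y = x u *\<^sub>R (\<Sum>j\<in>J. c u j *\<^sub>R g j y)" by (rule arg_cong)
      qed
      also have "\<dots> = (\<Sum>j\<in>J. (\<Sum>u\<in>B. c u j * x u) *\<^sub>R g j y)"
        unfolding scaleR_sum_right scaleR_sum_left by (subst sum.swap) (simp add: mult.commute)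
      also have "\<dots> = 0" using x(2) by simp
      finally show ?thesis .
    qed
    then have "(\<lambda>y. \<Sum>u\<in>B. x u *\<^sub>R u y) = (\<lambda>y. 0)" by simp
    then have "L2_inner \<Lambda> v (\<lambda>y. \<Sum>u\<in>B. x u *\<^sub>R u y) = 0" for v
      by (simp only:) (simp add: L2_inner_def torus_integral_zero)
    then have "x v = 0" if "v \<in> B" for v
      using L2_orthonormal_coefficient[of \<Lambda> B v x] B cont[OF B] that by (auto simp: good_def)
    then show False using x(1) by blast
  qed
  have "good {}" by (simp add: good_def L2_orthonormal_def)
  moreover have "\<forall>B. good B \<longrightarrow> card B < Suc (card J)" using le by (simp add: less_Suc_eq_le)
  ultimately obtain B where B: "good B" "\<And>B'. good B' \<Longrightarrow> card B' \<le> card B"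
    using ex_has_greatest_nat[of good "{}" card "Suc (card J)"] by blast
  have finB: "finite B" and on: "L2_orthonormal \<Lambda> B" and BS: "B \<subseteq> S"
    using B(1) by (auto simp: good_def L2_orthonormal_def)
  have "u = (\<lambda>x. \<Sum>v\<in>B. L2_inner \<Lambda> v u *\<^sub>R v x)" if u: "u \<in> S" for u
  proof (rule ccontr)
    assume neq: "u \<noteq> (\<lambda>x. \<Sum>v\<in>B. L2_inner \<Lambda> v u *\<^sub>R v x)"
    let ?w = "\<lambda>x. \<Sum>v\<in>B. L2_inner \<Lambda> v u *\<^sub>R v x"
    \<comment> \<open>The remainder of the projection onto the span of \<open>B\<close>. If it were
      nonzero, its normalization \<open>w\<close> would enlarge the maximal family.\<close>
    define r where "r = (\<lambda>x. u x - ?w x)"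
    have w: "?w \<in> S" using BS by (intro function_subspace_sum[OF sub]) auto
    have "(\<lambda>x. 1 *\<^sub>R u x + (- 1) *\<^sub>R ?w x) \<in> S" 
      by (rule function_subspace_lincomb[OF sub u w])
    then have rS: "r \<in> S" by (simp add: r_def)
    have vr: "L2_inner \<Lambda> v r = 0" if "v \<in> B" for v
    proof -
      have "L2_inner \<Lambda> v r = L2_inner \<Lambda> v u - L2_inner \<Lambda> v ?w"
        unfolding r_def using cont[OF B(1) that] cp[OF u] cp[OF w] by (intro L2_inner_diff_right) auto
      then show ?thesis
        using L2_orthonormal_coefficient[OF on cont[OF B(1)] that, of "\<lambda>v. L2_inner \<Lambda> v u"] by simp
    qed
    define N where "N = L2_inner \<Lambda> r r"
    have "N \<noteq> 0"
    proof
      assume "N = 0"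
      then have "r x = 0" for x using L2_inner_eq_0[OF pos, of r x] cp[OF rS] by (simp add: N_def)
      then show False using neq by (auto simp: r_def)
    qed
    then have N: "N > 0" using L2_inner_nonneg[of \<Lambda> r] by (simp add: N_def)
    define w where "w = (\<lambda>x. (1 / sqrt N) *\<^sub>R r x)"
    have "(\<lambda>x. (1 / sqrt N) *\<^sub>R r x + 0 *\<^sub>R r x) \<in> S" 
      by (rule function_subspace_lincomb[OF sub rS rS])
    then have wS: "w \<in> S" by (simp add: w_def)
    have wv: "L2_inner \<Lambda> v w = 0" "L2_inner \<Lambda> w v = 0" if "v \<in> B" for v
    proof -
      show "L2_inner \<Lambda> v w = 0"
        using vr[OF that] L2_inner_scale_right[of v r \<Lambda> "1 / sqrt N"] cont[OF B(1) that] cp[OF rS]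
        by (simp add: w_def)
      then show "L2_inner \<Lambda> w v = 0" by (simp only: L2_inner_commute[of \<Lambda> w v])
    qed
    have "L2_inner \<Lambda> r w = 1 / sqrt N * N"
      using L2_inner_scale_right[of r r \<Lambda> "1 / sqrt N"] cp[OF rS] unfolding w_def N_def by blast
    moreover have "L2_inner \<Lambda> w w = 1 / sqrt N * L2_inner \<Lambda> w r"
      using L2_inner_scale_right[of w r \<Lambda> "1 / sqrt N"] cp[OF rS] cp[OF wS] unfolding w_def by blast
    ultimately have "L2_inner \<Lambda> w w = 1 / sqrt N * (1 / sqrt N * N)"
      by (simp only: L2_inner_commute[of \<Lambda> w r])
    then have ww: "L2_inner \<Lambda> w w = 1" using N by (simp add: field_simps)
    have wB: "w \<notin> B" using ww wv by force
    have "good (insert w B)"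
      using B(1) wS ww wv wB by (auto simp: good_def L2_orthonormal_def)
    from B(2)[OF this] show False using wB finB by simp
  qed
  then show ?thesis using on BS by (auto simp: L2_basis_def)
qed

lemma trig_poly_lincomb:
  "a *\<^sub>R trig_poly P \<alpha> \<beta> x + b *\<^sub>R trig_poly P \<alpha>' \<beta>' x
    = trig_poly P (\<lambda>p. a *\<^sub>R \<alpha> p + b *\<^sub>R \<alpha>' p) (\<lambda>p. a *\<^sub>R \<beta> p + b *\<^sub>R \<beta>' p) x"
  by (simp add: trig_poly_def sum.distrib scaleR_sum_right algebra_simps)

section \<open>The curl and the first-order operator \<open>D\<close>\<close>

text \<open>The constant coefficient matrix of the \<open>i\<close>-th spatial derivative in the
  curl. Constant linear maps commute with derivatives and act directly on the coefficients of
  trigonometric polynomials.\<close>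

definition curl_map :: "3 \<Rightarrow> 'g::real_vector^3 \<Rightarrow> 'g^3" where
  "curl_map i v = (\<chi> k. \<Sum>j\<in>UNIV. levi_civita i j k *\<^sub>R v $ j)"

lemma curl_map_linear: "linear (curl_map i)"
  by (rule linearI) (simp_all add: curl_map_def vec_eq_iff sum.distrib scaleR_add_right scaleR_sum_right mult.commute)

lemma curl_eq: "curl A x = (\<Sum>i\<in>UNIV. curl_map i (partial_deriv (spatial i) A x))"
  by (simp add: curl_def curl_map_def vec_eq_iff)

lemma levi_civita_swap: "levi_civita i j k = - levi_civita i k j"
proof -
  have "\<forall>i j k. levi_civita i j k = - levi_civita i k j"
    unfolding forall_3 levi_civita_def by simp
  then show ?thesis by blast
qed

text \<open>\<open>levi_civita i j k\<close> is antisymmetric in \<open>j\<close> and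
  \<open>k\<close>. A partial derivative is antisymmetric too under the integral, so the curl, a sum
  of products of commuting antisymmetric operators, is symmetric.\<close>

lemma curl_map_antisym:
  fixes v w :: "'g::euclidean_space^3"
  shows "v \<bullet> curl_map i w = - (w \<bullet> curl_map i v)"
proof -
  have "v \<bullet> curl_map i w = (\<Sum>k\<in>UNIV. \<Sum>j\<in>UNIV. levi_civita i j k * (v $ k \<bullet> w $ j))"
    by (simp add: inner_vec_def curl_map_def inner_sum_right)
  also have "\<dots> = (\<Sum>j\<in>UNIV. \<Sum>k\<in>UNIV. - (levi_civita i k j * (w $ j \<bullet> v $ k)))"
  proof (subst sum.swap, intro sum.cong refl)
    fix j k
    show "levi_civita i j k * (v $ k \<bullet> w $ j) = - (levi_civita i k j * (w $ j \<bullet> v $ k))"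
      by (simp only: levi_civita_swap[of i j k] inner_commute[of "v $ k"] mult_minus_left)
  qed
  also have "\<dots> = - (w \<bullet> curl_map i v)"
    by (simp add: inner_vec_def curl_map_def inner_sum_right sum_negf)
  finally show ?thesis .
qed

text \<open>The operator \<open>D\<close>: its pairing with \<open>F\<close> collects both mixed
  terms of \<open>boson_form\<close>.\<close>

definition gauge_deriv :: "(real^4 \<Rightarrow> 'g::euclidean_space^3) \<Rightarrow> real^4 \<Rightarrow> 'g^3" where
  "gauge_deriv A x = partial_deriv 0 A x + curl A x"

text \<open>Every coefficient of a derivative carries a momentum component as a factor, hence
  \<open>\<gamma> 0 = 0\<close>. This will give the image mean zero.\<close>

lemma gauge_deriv_trig_poly:
  "\<exists>\<gamma> \<delta>. \<gamma> 0 = 0 \<and> gauge_deriv (trig_poly P \<alpha> \<beta>) = trig_poly P \<gamma> \<delta>"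
proof -
  let ?a = "\<lambda>i p. (p $ i) *\<^sub>R \<beta> p" and ?b = "\<lambda>i p. - (p $ i) *\<^sub>R \<alpha> p"
  have "gauge_deriv (trig_poly P \<alpha> \<beta>) x
      = trig_poly P (\<lambda>p. ?a 0 p + (\<Sum>i\<in>UNIV. curl_map i (?a (spatial i) p)))
          (\<lambda>p. ?b 0 p + (\<Sum>i\<in>UNIV. curl_map i (?b (spatial i) p))) x" for x
    unfolding gauge_deriv_def curl_eq trig_poly_partial trig_poly_linear[OF curl_map_linear]
      trig_poly_sum trig_poly_add ..
  then show ?thesis
    by (intro exI[of _ "\<lambda>p. ?a 0 p + (\<Sum>i\<in>UNIV. curl_map i (?a (spatial i) p))"]
        exI[of _ "\<lambda>p. ?b 0 p + (\<Sum>i\<in>UNIV. curl_map i (?b (spatial i) p))"])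
      (auto simp: linear_0[OF curl_map_linear])
qed

lemma partial_deriv_sum:
  assumes "\<And>j. j \<in> J \<Longrightarrow> v j differentiable (at x)"
  shows "partial_deriv i (\<lambda>x. \<Sum>j\<in>J. c j *\<^sub>R v j x) x = (\<Sum>j\<in>J. c j *\<^sub>R partial_deriv i (v j) x)"
proof -
  have "((\<lambda>x. \<Sum>j\<in>J. c j *\<^sub>R v j x) has_derivative
      (\<lambda>h. \<Sum>j\<in>J. c j *\<^sub>R frechet_derivative (v j) (at x) h)) (at x)"
    using assms by (intro has_derivative_sum has_derivative_scaleR_right) (simp add: frechet_derivative_works)
  from frechet_derivative_at[OF this] show ?thesis by (simp add: partial_deriv_def fun_eq_iff)
qed

lemma gauge_deriv_sum:
  assumes "\<And>j x. j \<in> J \<Longrightarrow> v j differentiable (at x)"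
  shows "gauge_deriv (\<lambda>x. \<Sum>j\<in>J. c j *\<^sub>R v j x) x = (\<Sum>j\<in>J. c j *\<^sub>R gauge_deriv (v j) x)"
proof -
  have p: "partial_deriv i (\<lambda>x. \<Sum>j\<in>J. c j *\<^sub>R v j x) x = (\<Sum>j\<in>J. c j *\<^sub>R partial_deriv i (v j) x)" for i
    by (intro partial_deriv_sum assms)
  have "(\<Sum>i\<in>UNIV. \<Sum>j\<in>J. c j *\<^sub>R curl_map i (partial_deriv (spatial i) (v j) x))
      = (\<Sum>j\<in>J. \<Sum>i\<in>UNIV. c j *\<^sub>R curl_map i (partial_deriv (spatial i) (v j) x))"
    by (rule sum.swap)
  then show ?thesis
    unfolding gauge_deriv_def curl_eq p
    by (simp add: linear_sum[OF curl_map_linear] linear_cmul[OF curl_map_linear] scaleR_add_right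
        sum.distrib scaleR_sum_right)
qed

lemma trig_poly_line_derivative:
  "((\<lambda>t. trig_poly P \<alpha> \<beta> (x + t *\<^sub>R axis i 1)) has_vector_derivative
    partial_deriv i (trig_poly P \<alpha> \<beta>) (x + s *\<^sub>R axis i 1)) (at s)"
proof -
  have "((\<lambda>t. x + t *\<^sub>R axis i 1) has_derivative (\<lambda>t. t *\<^sub>R axis i 1)) (at s)"
    by (auto intro!: derivative_eq_intros)
  from diff_chain_at[OF this trig_poly_has_derivative]
  show ?thesis
    unfolding has_vector_derivative_def partial_deriv_def trig_poly_frechet
    by (simp add: o_def trig_poly_def scaleR_sum_right algebra_simps)
qed

lemma component_constant:
  assumes "\<And>x. partial_deriv i (trig_poly P \<alpha> \<beta>) x $ k = 0"
  shows "trig_poly P \<alpha> \<beta> (x + t *\<^sub>R axis i 1) $ k = trig_poly P \<alpha> \<beta> x $ k"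
proof -
  let ?f = "\<lambda>t. trig_poly P \<alpha> \<beta> (x + t *\<^sub>R axis i 1) $ k"
  have "(?f has_vector_derivative partial_deriv i (trig_poly P \<alpha> \<beta>) (x + s *\<^sub>R axis i 1) $ k) (at s)" for s
    by (rule bounded_linear.has_vector_derivative[OF bounded_linear_vec_nth trig_poly_line_derivative])
  then have "(?f has_vector_derivative 0) (at s)" for s by (simp only: assms)
  then obtain c where "\<And>t. t \<in> UNIV \<Longrightarrow> ?f t = c"
    using has_vector_derivative_zero_constant[OF convex_UNIV, of ?f] by blast
  from this[of t] this[of 0] show ?thesis by simp
qed

lemma component_deriv_zero:
  assumes "\<And>x. trig_poly P \<alpha> \<beta> x $ k = 0"
  shows "partial_deriv i (trig_poly P \<alpha> \<beta>) x $ k = 0"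
proof -
  have "((\<lambda>t. trig_poly P \<alpha> \<beta> (x + t *\<^sub>R axis i 1) $ k) has_vector_derivative
      partial_deriv i (trig_poly P \<alpha> \<beta>) (x + 0 *\<^sub>R axis i 1) $ k) (at 0)"
    by (rule bounded_linear.has_vector_derivative[OF bounded_linear_vec_nth trig_poly_line_derivative])
  then have "((\<lambda>t. 0) has_vector_derivative partial_deriv i (trig_poly P \<alpha> \<beta>) x $ k) (at (0::real))"
    by (simp add: assms)
  then show ?thesis using vector_derivative_unique_at has_vector_derivative_const by blast
qed

section \<open>Band-limited fields and the injectivity of \<open>D\<close>\<close>

context
  fixes \<Lambda> :: "real^4"
  assumes pos: "\<And>i. \<Lambda> $ i > 0"
begin

text \<open>The mode cut-off sends a continuous function to a trigonometric polynomial with allowed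
  momenta and fixes every such polynomial, so the analytic conditions become an explicit
  finite-dimensional description.\<close>

lemma band_limited_iff:
  fixes u :: "real^4 \<Rightarrow> 'b::euclidean_space"
  shows "smooth u \<and> periodic \<Lambda> u \<and> mode_cutoff \<Lambda> \<kappa> u = u
    \<longleftrightarrow> (\<exists>\<alpha> \<beta>. u = trig_poly (momenta \<Lambda> \<kappa>) \<alpha> \<beta>)" (is "?L \<longleftrightarrow> ?R")
proof
  assume ?L
  then show ?R using mode_cutoff_is_trig_poly[OF pos smooth_continuous, of u \<kappa>] by simp
next
  assume ?R
  then obtain \<alpha> \<beta> where u: "u = trig_poly (momenta \<Lambda> \<kappa>) \<alpha> \<beta>" by blast
  show ?L
    unfolding u by (intro conjI trig_poly_smooth trig_poly_periodic pos momenta_subset_lattice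
        mode_cutoff_trig_poly order_refl)
qed

lemma cutoff_gauge_iff:
  fixes A :: "real^4 \<Rightarrow> 'g::euclidean_space^3"
  shows "A \<in> cutoff_gauge_fields \<Lambda> \<kappa> \<longleftrightarrow> (\<exists>\<alpha> \<beta>. A = trig_poly (momenta \<Lambda> \<kappa>) \<alpha> \<beta>) \<and>
     (\<forall>x. x $ 0 = 0 \<longrightarrow> A x $ 1 = 0) \<and>
     (\<forall>x. x $ 0 = 0 \<and> x $ 1 = 0 \<longrightarrow> A x $ 2 = 0) \<and>
     (\<forall>x. x $ 0 = 0 \<and> x $ 1 = 0 \<and> x $ 2 = 0 \<longrightarrow> A x $ 3 = 0)"
  unfolding band_limited_iff[symmetric] cutoff_gauge_fields_def gauge_fields_def by blast

lemma cutoff_two_form_iff: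
  fixes F :: "real^4 \<Rightarrow> 'g::euclidean_space^3"
  shows "F \<in> cutoff_two_form_fields \<Lambda> \<kappa>
    \<longleftrightarrow> (\<exists>\<alpha> \<beta>. F = trig_poly (momenta \<Lambda> (2 * \<kappa>)) \<alpha> \<beta>) \<and> torus_integral \<Lambda> F = 0"
  unfolding band_limited_iff[symmetric] cutoff_two_form_fields_def two_form_fields_def by blast

lemma zero_trig_poly: "(\<lambda>x. 0) = trig_poly P (\<lambda>_. 0) (\<lambda>_. 0)"
  by (simp add: trig_poly_def fun_eq_iff)

lemma cutoff_gauge_subspace:
  "function_subspace (cutoff_gauge_fields \<Lambda> \<kappa> :: (real^4 \<Rightarrow> 'g::euclidean_space^3) set)"
  unfolding function_subspace_def
proof (intro conjI ballI allI)
  have "\<exists>\<alpha> \<beta>. (\<lambda>x. 0 :: 'g^3) = trig_poly (momenta \<Lambda> \<kappa>) \<alpha> \<beta>" using zero_trig_poly by blast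
  then show "(\<lambda>x. 0 :: 'g^3) \<in> cutoff_gauge_fields \<Lambda> \<kappa>" by (simp add: cutoff_gauge_iff)
next
  fix u v :: "real^4 \<Rightarrow> 'g^3" and a b
  assume u: "u \<in> cutoff_gauge_fields \<Lambda> \<kappa>" and v: "v \<in> cutoff_gauge_fields \<Lambda> \<kappa>"
  obtain \<alpha> \<beta> where U: "u = trig_poly (momenta \<Lambda> \<kappa>) \<alpha> \<beta>" using u by (auto simp: cutoff_gauge_iff)
  obtain \<alpha>' \<beta>' where V: "v = trig_poly (momenta \<Lambda> \<kappa>) \<alpha>' \<beta>'" using v by (auto simp: cutoff_gauge_iff)
  have "\<exists>\<alpha> \<beta>. (\<lambda>x. a *\<^sub>R u x + b *\<^sub>R v x) = trig_poly (momenta \<Lambda> \<kappa>) \<alpha> \<beta>"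
    unfolding U V trig_poly_lincomb by blast
  then show "(\<lambda>x. a *\<^sub>R u x + b *\<^sub>R v x) \<in> cutoff_gauge_fields \<Lambda> \<kappa>"
    using u v by (simp add: cutoff_gauge_iff)
qed

lemma cutoff_two_form_subspace:
  "function_subspace (cutoff_two_form_fields \<Lambda> \<kappa> :: (real^4 \<Rightarrow> 'g::euclidean_space^3) set)"
  unfolding function_subspace_def
proof (intro conjI ballI allI)
  have "\<exists>\<alpha> \<beta>. (\<lambda>x. 0 :: 'g^3) = trig_poly (momenta \<Lambda> (2 * \<kappa>)) \<alpha> \<beta>" using zero_trig_poly by blast
  then show "(\<lambda>x. 0 :: 'g^3) \<in> cutoff_two_form_fields \<Lambda> \<kappa>"
    by (simp add: cutoff_two_form_iff torus_integral_zero)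
next
  fix u v :: "real^4 \<Rightarrow> 'g^3" and a b
  assume u: "u \<in> cutoff_two_form_fields \<Lambda> \<kappa>" and v: "v \<in> cutoff_two_form_fields \<Lambda> \<kappa>"
  obtain \<alpha> \<beta> where U: "u = trig_poly (momenta \<Lambda> (2 * \<kappa>)) \<alpha> \<beta>"
    using u by (auto simp: cutoff_two_form_iff)
  obtain \<alpha>' \<beta>' where V: "v = trig_poly (momenta \<Lambda> (2 * \<kappa>)) \<alpha>' \<beta>'"
    using v by (auto simp: cutoff_two_form_iff)
  have "\<exists>\<alpha> \<beta>. (\<lambda>x. a *\<^sub>R u x + b *\<^sub>R v x) = trig_poly (momenta \<Lambda> (2 * \<kappa>)) \<alpha> \<beta>"
    unfolding U V trig_poly_lincomb by blast
  moreover have "torus_integral \<Lambda> (\<lambda>x. a *\<^sub>R u x + b *\<^sub>R v x)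
      = torus_integral \<Lambda> (\<lambda>x. a *\<^sub>R u x) + torus_integral \<Lambda> (\<lambda>x. b *\<^sub>R v x)"
    unfolding U V by (intro torus_integral_add continuous_on_scaleR continuous_on_const trig_poly_continuous)
  moreover have "torus_integral \<Lambda> (\<lambda>x. a *\<^sub>R u x) = a *\<^sub>R torus_integral \<Lambda> u"
    "torus_integral \<Lambda> (\<lambda>x. b *\<^sub>R v x) = b *\<^sub>R torus_integral \<Lambda> v"
    unfolding U V by (intro torus_integral_bounded_linear bounded_linear_scaleR_right trig_poly_continuous)+
  ultimately show "(\<lambda>x. a *\<^sub>R u x + b *\<^sub>R v x) \<in> cutoff_two_form_fields \<Lambda> \<kappa>"
    using u v by (simp add: cutoff_two_form_iff)
qed

lemma trig_poly_space_basis: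
  fixes S :: "(real^4 \<Rightarrow> 'b::euclidean_space) set"
  assumes "function_subspace S" "\<And>u. u \<in> S \<Longrightarrow> \<exists>\<alpha> \<beta>. u = trig_poly (momenta \<Lambda> \<kappa>) \<alpha> \<beta>"
  shows "\<exists>B. L2_basis \<Lambda> S B"
proof (rule L2_basis_exists[OF pos assms(1)])
  fix u assume "u \<in> S"
  then obtain \<alpha> \<beta> where u: "u = trig_poly (momenta \<Lambda> \<kappa>) \<alpha> \<beta>" using assms(2) by blast
  show "continuous_on UNIV u \<and> periodic \<Lambda> u"
    unfolding u by (intro conjI trig_poly_continuous trig_poly_periodic pos momenta_subset_lattice)
  show "\<exists>c. u = (\<lambda>x. \<Sum>j\<in>momenta \<Lambda> \<kappa> \<times> Basis \<times> UNIV. c j *\<^sub>R (\<lambda>(p, b, s) x.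
      (if s then cos (p \<bullet> x) else sin (p \<bullet> x)) *\<^sub>R b) j x)"
    unfolding u trig_poly_basis_expansion
    by (intro exI[of _ "\<lambda>(p, b, s). if s then \<alpha> p \<bullet> b else \<beta> p \<bullet> b"] ext sum.cong) auto
next
  show "finite (momenta \<Lambda> \<kappa> \<times> (Basis :: 'b set) \<times> (UNIV :: bool set))"
    using finite_momenta[OF pos] by simp
qed

text \<open>Differentiation creates no momenta, the range below \<open>2 * \<kappa>\<close> includes
  that below \<open>\<kappa>\<close>, and the zero mode is killed.\<close>

lemma gauge_deriv_two_form:
  fixes A :: "real^4 \<Rightarrow> 'g::euclidean_space^3"
  assumes "A \<in> cutoff_gauge_fields \<Lambda> \<kappa>" "\<kappa> > 0"
  shows "gauge_deriv A \<in> cutoff_two_form_fields \<Lambda> \<kappa>"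
proof -
  obtain \<alpha> \<beta> where A: "A = trig_poly (momenta \<Lambda> \<kappa>) \<alpha> \<beta>" using assms(1) by (auto simp: cutoff_gauge_iff)
  obtain \<gamma> \<delta> where z: "\<gamma> 0 = 0" and D: "gauge_deriv A = trig_poly (momenta \<Lambda> \<kappa>) \<gamma> \<delta>"
    unfolding A using gauge_deriv_trig_poly by blast
  have "torus_integral \<Lambda> (gauge_deriv A) = 0"
    unfolding D by (rule trig_poly_integral[where \<alpha> = \<gamma>, OF pos momenta_subset_lattice z])
  moreover have "\<exists>\<alpha> \<beta>. gauge_deriv A = trig_poly (momenta \<Lambda> (2 * \<kappa>)) \<alpha> \<beta>"
    unfolding D using assms(2)
    by (intro exI) (rule trig_poly_mono[OF finite_momenta[OF pos] momenta_mono], simp)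
  ultimately show ?thesis by (simp add: cutoff_two_form_iff)
qed

lemma integration_by_parts:
  fixes \<alpha> \<beta> \<alpha>' \<beta>' :: "real^4 \<Rightarrow> 'b::euclidean_space"
  assumes "P \<subseteq> dual_lattice \<Lambda>"
  defines "u \<equiv> trig_poly P \<alpha> \<beta>" and "v \<equiv> trig_poly P \<alpha>' \<beta>'"
  shows "L2_inner \<Lambda> (partial_deriv i u) v + L2_inner \<Lambda> u (partial_deriv i v) = 0"
proof -
  have c: "continuous_on UNIV (partial_deriv i u)" "continuous_on UNIV (partial_deriv i v)"
    "continuous_on UNIV u" "continuous_on UNIV v"
    unfolding u_def v_def trig_poly_partial by (intro trig_poly_continuous)+
  have "torus_integral \<Lambda> (\<lambda>x. partial_deriv i u x \<bullet> v x + u x \<bullet> partial_deriv i v x) = 0"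
  proof (rule torus_integral_partial_zero[OF pos])
    show "continuous_on UNIV (\<lambda>x. u x \<bullet> v x)" by (intro continuous_on_inner c)
    show "continuous_on UNIV (\<lambda>x. partial_deriv i u x \<bullet> v x + u x \<bullet> partial_deriv i v x)"
      by (intro continuous_on_add continuous_on_inner c)
    have "periodic \<Lambda> u" "periodic \<Lambda> v"
      unfolding u_def v_def by (intro trig_poly_periodic pos assms)+
    then show "periodic \<Lambda> (\<lambda>x. u x \<bullet> v x)" by (simp add: periodic_def)
    fix x
    have "((\<lambda>t. u (x + t *\<^sub>R axis i 1)) has_vector_derivative partial_deriv i u (x + 0 *\<^sub>R axis i 1)) (at 0)"
      "((\<lambda>t. v (x + t *\<^sub>R axis i 1)) has_vector_derivative partial_deriv i v (x + 0 *\<^sub>R axis i 1)) (at 0)"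
      unfolding u_def v_def by (rule trig_poly_line_derivative)+
    from bounded_bilinear.has_vector_derivative[OF bounded_bilinear_inner this]
    show "((\<lambda>t. u (x + t *\<^sub>R axis i 1) \<bullet> v (x + t *\<^sub>R axis i 1)) has_vector_derivative
        partial_deriv i u x \<bullet> v x + u x \<bullet> partial_deriv i v x) (at 0)"
      by (simp add: add.commute)
  qed
  then show ?thesis
    unfolding L2_inner_def
    by (subst (asm) torus_integral_add) (intro continuous_on_inner c | assumption)+
qed

text \<open>\<open>\<partial>\<^sub>0\<close> and the curl commute, the first is antisymmetric and the second symmetric, so \<open>\<partial>\<^sub>0 A\<close> and
  the curl of \<open>A\<close> are orthogonal.\<close>

lemma time_deriv_curl_orthogonal:
  fixes \<alpha> \<beta> :: "real^4 \<Rightarrow> 'g::euclidean_space^3"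
  assumes "P \<subseteq> dual_lattice \<Lambda>"
  defines "A \<equiv> trig_poly P \<alpha> \<beta>"
  shows "L2_inner \<Lambda> (partial_deriv 0 A) (curl A) = 0"
proof -
  have c: "continuous_on UNIV (partial_deriv j A)" for j
    unfolding A_def trig_poly_partial by (rule trig_poly_continuous)
  have cm: "continuous_on UNIV (\<lambda>x. curl_map i (partial_deriv j A x))" for i j
    unfolding A_def trig_poly_partial trig_poly_linear[OF curl_map_linear] by (rule trig_poly_continuous)
  have z: "L2_inner \<Lambda> (partial_deriv 0 A) (\<lambda>x. curl_map i (partial_deriv j A x)) = 0" for i j
  proof -
    define T where "T k = (\<lambda>x. curl_map i (partial_deriv k A x))" for k
    have T: "T k = trig_poly P (\<lambda>p. curl_map i ((p $ k) *\<^sub>R \<beta> p)) (\<lambda>p. curl_map i (- (p $ k) *\<^sub>R \<alpha> p))" for k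
      unfolding T_def A_def trig_poly_partial trig_poly_linear[OF curl_map_linear] ..
    have comm: "partial_deriv 0 (T j) = partial_deriv j (T 0)"
      unfolding T trig_poly_partial
      by (simp add: linear_cmul[OF curl_map_linear] linear_neg[OF curl_map_linear] mult.commute)
    \<comment> \<open>Since the derivatives commute, these two integrations by parts equate the
      pairing of \<open>\<partial>\<^sub>0 A\<close> and \<open>T j\<close> with that of
      \<open>\<partial>\<^sub>j A\<close> and \<open>T 0\<close>. Antisymmetry of
      \<open>curl_map i\<close> makes the second the negative of the first, so the pairing vanishes
      for each \<open>i\<close> and \<open>j\<close> separately.\<close>
    have "L2_inner \<Lambda> (partial_deriv 0 A) (T j) + L2_inner \<Lambda> A (partial_deriv 0 (T j)) = 0"
      "L2_inner \<Lambda> (partial_deriv j A) (T 0) + L2_inner \<Lambda> A (partial_deriv j (T 0)) = 0"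
      unfolding A_def T by (rule integration_by_parts[OF assms(1)])+
    moreover have "L2_inner \<Lambda> (partial_deriv j A) (T 0) = - L2_inner \<Lambda> (partial_deriv 0 A) (T j)"
    proof -
      have "L2_inner \<Lambda> (partial_deriv j A) (T 0) = torus_integral \<Lambda> (\<lambda>x. - (partial_deriv 0 A x \<bullet> T j x))"
        unfolding L2_inner_def T_def using curl_map_antisym by (intro arg_cong[of _ _ "torus_integral \<Lambda>"] ext)
      also have "\<dots> = - L2_inner \<Lambda> (partial_deriv 0 A) (T j)"
        unfolding L2_inner_def using c cm
        by (intro torus_integral_bounded_linear[of uminus] bounded_linear_minus bounded_linear_ident
            continuous_on_inner) (auto simp: T_def)
      finally show ?thesis .
    qed
    ultimately have "L2_inner \<Lambda> (partial_deriv 0 A) (T j) = 0" unfolding comm by linarith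
    then show ?thesis by (simp only: T_def)
  qed
  have "curl A = (\<lambda>x. \<Sum>i\<in>UNIV. 1 *\<^sub>R curl_map i (partial_deriv (spatial i) A x))"
    by (simp add: curl_eq fun_eq_iff)
  then have "L2_inner \<Lambda> (partial_deriv 0 A) (curl A)
      = (\<Sum>i\<in>UNIV. 1 * L2_inner \<Lambda> (partial_deriv 0 A) (\<lambda>x. curl_map i (partial_deriv (spatial i) A x)))"
    by (simp only:) (rule L2_inner_sum_right[OF c cm])
  then show ?thesis by (simp add: z)
qed

text \<open>The components vanish in the order 1, 2, 3. Component \<open>k\<close> is constant in
  direction 0, and once the earlier components vanish the curl equations make it constant in the
  spatial directions below \<open>k\<close>. Along these directions any point can be moved to where
  the gauge condition applies.\<close>

lemma gauge_deriv_injective: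
  fixes A :: "real^4 \<Rightarrow> 'g::euclidean_space^3"
  assumes A: "A \<in> cutoff_gauge_fields \<Lambda> \<kappa>" and zero: "\<And>x. gauge_deriv A x = 0"
  shows "A x = 0"
proof -
  obtain \<alpha> \<beta> where At: "A = trig_poly (momenta \<Lambda> \<kappa>) \<alpha> \<beta>" using A by (auto simp: cutoff_gauge_iff)
  \<comment> \<open>Combined with the orthogonality of the two summands of \<open>D A\<close>, this
    identity makes the norm of \<open>\<partial>\<^sub>0 A\<close> vanish.\<close>
  have curl_neg: "curl A x = - 1 *\<^sub>R partial_deriv 0 A x" for x
    using zero[of x] by (simp add: gauge_deriv_def eq_neg_iff_add_eq_0 add.commute)
  have c0: "continuous_on UNIV (partial_deriv 0 A)"
    unfolding At trig_poly_partial by (rule trig_poly_continuous)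
  have "L2_inner \<Lambda> (partial_deriv 0 A) (curl A) = 0"
    unfolding At by (rule time_deriv_curl_orthogonal[OF momenta_subset_lattice])
  moreover have "L2_inner \<Lambda> (partial_deriv 0 A) (curl A) = - 1 * L2_inner \<Lambda> (partial_deriv 0 A) (partial_deriv 0 A)"
    unfolding curl_neg[abs_def] by (rule L2_inner_scale_right[OF c0 c0])
  ultimately have "L2_inner \<Lambda> (partial_deriv 0 A) (partial_deriv 0 A) = 0" by simp
  moreover have "periodic \<Lambda> (partial_deriv 0 A)"
    unfolding At trig_poly_partial by (intro trig_poly_periodic pos momenta_subset_lattice)
  ultimately have d0: "partial_deriv 0 A x = 0" for x
    using L2_inner_eq_0[OF pos c0] by blast
  then have cz: "curl A x $ k = 0" for x k by (simp add: curl_neg)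
  have curl3: "\<And>k x. (\<Sum>i\<in>UNIV. \<Sum>j\<in>UNIV. levi_civita i j k *\<^sub>R (partial_deriv (spatial i) A x $ j)) = 0"
    using cz by (simp add: curl_def)
  have e1: "partial_deriv 1 A x $ 2 = partial_deriv 2 A x $ 1"
    and e2: "partial_deriv 3 A x $ 1 = partial_deriv 1 A x $ 3"
    and e3: "partial_deriv 2 A x $ 3 = partial_deriv 3 A x $ 2" for x
    using curl3[where k = 3 and x = x] curl3[where k = 2 and x = x] curl3[where k = 1 and x = x] unfolding sum_3 by (simp_all add: levi_civita_def spatial_def)
  have const: "A (x + t *\<^sub>R axis i 1) $ k = A x $ k" if "\<And>x. partial_deriv i A x $ k = 0" for i k x t
    using that unfolding At by (rule component_constant)
  have deriv: "partial_deriv i A x $ k = 0" if "\<And>x. A x $ k = 0" for i k x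
    using that unfolding At by (rule component_deriv_zero)
  have V: "\<And>x. x $ 0 = 0 \<Longrightarrow> A x $ 1 = 0" "\<And>x. x $ 0 = 0 \<Longrightarrow> x $ 1 = 0 \<Longrightarrow> A x $ 2 = 0"
    "\<And>x. x $ 0 = 0 \<Longrightarrow> x $ 1 = 0 \<Longrightarrow> x $ 2 = 0 \<Longrightarrow> A x $ 3 = 0"
    using A unfolding cutoff_gauge_iff by blast+
  have move: "A x $ k = A (x + (- (x $ i)) *\<^sub>R axis i 1) $ k" if "\<And>x. partial_deriv i A x $ k = 0" for i k x
    by (rule const[OF that, symmetric])
  have d0k: "partial_deriv 0 A x $ k = 0" for x k by (simp add: d0)
  have A1: "A x $ 1 = 0" for x
  proof -
    have "A x $ 1 = A (x + (- (x $ 0)) *\<^sub>R axis 0 1) $ 1" by (rule move[OF d0k])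
    also have "\<dots> = 0" by (rule V(1)) (simp add: axis_def)
    finally show ?thesis .
  qed
  have A2: "A x $ 2 = 0" for x
  proof -
    have d1: "partial_deriv 1 A x $ 2 = 0" for x using e1[of x] deriv[OF A1] by simp
    let ?y = "x + (- (x $ 0)) *\<^sub>R axis 0 1"
    let ?z = "?y + (- (?y $ 1)) *\<^sub>R axis 1 1"
    have "A x $ 2 = A ?y $ 2" by (rule move[OF d0k])
    also have "\<dots> = A ?z $ 2" by (rule move[OF d1])
    also have "\<dots> = 0" by (rule V(2)) (simp_all add: axis_def)
    finally show ?thesis .
  qed
  have A3: "A x $ 3 = 0" for x
  proof -
    have d1: "partial_deriv 1 A x $ 3 = 0" "partial_deriv 2 A x $ 3 = 0" for x
      using e2[of x] e3[of x] deriv[OF A1] deriv[OF A2] by simp_all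
    let ?y = "x + (- (x $ 0)) *\<^sub>R axis 0 1"
    let ?z = "?y + (- (?y $ 1)) *\<^sub>R axis 1 1"
    let ?w = "?z + (- (?z $ 2)) *\<^sub>R axis 2 1"
    have "A x $ 3 = A ?y $ 3" by (rule move[OF d0k])
    also have "\<dots> = A ?z $ 3" by (rule move[OF d1(1)])
    also have "\<dots> = A ?w $ 3" by (rule move[OF d1(2)])
    also have "\<dots> = 0" by (rule V(3)) (simp_all add: axis_def)
    finally show ?thesis .
  qed
  show ?thesis unfolding vec_eq_iff forall_3 using A1 A2 A3 by simp
qed

end

section \<open>The propagator in an orthonormal basis\<close>

lemma pairing_commute: "pairing \<Lambda> w z = pairing \<Lambda> z w"
  by (simp add: pairing_def mult.commute)

lemma pairing_sum_right:
  fixes w :: "('n::finite) cfield"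
  assumes "continuous_on UNIV w" "\<And>j. j \<in> J \<Longrightarrow> continuous_on UNIV (v j)"
  shows "pairing \<Lambda> w (\<lambda>x. \<Sum>j\<in>J. c j *s v j x) = (\<Sum>j\<in>J. c j * pairing \<Lambda> w (v j))"
proof -
  have c: "continuous_on UNIV (\<lambda>x. \<Sum>r\<in>UNIV. w x $ r * v j x $ r)" if "j \<in> J" for j
    using assms that by (intro continuous_intros) auto
  have "pairing \<Lambda> w (\<lambda>x. \<Sum>j\<in>J. c j *s v j x)
      = torus_integral \<Lambda> (\<lambda>x. \<Sum>j\<in>J. c j * (\<Sum>r\<in>UNIV. w x $ r * v j x $ r))"
    unfolding pairing_def
    by (simp add: sum_distrib_left sum.swap[of _ J] mult_ac)
  also have "\<dots> = (\<Sum>j\<in>J. torus_integral \<Lambda> (\<lambda>x. c j * (\<Sum>r\<in>UNIV. w x $ r * v j x $ r)))"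
    by (intro torus_integral_sum continuous_on_mult_left c)
  also have "\<dots> = (\<Sum>j\<in>J. c j * pairing \<Lambda> w (v j))"
    unfolding pairing_def
    by (intro sum.cong refl torus_integral_bounded_linear[OF bounded_linear_mult_right] c)
  finally show ?thesis .
qed

lemma pairing_add_right:
  fixes w :: "('n::finite) cfield"
  assumes "continuous_on UNIV w" "continuous_on UNIV u" "continuous_on UNIV v"
  shows "pairing \<Lambda> w (\<lambda>x. u x + v x) = pairing \<Lambda> w u + pairing \<Lambda> w v"
  using pairing_sum_right[OF assms(1), of "UNIV :: bool set" "\<lambda>b. if b then u else v" \<Lambda> "\<lambda>_. 1"] assms
  by (simp add: UNIV_bool add.commute)

lemma pairing_diff_right:
  fixes w :: "('n::finite) cfield"
  assumes "continuous_on UNIV w" "continuous_on UNIV u" "continuous_on UNIV v"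
  shows "pairing \<Lambda> w (\<lambda>x. u x - v x) = pairing \<Lambda> w u - pairing \<Lambda> w v"
  using pairing_sum_right[OF assms(1), of "UNIV :: bool set" "\<lambda>b. if b then u else v" \<Lambda> "\<lambda>b. if b then 1 else - 1"] assms
  by (simp add: UNIV_bool vec_eq_iff)

text \<open>Testing with the conjugate of a row of the difference of two kernels shows that a kernel is
  determined by its operator.\<close>

lemma kernel_unique:
  fixes C C' :: "real^4 \<Rightarrow> real^4 \<Rightarrow> complex^'n::finite comp^'n comp"
  assumes pos: "\<And>i. \<Lambda> $ i > 0"
    and C: "continuous_on UNIV (\<lambda>(x, y). C x y)" "\<And>x. periodic \<Lambda> (C x)"
    and C': "continuous_on UNIV (\<lambda>(x, y). C' x y)" "\<And>x. periodic \<Lambda> (C' x)"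
    and eq: "\<And>w x. continuous_on UNIV w \<Longrightarrow> periodic \<Lambda> w \<Longrightarrow>
      torus_integral \<Lambda> (\<lambda>y. C x y *v w y) = torus_integral \<Lambda> (\<lambda>y. C' x y *v w y)"
  shows "C = C'"
proof (intro ext)
  fix x y0 :: "real^4"
  have "continuous_on UNIV (Pair x :: real^4 \<Rightarrow> (real^4) \<times> (real^4))"
    by (intro continuous_on_Pair continuous_on_const continuous_on_id)
  then have c: "continuous_on UNIV (C x)" "continuous_on UNIV (C' x)"
    using continuous_on_compose2[OF C(1), of UNIV "Pair x"]
      continuous_on_compose2[OF C'(1), of UNIV "Pair x"] by auto
  show "C x y0 = C' x y0"
    unfolding vec_eq_iff
  proof (intro allI)
    fix r s
    define w where "w y = (\<chi> s. cnj (C x y $ r $ s - C' x y $ r $ s))" for y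
    have w: "continuous_on UNIV w" unfolding w_def
      using c by (intro continuous_on_vec_lambda continuous_intros) auto
    have wp: "periodic \<Lambda> w" using C(2)[of x] C'(2)[of x] by (simp add: periodic_def w_def)
    have cv: "continuous_on UNIV (\<lambda>y. C x y *v w y)" "continuous_on UNIV (\<lambda>y. C' x y *v w y)"
      unfolding matrix_vector_mult_def using c w
      by (intro continuous_on_vec_lambda continuous_intros; simp)+
    define f where "f y = (\<Sum>s\<in>UNIV. (cmod (C x y $ r $ s - C' x y $ r $ s))\<^sup>2)" for y
    have f: "continuous_on UNIV f" unfolding f_def using c by (intro continuous_intros)
    have fp: "periodic \<Lambda> f" using C(2)[of x] C'(2)[of x] by (simp add: periodic_def f_def)
    have "(C x y *v w y) $ r - (C' x y *v w y) $ r = complex_of_real (f y)" for y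
      unfolding matrix_vector_mult_def f_def w_def of_real_sum complex_norm_square
      by (simp add: algebra_simps flip: sum_subtractf)
    then have "complex_of_real (torus_integral \<Lambda> f)
        = torus_integral \<Lambda> (\<lambda>y. (C x y *v w y) $ r - (C' x y *v w y) $ r)"
      by (simp only: torus_integral_bounded_linear[OF bounded_linear_of_real f])
    also have "\<dots> = torus_integral \<Lambda> (\<lambda>y. (C x y *v w y) $ r) - torus_integral \<Lambda> (\<lambda>y. (C' x y *v w y) $ r)"
      using cv by (intro torus_integral_diff continuous_intros)
    also have "\<dots> = torus_integral \<Lambda> (\<lambda>y. C x y *v w y) $ r - torus_integral \<Lambda> (\<lambda>y. C' x y *v w y) $ r"
      by (simp only: torus_integral_bounded_linear[OF bounded_linear_vec_nth] cv)
    also have "\<dots> = 0" using eq[OF w wp] by simp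
    finally have "torus_integral \<Lambda> f = 0" by simp
    then have "f y0 = 0"
      by (intro torus_integral_nonneg_eq_0[OF pos f fp]) (auto simp: f_def intro: sum_nonneg)
    then show "C x y0 $ r $ s = C' x y0 $ r $ s"
      unfolding f_def by (subst (asm) sum_nonneg_eq_0_iff) auto
  qed
qed

context
  fixes \<Lambda> :: "real^4" and \<kappa> :: real and e :: "'n::finite \<Rightarrow> 'g::euclidean_space"
    and I :: "'i set" and E :: "'i \<Rightarrow> 'n cfield"
  assumes pos: "\<And>i. \<Lambda> $ i > 0" and fin: "finite I"
    and E_cont: "\<And>m. m \<in> I \<Longrightarrow> continuous_on UNIV (E m)"
    and E_per: "\<And>m. m \<in> I \<Longrightarrow> periodic \<Lambda> (E m)"
    and E_on: "\<And>m n. m \<in> I \<Longrightarrow> n \<in> I \<Longrightarrow> pairing \<Lambda> (E m) (E n) = (if m = n then 1 else 0)"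
begin

definition lincomb :: "('i \<Rightarrow> complex) \<Rightarrow> 'n cfield" where
  "lincomb z = (\<lambda>x. \<Sum>m\<in>I. z m *s E m x)"

lemma smult_continuous:
  fixes u :: "'n cfield"
  assumes "continuous_on UNIV u"
  shows "continuous_on UNIV (\<lambda>x. c *s u x)"
  unfolding vector_scalar_mult_def using assms
  by (intro continuous_on_vec_lambda continuous_intros)

lemma lincomb_continuous: "continuous_on UNIV (lincomb z)"
  unfolding lincomb_def by (intro continuous_on_sum smult_continuous E_cont)

lemma pairing_E_lincomb: "m \<in> I \<Longrightarrow> pairing \<Lambda> (E m) (lincomb z) = z m"
  unfolding lincomb_def using fin by (subst pairing_sum_right) (simp_all add: E_cont E_on if_distrib cong: if_cong)

lemma pairing_lincomb: "continuous_on UNIV w \<Longrightarrow> pairing \<Lambda> (lincomb y) w = (\<Sum>m\<in>I. y m * pairing \<Lambda> (E m) w)"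
  unfolding lincomb_def pairing_commute[of \<Lambda> _ w] by (subst pairing_sum_right) (simp_all add: E_cont)

lemma lincomb_add: "(\<lambda>x. lincomb y x + lincomb z x) = lincomb (\<lambda>m. y m + z m)"
  by (simp add: lincomb_def fun_eq_iff vec_eq_iff sum.distrib ring_distribs)

lemma lincomb_scale: "(\<lambda>x. c *s lincomb z x) = lincomb (\<lambda>m. c * z m)"
  by (simp add: lincomb_def fun_eq_iff vec_eq_iff sum_distrib_left mult.assoc)

lemma lincomb_cong: "(\<And>m. m \<in> I \<Longrightarrow> y m = z m) \<Longrightarrow> lincomb y = lincomb z"
  unfolding lincomb_def by (intro ext sum.cong) auto

lemma E_lincomb: "m \<in> I \<Longrightarrow> E m = lincomb (\<lambda>k. if k = m then 1 else 0)"
  using fin by (simp add: lincomb_def fun_eq_iff vec_eq_iff if_distrib[of "\<lambda>z. z * _"] cong: if_cong)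

context
  assumes W: "complexified_space e \<Lambda> \<kappa> = range lincomb"
begin

text \<open>Pairing with \<open>E m\<close> reads off the \<open>m\<close>-th coefficient, so the
  orthogonality conditions in the description have exactly one solution.\<close>

lemma projection_eq:
  assumes "continuous_on UNIV w"
  shows "projection e \<Lambda> \<kappa> w = lincomb (\<lambda>m. pairing \<Lambda> (E m) w)"
proof -
  have d: "pairing \<Lambda> z (\<lambda>x. w x - lincomb u x) = pairing \<Lambda> z w - pairing \<Lambda> z (lincomb u)"
    if "continuous_on UNIV z" for z u
    by (intro pairing_diff_right that assms lincomb_continuous)
  show ?thesis
    unfolding projection_def W
  proof (rule the_equality)
    show "lincomb (\<lambda>m. pairing \<Lambda> (E m) w) \<in> range lincomb \<and>
        (\<forall>z\<in>range lincomb. pairing \<Lambda> z (\<lambda>x. w x - lincomb (\<lambda>m. pairing \<Lambda> (E m) w) x) = 0)"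
      using assms by (auto simp: d lincomb_continuous pairing_lincomb pairing_E_lincomb)
  next
    fix u assume u: "u \<in> range lincomb \<and> (\<forall>z\<in>range lincomb. pairing \<Lambda> z (\<lambda>x. w x - u x) = 0)"
    then obtain y where y: "u = lincomb y" by blast
    have "y m = pairing \<Lambda> (E m) w" if m: "m \<in> I" for m
    proof -
      have "E m \<in> range lincomb" using E_lincomb[OF m] by blast
      then have "pairing \<Lambda> (E m) (\<lambda>x. w x - lincomb y x) = 0" using u unfolding y by blast
      then show ?thesis by (simp add: d[OF E_cont[OF m]] pairing_E_lincomb[OF m])
    qed
    then show "u = lincomb (\<lambda>m. pairing \<Lambda> (E m) w)" unfolding y by (rule lincomb_cong)
  qed
qed

section \<open>Identification of the propagator with an explicit kernel\<close>

context
  fixes q R :: "'i \<Rightarrow> 'i \<Rightarrow> complex" and rc and br :: "'g \<Rightarrow> 'g \<Rightarrow> 'g" and \<mu> :: real and \<Phi> :: "'g^3"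
  assumes q_sym: "\<And>m n. m \<in> I \<Longrightarrow> n \<in> I \<Longrightarrow> q m n = q n m"
    and q_inj: "\<And>z. (\<And>m. m \<in> I \<Longrightarrow> (\<Sum>n\<in>I. q m n * z n) = 0) \<Longrightarrow> \<forall>m\<in>I. z m = 0"
    and R: "\<And>m k. m \<in> I \<Longrightarrow> k \<in> I \<Longrightarrow> (\<Sum>n\<in>I. q m n * R n k) = (if m = k then 1 else 0)"
    and coords: "\<And>v. v \<in> boson_space \<Lambda> \<kappa> \<Longrightarrow> components e v = lincomb (\<lambda>m. of_real (rc v m))"
    and coords_surj: "\<And>c. \<exists>v\<in>boson_space \<Lambda> \<kappa>. \<forall>m\<in>I. rc v m = c m"
    and form: "\<And>v. v \<in> boson_space \<Lambda> \<kappa> \<Longrightarrow> boson_form br e \<Lambda> \<kappa> \<mu> \<Phi> v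
      = (\<Sum>m\<in>I. \<Sum>n\<in>I. of_real (rc v m) * q m n * of_real (rc v n))"
begin

definition matrix_operator :: "'n cfield \<Rightarrow> 'n cfield" where
  "matrix_operator w = lincomb (\<lambda>m. \<Sum>n\<in>I. q m n * pairing \<Lambda> (E n) w)"

lemma matrix_operator_lincomb: "matrix_operator (lincomb z) = lincomb (\<lambda>m. \<Sum>n\<in>I. q m n * z n)"
  unfolding matrix_operator_def by (simp add: pairing_E_lincomb)

lemma form_operator_exists: "form_operator br e \<Lambda> \<kappa> \<mu> \<Phi> matrix_operator"
  unfolding form_operator_def Let_def W
proof (intro conjI ballI allI)
  fix w z assume "w \<in> range lincomb" "z \<in> range lincomb"
  then obtain y y' where wz: "w = lincomb y" "z = lincomb y'" by blast
  show "matrix_operator w \<in> range lincomb" unfolding wz matrix_operator_lincomb by blast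
  show "matrix_operator (\<lambda>x. w x + z x) = (\<lambda>x. matrix_operator w x + matrix_operator z x)"
    unfolding wz lincomb_add matrix_operator_lincomb by (simp add: ring_distribs sum.distrib)
  show "matrix_operator (\<lambda>x. c *s w x) = (\<lambda>x. c *s matrix_operator w x)" for c
    unfolding wz lincomb_scale matrix_operator_lincomb by (simp add: sum_distrib_left mult_ac)
  show "pairing \<Lambda> w (matrix_operator z) = pairing \<Lambda> (matrix_operator w) z"
  proof -
    have "pairing \<Lambda> w (matrix_operator z) = (\<Sum>m\<in>I. \<Sum>n\<in>I. y m * (q m n * y' n))"
      unfolding wz matrix_operator_lincomb
      by (simp add: pairing_lincomb[OF lincomb_continuous] pairing_E_lincomb sum_distrib_left)
    also have "\<dots> = (\<Sum>n\<in>I. \<Sum>m\<in>I. q n m * y m * y' n)"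
      by (subst sum.swap) (intro sum.cong refl, simp add: q_sym mult_ac)
    also have "\<dots> = pairing \<Lambda> (matrix_operator w) z"
      unfolding wz matrix_operator_lincomb
      by (simp add: pairing_lincomb[OF lincomb_continuous] pairing_E_lincomb sum_distrib_right)
    finally show ?thesis .
  qed
next
  fix v :: "(real^4 \<Rightarrow> 'g^3) \<times> (real^4 \<Rightarrow> 'g^3)"
  assume v: "v \<in> boson_space \<Lambda> \<kappa>"
  show "boson_form br e \<Lambda> \<kappa> \<mu> \<Phi> v = pairing \<Lambda> (components e v) (matrix_operator (components e v))"
    unfolding form[OF v] coords[OF v] matrix_operator_lincomb
    by (simp add: pairing_lincomb[OF lincomb_continuous] pairing_E_lincomb sum_distrib_left mult.assoc)
qed

text \<open>Polarization. The form is prescribed on real vectors only, but basis vectors and their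
  pairwise sums are real and determine the symmetric bilinear form on the basis; complex linearity
  does the rest. \<open>Q\<close> maps the space into itself, so the pairings with basis vectors
  determine its values.\<close>

lemma form_operator_unique:
  assumes Q: "form_operator br e \<Lambda> \<kappa> \<mu> \<Phi> Q"
  shows "Q (lincomb z) = lincomb (\<lambda>m. \<Sum>n\<in>I. q m n * z n)"
proof -
  have Q_range: "\<And>y. Q (lincomb y) \<in> range lincomb"
    and Q_add: "\<And>y z. Q (lincomb (\<lambda>m. y m + z m)) = (\<lambda>x. Q (lincomb y) x + Q (lincomb z) x)"
    and Q_scale: "\<And>y c. Q (lincomb (\<lambda>m. c * y m)) = (\<lambda>x. c *s Q (lincomb y) x)"
    and Q_sym: "\<And>y z. pairing \<Lambda> (lincomb y) (Q (lincomb z)) = pairing \<Lambda> (Q (lincomb y)) (lincomb z)"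
    and Q_form: "\<And>v. v \<in> boson_space \<Lambda> \<kappa> \<Longrightarrow>
      boson_form br e \<Lambda> \<kappa> \<mu> \<Phi> v = pairing \<Lambda> (components e v) (Q (components e v))"
    using Q unfolding form_operator_def Let_def W by (auto simp flip: lincomb_add lincomb_scale)
  have Q_cont: "continuous_on UNIV (Q (lincomb y))" for y
    using Q_range[of y] lincomb_continuous by auto
  define b where "b y z = pairing \<Lambda> (lincomb y) (Q (lincomb z))" for y z
  have b_sym: "b y z = b z y" for y z
    unfolding b_def by (rule trans[OF Q_sym[of y z] pairing_commute])
  have b_add: "b y (\<lambda>m. z m + z' m) = b y z + b y z'" for y z z'
    unfolding b_def Q_add by (intro pairing_add_right lincomb_continuous Q_cont)
  have b_diag: "b (\<lambda>m. of_real (c m)) (\<lambda>m. of_real (c m))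
      = (\<Sum>m\<in>I. \<Sum>n\<in>I. of_real (c m) * q m n * of_real (c n))" for c
  proof -
    obtain v where v: "v \<in> boson_space \<Lambda> \<kappa>" "\<And>m. m \<in> I \<Longrightarrow> rc v m = c m" using coords_surj by blast
    have "components e v = lincomb (\<lambda>m. of_real (c m))"
      unfolding coords[OF v(1)] by (intro lincomb_cong) (simp add: v(2))
    then show ?thesis using form[OF v(1)] Q_form[OF v(1)] by (simp add: b_def v(2))
  qed
  define u where "u m = (\<lambda>k. if k = m then 1 else 0 :: complex)" for m :: 'i
  have u_real: "u m = (\<lambda>k. of_real (if k = m then 1 else 0))" for m by (simp add: u_def fun_eq_iff)
  have quu: "b (u m) (u m) = q m m" if "m \<in> I" for m
    unfolding u_real b_diag using that fin
    by (simp add: if_distrib[of of_real] if_distrib[of "\<lambda>z. z * _"] if_distrib[of "\<lambda>z. _ * z"] cong: if_cong)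
  have buu: "b (u m) (u n) = q m n" if m: "m \<in> I" and n: "n \<in> I" for m n
  proof -
    \<comment> \<open>Coordinates of the sum of two basis vectors. For \<open>m = n\<close> the
      value is 2, so this case needs no separate treatment.\<close>
    define c where "c k = (if k = m then 1 else 0) + (if k = n then 1 else 0 :: real)" for k
    have c: "(\<lambda>k. u m k + u n k) = (\<lambda>k. of_real (c k))" by (simp add: u_def c_def fun_eq_iff)
    have row: "(\<Sum>k\<in>I. f k * of_real (c k)) = f m + f n" for f :: "'i \<Rightarrow> complex"
    proof -
      have "(\<Sum>k\<in>I. f k * of_real (c k)) = (\<Sum>k\<in>I. (if k = m then f k else 0) + (if k = n then f k else 0))"
        by (intro sum.cong) (auto simp: c_def)
      then show ?thesis using m n fin by (simp add: sum.distrib)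
    qed
    have "b (\<lambda>k. u m k + u n k) (\<lambda>k. u m k + u n k) = (\<Sum>k\<in>I. (\<Sum>l\<in>I. q k l * of_real (c l)) * of_real (c k))"
      unfolding c b_diag sum_distrib_right by (intro sum.cong refl) (simp add: mult_ac)
    also have "\<dots> = q m m + q m n + (q n m + q n n)" by (simp only: row)
    finally have "b (\<lambda>k. u m k + u n k) (\<lambda>k. u m k + u n k) = q m m + q m n + (q n m + q n n)" .
    moreover have "b (\<lambda>k. u m k + u n k) (\<lambda>k. u m k + u n k) = b (u m) (u m) + b (u m) (u n) + (b (u n) (u m) + b (u n) (u n))"
      unfolding b_add b_sym[of "\<lambda>k. u m k + u n k"] by (simp add: b_sym[of "u n" "u m"])
    ultimately show ?thesis using quu[OF m] quu[OF n] b_sym[of "u n" "u m"] q_sym[OF n m] by simp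
  qed
  have b_scale: "b y (\<lambda>m. c * z m) = c * b y z" for y z c
  proof -
    have "pairing \<Lambda> (lincomb y) (\<lambda>x. \<Sum>j\<in>{()}. c *s Q (lincomb z) x) = (\<Sum>j\<in>{()}. c * b y z)"
      unfolding b_def by (rule pairing_sum_right) (intro lincomb_continuous Q_cont)+
    then show ?thesis by (simp add: b_def Q_scale)
  qed
  have b_sum: "b y (\<lambda>m. \<Sum>n\<in>J. z n * u n m) = (\<Sum>n\<in>J. z n * b y (u n))" if "finite J" for J y
    using that
  proof (induction J rule: finite_induct)
    case empty
    show ?case using b_scale[of y 0 "\<lambda>_. 0"] by simp
  next
    case (insert j J)
    then show ?case using b_add[of y "\<lambda>m. z j * u j m" "\<lambda>m. \<Sum>n\<in>J. z n * u n m"] by (simp add: b_scale)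
  qed
  have lz: "lincomb z = lincomb (\<lambda>m. \<Sum>n\<in>I. z n * u n m)"
    using fin by (intro lincomb_cong) (simp add: u_def if_distrib[of "\<lambda>z. _ * z"] cong: if_cong)
  obtain y where y: "Q (lincomb z) = lincomb y" using Q_range[of z] by blast
  have "y m = (\<Sum>n\<in>I. q m n * z n)" if m: "m \<in> I" for m
  proof -
    have "y m = pairing \<Lambda> (lincomb (u m)) (Q (lincomb z))"
      unfolding y u_def E_lincomb[OF m, symmetric] by (simp add: pairing_E_lincomb[OF m])
    also have "\<dots> = b (u m) (\<lambda>m. \<Sum>n\<in>I. z n * u n m)" unfolding b_def lz[symmetric] ..
    also have "\<dots> = (\<Sum>n\<in>I. z n * q m n)" unfolding b_sum[OF fin] using m by (simp add: buu)
    finally show ?thesis by (simp add: mult.commute)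
  qed
  then show ?thesis unfolding y by (rule lincomb_cong)
qed

text \<open>\<open>inv_into\<close> chooses some preimage; injectivity of the form matrix leaves
  only one, and the right inverse \<open>R\<close> produces it.\<close>

lemma form_operator_inverse:
  assumes Q: "form_operator br e \<Lambda> \<kappa> \<mu> \<Phi> Q"
  shows "inv_into (complexified_space e \<Lambda> \<kappa>) Q (lincomb y) = lincomb (\<lambda>m. \<Sum>k\<in>I. R m k * y k)"
proof -
  have inj: "inj_on Q (range lincomb)"
  proof (rule inj_onI)
    fix w w' assume "w \<in> range lincomb" "w' \<in> range lincomb" and eq: "Q w = Q w'"
    then obtain a a' where w: "w = lincomb a" "w' = lincomb a'" by blast
    have lin: "lincomb (\<lambda>m. \<Sum>n\<in>I. q m n * a n) = lincomb (\<lambda>m. \<Sum>n\<in>I. q m n * a' n)"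
      using eq unfolding w form_operator_unique[OF Q] .
    have "(\<Sum>n\<in>I. q m n * a n) = (\<Sum>n\<in>I. q m n * a' n)" if m: "m \<in> I" for m
      using arg_cong[OF lin, of "pairing \<Lambda> (E m)"] by (simp only: pairing_E_lincomb[OF m])
    then have "\<forall>m\<in>I. a m - a' m = 0" by (intro q_inj) (simp add: right_diff_distrib sum_subtractf)
    then show "w = w'" unfolding w by (intro lincomb_cong) auto
  qed
  have sol: "Q (lincomb (\<lambda>m. \<Sum>k\<in>I. R m k * y k)) = lincomb y"
    unfolding form_operator_unique[OF Q]
  proof (rule lincomb_cong)
    fix m assume m: "m \<in> I"
    have "(\<Sum>n\<in>I. q m n * (\<Sum>k\<in>I. R n k * y k)) = (\<Sum>k\<in>I. (\<Sum>n\<in>I. q m n * R n k) * y k)"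
      unfolding sum_distrib_left sum_distrib_right by (subst sum.swap) (simp add: mult.assoc)
    also have "\<dots> = (\<Sum>k\<in>I. if m = k then y k else 0)" using m by (intro sum.cong) (auto simp: R)
    finally show "(\<Sum>n\<in>I. q m n * (\<Sum>k\<in>I. R n k * y k)) = y m" using m fin by simp
  qed
  show ?thesis
    using inv_into_f_f[OF inj rangeI, of "\<lambda>m. \<Sum>k\<in>I. R m k * y k"] unfolding W sol .
qed

text \<open>The inverse form matrix \<open>R\<close> expanded in the basis. \<open>E k\<close>
  carries no conjugate because the pairing is bilinear.\<close>

definition kernel_matrix :: "real^4 \<Rightarrow> real^4 \<Rightarrow> complex^'n comp^'n comp" where
  "kernel_matrix x y = (\<chi> r s. \<Sum>m\<in>I. \<Sum>k\<in>I. R m k * (E m x $ r * E k y $ s))"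

lemma kernel_matrix_is_kernel:
  assumes Q: "form_operator br e \<Lambda> \<kappa> \<mu> \<Phi> Q"
  shows "integral_kernel \<Lambda> (inv_into (complexified_space e \<Lambda> \<kappa>) Q \<circ> projection e \<Lambda> \<kappa>) kernel_matrix"
  unfolding integral_kernel_def
proof (intro conjI allI impI)
  have "continuous_on UNIV (\<lambda>p :: (real^4) \<times> (real^4). E m (fst p))"
    "continuous_on UNIV (\<lambda>p :: (real^4) \<times> (real^4). E m (snd p))"
    if "m \<in> I" for m
    using E_cont[OF that] by (auto intro!: continuous_on_compose2[of UNIV "E m"] continuous_intros)
  then show "continuous_on UNIV (\<lambda>(x, y). kernel_matrix x y)"
    unfolding kernel_matrix_def case_prod_unfold
    by (intro continuous_on_vec_lambda continuous_on_sum continuous_on_mult continuous_on_const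
        continuous_on_component) auto
  have E_shift: "E m (x + (2 * \<Lambda> $ i) *\<^sub>R axis i 1) = E m x" if "m \<in> I" for m x i
    using E_per[OF that] unfolding periodic_def by blast
  show "periodic \<Lambda> (\<lambda>x. kernel_matrix x y)" "periodic \<Lambda> (kernel_matrix x)" for x y
    unfolding kernel_matrix_def periodic_def by (auto simp: vec_eq_iff E_shift intro!: sum.cong)
  fix w :: "'n cfield" assume w: "continuous_on UNIV w \<and> periodic \<Lambda> w"
  show "(inv_into (complexified_space e \<Lambda> \<kappa>) Q \<circ> projection e \<Lambda> \<kappa>) w
      = (\<lambda>x. torus_integral \<Lambda> (\<lambda>y. kernel_matrix x y *v w y))"
  proof
    fix x
    have c: "continuous_on UNIV (\<lambda>y. \<Sum>s\<in>UNIV. E k y $ s * w y $ s)" if "k \<in> I" for k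
      using w E_cont[OF that] by (intro continuous_intros) auto
    have "kernel_matrix x y *v w y
        = (\<Sum>m\<in>I. \<Sum>k\<in>I. (\<Sum>s\<in>UNIV. E k y $ s * w y $ s) *s (R m k *s E m x))" for y
    proof -
      have "(kernel_matrix x y *v w y) $ r
          = (\<Sum>s\<in>UNIV. \<Sum>m\<in>I. \<Sum>k\<in>I. R m k * (E m x $ r * E k y $ s) * w y $ s)" for r
        by (simp add: kernel_matrix_def matrix_vector_mult_def sum_distrib_right)
      also have "(\<Sum>s\<in>UNIV. \<Sum>m\<in>I. \<Sum>k\<in>I. R m k * (E m x $ r * E k y $ s) * w y $ s)
          = (\<Sum>m\<in>I. \<Sum>k\<in>I. \<Sum>s\<in>UNIV. R m k * (E m x $ r * E k y $ s) * w y $ s)" for r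
        by (subst sum.swap, intro sum.cong refl, rule sum.swap)
      finally show ?thesis by (simp add: vec_eq_iff sum_distrib_left sum_distrib_right mult_ac)
    qed
    moreover define h where "h m k y = (\<Sum>s\<in>UNIV. E k y $ s * w y $ s) *s (R m k *s E m x)" for m k y
    ultimately have "torus_integral \<Lambda> (\<lambda>y. kernel_matrix x y *v w y)
        = torus_integral \<Lambda> (\<lambda>y. \<Sum>m\<in>I. \<Sum>k\<in>I. h m k y)" by simp
    also have "\<dots> = (\<Sum>m\<in>I. \<Sum>k\<in>I. torus_integral \<Lambda> (h m k))"
    proof -
      have h: "continuous_on UNIV (h m k)" if "k \<in> I" for m k
        unfolding h_def vector_scalar_mult_def
        by (intro continuous_on_vec_lambda continuous_on_mult continuous_on_const c that)
      have "torus_integral \<Lambda> (\<lambda>y. \<Sum>m\<in>I. \<Sum>k\<in>I. h m k y) = (\<Sum>m\<in>I. torus_integral \<Lambda> (\<lambda>y. \<Sum>k\<in>I. h m k y))"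
        by (intro torus_integral_sum continuous_on_sum h)
      also have "\<dots> = (\<Sum>m\<in>I. \<Sum>k\<in>I. torus_integral \<Lambda> (h m k))"
        by (intro sum.cong refl torus_integral_sum h)
      finally show ?thesis .
    qed
    also have "\<dots> = (\<Sum>m\<in>I. \<Sum>k\<in>I. pairing \<Lambda> (E k) w *s (R m k *s E m x))"
    proof (intro sum.cong refl)
      fix m k assume k: "k \<in> I"
      have "bounded_linear (\<lambda>a. a *s (R m k *s E m x))"
        by (intro linear_conv_bounded_linear[THEN iffD1] linearI)
          (simp_all add: vec_eq_iff ring_distribs)
      from torus_integral_bounded_linear[OF this c[OF k]]
      show "torus_integral \<Lambda> (h m k) = pairing \<Lambda> (E k) w *s (R m k *s E m x)"
        by (simp add: pairing_def h_def[abs_def])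
    qed
    also have "\<dots> = lincomb (\<lambda>m. \<Sum>k\<in>I. R m k * pairing \<Lambda> (E k) w) x"
      unfolding lincomb_def by (simp add: vec_eq_iff sum_distrib_left sum_distrib_right mult_ac)
    also have "\<dots> = (inv_into (complexified_space e \<Lambda> \<kappa>) Q \<circ> projection e \<Lambda> \<kappa>) w x"
      using w by (simp add: projection_eq form_operator_inverse[OF Q])
    finally show "(inv_into (complexified_space e \<Lambda> \<kappa>) Q \<circ> projection e \<Lambda> \<kappa>) w x
        = torus_integral \<Lambda> (\<lambda>y. kernel_matrix x y *v w y)" ..
  qed
qed

text \<open>The description has exactly one solution: all admissible \<open>Q\<close> agree on the
  complexified space, hence give the same operator after inversion and projection, and a continuous
  periodic kernel is determined by its operator.\<close>

lemma propagator_eq_kernel_matrix: "propagator br e \<Lambda> \<kappa> \<mu> \<Phi> = kernel_matrix"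
  unfolding propagator_def
proof (rule the_equality)
  show "\<exists>Q. form_operator br e \<Lambda> \<kappa> \<mu> \<Phi> Q \<and>
      integral_kernel \<Lambda> (inv_into (complexified_space e \<Lambda> \<kappa>) Q \<circ> projection e \<Lambda> \<kappa>) kernel_matrix"
    using form_operator_exists kernel_matrix_is_kernel by blast
next
  fix C
  assume "\<exists>Q. form_operator br e \<Lambda> \<kappa> \<mu> \<Phi> Q \<and>
      integral_kernel \<Lambda> (inv_into (complexified_space e \<Lambda> \<kappa>) Q \<circ> projection e \<Lambda> \<kappa>) C"
  then obtain Q where Q: "form_operator br e \<Lambda> \<kappa> \<mu> \<Phi> Q"
    and C: "integral_kernel \<Lambda> (inv_into (complexified_space e \<Lambda> \<kappa>) Q \<circ> projection e \<Lambda> \<kappa>) C" by blast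
  note K = kernel_matrix_is_kernel[OF Q]
  show "C = kernel_matrix"
  proof (rule kernel_unique[OF pos])
    show "torus_integral \<Lambda> (\<lambda>y. C x y *v w y) = torus_integral \<Lambda> (\<lambda>y. kernel_matrix x y *v w y)"
      if "continuous_on UNIV w" "periodic \<Lambda> w" for w x
    proof -
      have "(\<lambda>x. torus_integral \<Lambda> (\<lambda>y. C x y *v w y))
          = (inv_into (complexified_space e \<Lambda> \<kappa>) Q \<circ> projection e \<Lambda> \<kappa>) w"
        using C that unfolding integral_kernel_def by simp
      also have "\<dots> = (\<lambda>x. torus_integral \<Lambda> (\<lambda>y. kernel_matrix x y *v w y))"
        using K that unfolding integral_kernel_def by simp
      finally show ?thesis by (rule fun_cong)
    qed
  qed (use C K in \<open>auto simp: integral_kernel_def\<close>)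
qed

end

end

end

section \<open>Uniform bounds for the propagators\<close>

text \<open>The remainder \<open>r\<close> of the expansion of \<open>v\<close> is orthogonal to
  every \<open>e b\<close>, hence to their span, hence to itself.\<close>

lemma parseval:
  assumes "orthonormal_basis e"
  shows "(\<Sum>a\<in>UNIV. (u \<bullet> e a) * (v \<bullet> e a)) = u \<bullet> v"
proof -
  have on: "e a \<bullet> e b = (if a = b then 1 else 0)" for a b
    using assms by (simp add: orthonormal_basis_def)
  have full: "span (range e) = UNIV" using assms by (simp add: orthonormal_basis_def)
  define r where "r = v - (\<Sum>a\<in>UNIV. (v \<bullet> e a) *\<^sub>R e a)"
  have re: "r \<bullet> e b = 0" for b
    by (simp add: r_def inner_diff_left inner_sum_left on if_distrib[of "\<lambda>z. _ * z"] cong: if_cong)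
  have "r \<in> span (range e)" using full by simp
  moreover have "span (range e) \<subseteq> {x. r \<bullet> x = 0}"
    by (rule span_minimal) (use re in \<open>auto intro: subspace_hyperplane\<close>)
  ultimately have "r \<bullet> r = 0" by blast
  then have "v = (\<Sum>a\<in>UNIV. (v \<bullet> e a) *\<^sub>R e a)" by (simp add: r_def)
  then have "u \<bullet> v = u \<bullet> (\<Sum>a\<in>UNIV. (v \<bullet> e a) *\<^sub>R e a)" by (rule arg_cong)
  also have "\<dots> = (\<Sum>a\<in>UNIV. (u \<bullet> e a) * (v \<bullet> e a))" by (simp add: inner_sum_right mult.commute)
  finally show ?thesis by simp
qed

lemma sum_sum_type:
  fixes f :: "'a::finite + 'b::finite \<Rightarrow> 'c::comm_monoid_add"
  shows "(\<Sum>r\<in>UNIV. f r) = (\<Sum>i\<in>UNIV. f (Inl i)) + (\<Sum>i\<in>UNIV. f (Inr i))"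
  by (simp add: UNIV_Plus_UNIV[symmetric] sum.Plus del: UNIV_Plus_UNIV)

lemma sum_prod_type:
  fixes f :: "'a::finite \<times> 'b::finite \<Rightarrow> 'c::comm_monoid_add"
  shows "(\<Sum>r\<in>UNIV. f r) = (\<Sum>i\<in>UNIV. \<Sum>a\<in>UNIV. f (i, a))"
  by (simp add: UNIV_Times_UNIV[symmetric] sum.cartesian_product del: UNIV_Times_UNIV)

lemma components_inner:
  fixes e :: "'n::finite \<Rightarrow> 'g::euclidean_space"
  assumes "orthonormal_basis e"
  shows "(\<Sum>r\<in>UNIV. components e v x $ r * components e w x $ r)
    = of_real (fst v x \<bullet> fst w x + snd v x \<bullet> snd w x)"
proof -
  have "(\<Sum>i\<in>UNIV. \<Sum>a\<in>UNIV. complex_of_real (u $ i \<bullet> e a) * of_real (u' $ i \<bullet> e a)) = of_real (u \<bullet> u')"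
    for u u' :: "'g^3"
    by (simp add: inner_vec_def parseval[OF assms] flip: of_real_mult of_real_sum)
  then show ?thesis by (simp add: sum_sum_type sum_prod_type components_def)
qed

lemma components_continuous:
  assumes "continuous_on UNIV (fst v)" "continuous_on UNIV (snd v)"
  shows "continuous_on UNIV (components e v)"
proof -
  have "continuous_on UNIV (\<lambda>x. case r of Inl (i, a) \<Rightarrow> complex_of_real (fst v x $ i \<bullet> e a)
     | Inr (i, a) \<Rightarrow> of_real (snd v x $ i \<bullet> e a))" for r
    using assms by (cases r) (auto intro!: continuous_intros)
  then show ?thesis unfolding components_def[abs_def] by (rule continuous_on_vec_lambda)
qed

lemma pairing_components:
  assumes "orthonormal_basis e"
    and "continuous_on UNIV (fst v)" "continuous_on UNIV (snd v)"
    and "continuous_on UNIV (fst w)" "continuous_on UNIV (snd w)"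
  shows "pairing \<Lambda> (components e v) (components e w)
    = of_real (L2_inner \<Lambda> (fst v) (fst w) + L2_inner \<Lambda> (snd v) (snd w))"
proof -
  have c: "continuous_on UNIV (\<lambda>x. fst v x \<bullet> fst w x)" "continuous_on UNIV (\<lambda>x. snd v x \<bullet> snd w x)"
    by (intro continuous_on_inner assms)+
  have "pairing \<Lambda> (components e v) (components e w)
      = complex_of_real (torus_integral \<Lambda> (\<lambda>x. fst v x \<bullet> fst w x + snd v x \<bullet> snd w x))"
    unfolding pairing_def components_inner[OF assms(1)]
    by (intro torus_integral_bounded_linear bounded_linear_of_real continuous_on_add c)
  then show ?thesis by (simp only: torus_integral_add[OF c] L2_inner_def)
qed

section \<open>The quadratic form in orthonormal bases\<close>

text \<open>The field bracket acts pointwise by this bilinear map, which gives its continuity and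
  its expansion in a basis of fields.\<close>

definition point_bracket ::
  "('g::euclidean_space \<Rightarrow> 'g \<Rightarrow> 'g) \<Rightarrow> ('n::finite \<Rightarrow> 'g) \<Rightarrow> 'g^3 \<Rightarrow> 'g^3 \<Rightarrow> 'g^3" where
  "point_bracket br e u v = (\<chi> k. \<Sum>c\<in>UNIV.
     (\<Sum>i\<in>UNIV. \<Sum>j\<in>UNIV. \<Sum>a\<in>UNIV. \<Sum>b\<in>UNIV.
        levi_civita i j k * structure_const br e a b c * (u $ i \<bullet> e a) * (v $ j \<bullet> e b)) *\<^sub>R e c)"

lemma field_bracket_pointwise: "field_bracket br e A B = (\<lambda>x. point_bracket br e (A x) (B x))"
  by (simp add: field_bracket_def point_bracket_def fun_eq_iff)

lemma point_bracket_bilinear: "bilinear (point_bracket br e)"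
  unfolding bilinear_def
proof (intro conjI allI)
  fix u :: "'a^3"
  show "linear (point_bracket br e u)" "linear (\<lambda>v. point_bracket br e v u)"
    by (rule linearI; simp add: point_bracket_def vec_eq_iff inner_add_left ring_distribs sum.distrib
        scaleR_add_left scaleR_sum_right sum_distrib_left mult_ac)+
qed

primrec basis_pair ::
  "(real^4 \<Rightarrow> 'g::euclidean_space^3) + (real^4 \<Rightarrow> 'g^3) \<Rightarrow> (real^4 \<Rightarrow> 'g^3) \<times> (real^4 \<Rightarrow> 'g^3)" where
  "basis_pair (Inl u) = (u, \<lambda>_. 0)"
| "basis_pair (Inr f) = (\<lambda>_. 0, f)"

lemma components_expansion:
  assumes "finite A" "finite B"
  shows "components e (\<lambda>x. \<Sum>u\<in>A. c (Inl u) *\<^sub>R u x, \<lambda>x. \<Sum>f\<in>B. c (Inr f) *\<^sub>R f x) x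
    = (\<Sum>m\<in>A <+> B. of_real (c m) *s components e (basis_pair m) x)"
proof (rule vec_eq_iff[THEN iffD2], rule allI)
  fix r
  show "components e (\<lambda>x. \<Sum>u\<in>A. c (Inl u) *\<^sub>R u x, \<lambda>x. \<Sum>f\<in>B. c (Inr f) *\<^sub>R f x) x $ r
    = (\<Sum>m\<in>A <+> B. of_real (c m) *s components e (basis_pair m) x) $ r"
    unfolding sum.Plus[OF assms] by (cases r) (auto simp: components_def inner_sum_left)
qed

context
  fixes \<Lambda> :: "real^4" and \<kappa> :: real and br :: "'g::euclidean_space \<Rightarrow> 'g \<Rightarrow> 'g"
    and e :: "'n::finite \<Rightarrow> 'g" and A F :: "(real^4 \<Rightarrow> 'g^3) set"
  assumes pos: "\<And>i. \<Lambda> $ i > 0" and \<kappa>: "\<kappa> > 0" and e: "orthonormal_basis e"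
    and A: "L2_basis \<Lambda> (cutoff_gauge_fields \<Lambda> \<kappa>) A"
    and F: "L2_basis \<Lambda> (cutoff_two_form_fields \<Lambda> \<kappa>) F"
begin

definition coord :: "(real^4 \<Rightarrow> 'g^3) \<times> (real^4 \<Rightarrow> 'g^3)
    \<Rightarrow> (real^4 \<Rightarrow> 'g^3) + (real^4 \<Rightarrow> 'g^3) \<Rightarrow> real" where
  "coord v m = (case m of Inl u \<Rightarrow> L2_inner \<Lambda> u (fst v) | Inr f \<Rightarrow> L2_inner \<Lambda> f (snd v))"

definition deriv_matrix :: "(real^4 \<Rightarrow> 'g^3) \<Rightarrow> (real^4 \<Rightarrow> 'g^3) \<Rightarrow> real" where
  "deriv_matrix f u = L2_inner \<Lambda> f (gauge_deriv u)"

text \<open>The sum over both orders absorbs the factor 2 of the bracket term in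
  \<open>boson_form\<close> and is manifestly symmetric, as \<open>saddle_point_bound\<close>
  requires of \<open>M\<close>.\<close>

definition bracket_matrix :: "real \<Rightarrow> 'g^3 \<Rightarrow> (real^4 \<Rightarrow> 'g^3) \<Rightarrow> (real^4 \<Rightarrow> 'g^3) \<Rightarrow> real" where
  "bracket_matrix \<mu> \<Phi> u v = \<mu> * (L2_inner \<Lambda> (\<lambda>_. \<Phi>) (field_bracket br e u v)
     + L2_inner \<Lambda> (\<lambda>_. \<Phi>) (field_bracket br e v u))"

text \<open>The factor 2 of the mixed terms is shared between the two off-diagonal blocks, which
  leaves \<open>- \<i>\<close> times the real matrix of \<open>D\<close> in each.\<close>

definition form_matrix :: "real \<Rightarrow> 'g^3 \<Rightarrow> (real^4 \<Rightarrow> 'g^3) + (real^4 \<Rightarrow> 'g^3)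
    \<Rightarrow> (real^4 \<Rightarrow> 'g^3) + (real^4 \<Rightarrow> 'g^3) \<Rightarrow> complex" where
  "form_matrix \<mu> \<Phi> m n = (case m of
      Inl u \<Rightarrow> (case n of Inl v \<Rightarrow> - \<i> * of_real (bracket_matrix \<mu> \<Phi> u v)
        | Inr f \<Rightarrow> - \<i> * of_real (deriv_matrix f u))
    | Inr f \<Rightarrow> (case n of Inl u \<Rightarrow> - \<i> * of_real (deriv_matrix f u)
        | Inr g \<Rightarrow> if f = g then 1 else 0))"

lemma finite_bases: "finite A" "finite F"
  using A F by (auto simp: L2_basis_def L2_orthonormal_def)

lemma gauge_field_trig: "u \<in> cutoff_gauge_fields \<Lambda> \<kappa> \<Longrightarrow> \<exists>\<alpha> \<beta>. u = trig_poly (momenta \<Lambda> \<kappa>) \<alpha> \<beta>"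
  for u :: "real^4 \<Rightarrow> 'g^3"
  using cutoff_gauge_iff[OF pos] by blast

lemma two_form_trig: "u \<in> cutoff_two_form_fields \<Lambda> \<kappa> \<Longrightarrow> \<exists>\<alpha> \<beta>. u = trig_poly (momenta \<Lambda> (2 * \<kappa>)) \<alpha> \<beta>"
  for u :: "real^4 \<Rightarrow> 'g^3"
  using cutoff_two_form_iff[OF pos] by blast

lemma gauge_field_regular:
  fixes u :: "real^4 \<Rightarrow> 'g^3"
  assumes "u \<in> cutoff_gauge_fields \<Lambda> \<kappa>"
  shows "continuous_on UNIV u" "periodic \<Lambda> u" "u differentiable at x"
    "continuous_on UNIV (gauge_deriv u)" "continuous_on UNIV (partial_deriv i u)" "continuous_on UNIV (curl u)"
proof -
  obtain \<alpha> \<beta> where u: "u = trig_poly (momenta \<Lambda> \<kappa>) \<alpha> \<beta>" using gauge_field_trig[OF assms] by blast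
  show "continuous_on UNIV u" unfolding u by (rule trig_poly_continuous)
  show "periodic \<Lambda> u" unfolding u by (intro trig_poly_periodic pos momenta_subset_lattice)
  show "u differentiable at x" unfolding u differentiable_def by (rule exI) (rule trig_poly_has_derivative)
  show p: "continuous_on UNIV (partial_deriv i u)" for i
    unfolding u trig_poly_partial by (rule trig_poly_continuous)
  show "continuous_on UNIV (curl u)"
    unfolding curl_eq[abs_def] u trig_poly_partial trig_poly_linear[OF curl_map_linear]
    by (intro continuous_on_sum trig_poly_continuous)
  then show "continuous_on UNIV (gauge_deriv u)"
    unfolding gauge_deriv_def[abs_def] by (intro continuous_on_add p)
qed

lemma two_form_regular:
  fixes u :: "real^4 \<Rightarrow> 'g^3"
  assumes "u \<in> cutoff_two_form_fields \<Lambda> \<kappa>"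
  shows "continuous_on UNIV u" "periodic \<Lambda> u"
proof -
  obtain \<alpha> \<beta> where u: "u = trig_poly (momenta \<Lambda> (2 * \<kappa>)) \<alpha> \<beta>" using two_form_trig[OF assms] by blast
  show "continuous_on UNIV u" unfolding u by (rule trig_poly_continuous)
  show "periodic \<Lambda> u" unfolding u by (intro trig_poly_periodic pos momenta_subset_lattice)
qed

lemma A_sub: "u \<in> A \<Longrightarrow> u \<in> cutoff_gauge_fields \<Lambda> \<kappa>"
  using A by (auto simp: L2_basis_def)

lemma F_sub: "u \<in> F \<Longrightarrow> u \<in> cutoff_two_form_fields \<Lambda> \<kappa>"
  using F by (auto simp: L2_basis_def)

lemma A_coefficient: "u \<in> A \<Longrightarrow> L2_inner \<Lambda> u (\<lambda>x. \<Sum>v\<in>A. c v *\<^sub>R v x) = c u"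
  using A by (intro L2_orthonormal_coefficient gauge_field_regular A_sub) (auto simp: L2_basis_def)

lemma F_coefficient: "f \<in> F \<Longrightarrow> L2_inner \<Lambda> f (\<lambda>x. \<Sum>v\<in>F. c v *\<^sub>R v x) = c f"
  using F by (intro L2_orthonormal_coefficient two_form_regular F_sub) (auto simp: L2_basis_def)

lemma A_expansion: "u \<in> cutoff_gauge_fields \<Lambda> \<kappa> \<Longrightarrow> u = (\<lambda>x. \<Sum>v\<in>A. L2_inner \<Lambda> v u *\<^sub>R v x)"
  using A unfolding L2_basis_def by blast

lemma F_expansion: "u \<in> cutoff_two_form_fields \<Lambda> \<kappa> \<Longrightarrow> u = (\<lambda>x. \<Sum>v\<in>F. L2_inner \<Lambda> v u *\<^sub>R v x)"
  using F unfolding L2_basis_def by blast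

lemma A_combination: "(\<lambda>x. \<Sum>v\<in>A. c v *\<^sub>R v x) \<in> cutoff_gauge_fields \<Lambda> \<kappa>"
  by (rule function_subspace_sum[OF cutoff_gauge_subspace[OF pos]]) (rule A_sub)

lemma F_combination: "(\<lambda>x. \<Sum>v\<in>F. c v *\<^sub>R v x) \<in> cutoff_two_form_fields \<Lambda> \<kappa>"
  by (rule function_subspace_sum[OF cutoff_two_form_subspace[OF pos]]) (rule F_sub)

text \<open>If the matrix annihilates \<open>x\<close>, then \<open>D\<close> of the field with
  coordinates \<open>x\<close> is orthogonal to all of \<open>F\<close>. As a cut-off two-form it is
  also spanned by \<open>F\<close>, so it vanishes, and injectivity of \<open>D\<close> on fields
  applies.\<close>

lemma deriv_matrix_injective:
  assumes "\<And>f. f \<in> F \<Longrightarrow> (\<Sum>u\<in>A. deriv_matrix f u * x u) = 0"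
  shows "\<forall>u\<in>A. x u = 0"
proof
  fix u assume u: "u \<in> A"
  let ?v = "\<lambda>y. \<Sum>u\<in>A. x u *\<^sub>R u y"
  have g: "gauge_deriv ?v = (\<lambda>y. \<Sum>u\<in>A. x u *\<^sub>R gauge_deriv u y)"
    by (intro ext gauge_deriv_sum gauge_field_regular A_sub)
  have "L2_inner \<Lambda> f (gauge_deriv ?v) = 0" if f: "f \<in> F" for f
  proof -
    have "L2_inner \<Lambda> f (gauge_deriv ?v) = (\<Sum>u\<in>A. x u * L2_inner \<Lambda> f (gauge_deriv u))"
      unfolding g by (intro L2_inner_sum_right gauge_field_regular two_form_regular A_sub F_sub f)
    then show ?thesis using assms[OF f] by (simp add: deriv_matrix_def mult.commute)
  qed
  then have "(\<lambda>x. \<Sum>f\<in>F. L2_inner \<Lambda> f (gauge_deriv ?v) *\<^sub>R f x) = (\<lambda>x. 0)" by simp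
  with F_expansion[OF gauge_deriv_two_form[OF pos A_combination \<kappa>]]
  have "gauge_deriv ?v y = 0" for y by (rule fun_cong[OF trans])
  then have "?v y = 0" for y by (rule gauge_deriv_injective[OF pos A_combination])
  then have "?v = (\<lambda>y. 0)" by (rule ext)
  with A_coefficient[OF u, of x] have "x u = L2_inner \<Lambda> u (\<lambda>y. 0)" by (simp only:)
  then show "x u = 0" by (simp add: L2_inner_def torus_integral_zero)
qed

lemma coord_basis_space:
  assumes "v \<in> boson_space \<Lambda> \<kappa>"
  shows "fst v = (\<lambda>x. \<Sum>u\<in>A. coord v (Inl u) *\<^sub>R u x)" "snd v = (\<lambda>x. \<Sum>f\<in>F. coord v (Inr f) *\<^sub>R f x)"
  using assms A_expansion[of "fst v"] F_expansion[of "snd v"] by (auto simp: boson_space_def coord_def)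

lemma boson_form_coord:
  assumes v: "v \<in> boson_space \<Lambda> \<kappa>"
  shows "boson_form br e \<Lambda> \<kappa> \<mu> \<Phi> v
    = (\<Sum>m\<in>A <+> F. \<Sum>n\<in>A <+> F. of_real (coord v m) * form_matrix \<mu> \<Phi> m n * of_real (coord v n))"
proof -
  define a f where "a = fst v" and "f = snd v"
  define x y where "x u = coord v (Inl u)" and "y u = coord v (Inr u)" for u
  have a: "a \<in> cutoff_gauge_fields \<Lambda> \<kappa>" and f: "f \<in> cutoff_two_form_fields \<Lambda> \<kappa>"
    using v by (auto simp: boson_space_def a_def f_def)
  have ae: "a = (\<lambda>z. \<Sum>u\<in>A. x u *\<^sub>R u z)" and fe: "f = (\<lambda>z. \<Sum>u\<in>F. y u *\<^sub>R u z)"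
    using coord_basis_space[OF v] by (simp_all add: a_def f_def x_def y_def)
  have yf: "y g = L2_inner \<Lambda> g f" for g by (simp add: y_def coord_def f_def)
  have ff: "L2_inner \<Lambda> f f = (\<Sum>g\<in>F. y g * y g)"
  proof -
    have "L2_inner \<Lambda> f (\<lambda>z. \<Sum>u\<in>F. y u *\<^sub>R u z) = (\<Sum>g\<in>F. y g * L2_inner \<Lambda> f g)"
      by (intro L2_inner_sum_right two_form_regular F_sub f)
    then show ?thesis by (simp only: fe[symmetric] L2_inner_commute[of \<Lambda> f] yf[symmetric])
  qed
  have "L2_inner \<Lambda> f (partial_deriv 0 a) + L2_inner \<Lambda> f (curl a) = L2_inner \<Lambda> f (gauge_deriv a)"
    unfolding L2_inner_def gauge_deriv_def inner_add_right
    by (intro torus_integral_add[symmetric] continuous_on_inner gauge_field_regular[OF a] two_form_regular[OF f])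
  also have "gauge_deriv a = (\<lambda>z. \<Sum>u\<in>A. x u *\<^sub>R gauge_deriv u z)"
    unfolding ae by (intro ext gauge_deriv_sum gauge_field_regular A_sub)
  also have "L2_inner \<Lambda> f \<dots> = (\<Sum>u\<in>A. x u * L2_inner \<Lambda> f (gauge_deriv u))"
    by (intro L2_inner_sum_right gauge_field_regular two_form_regular A_sub f)
  also have "\<dots> = (\<Sum>u\<in>A. x u * (\<Sum>g\<in>F. y g * deriv_matrix g u))"
  proof (rule sum.cong[OF refl])
    fix u assume u: "u \<in> A"
    have "L2_inner \<Lambda> (\<lambda>z. \<Sum>u\<in>F. y u *\<^sub>R u z) (gauge_deriv u) = (\<Sum>g\<in>F. y g * L2_inner \<Lambda> g (gauge_deriv u))"
      by (intro L2_inner_sum_left gauge_field_regular two_form_regular A_sub F_sub u)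
    then show "x u * L2_inner \<Lambda> f (gauge_deriv u) = x u * (\<Sum>g\<in>F. y g * deriv_matrix g u)"
      by (simp only: fe[symmetric] deriv_matrix_def)
  qed
  finally have fd: "L2_inner \<Lambda> f (partial_deriv 0 a) + L2_inner \<Lambda> f (curl a)
      = (\<Sum>u\<in>A. \<Sum>g\<in>F. x u * deriv_matrix g u * y g)" by (simp add: sum_distrib_left mult_ac)
  let ?N = "\<lambda>u v. L2_inner \<Lambda> (\<lambda>_. \<Phi>) (field_bracket br e u v)"
  have bb: "?N a a = (\<Sum>u\<in>A. \<Sum>w\<in>A. x u * x w * ?N u w)"
  proof -
    have "field_bracket br e a a = (\<lambda>z. \<Sum>p\<in>A \<times> A. (x (fst p) * x (snd p)) *\<^sub>R field_bracket br e (fst p) (snd p) z)"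
    proof
      fix z
      have "field_bracket br e a a z
          = (\<Sum>(u, w)\<in>A \<times> A. point_bracket br e (x u *\<^sub>R u z) (x w *\<^sub>R w z))"
        unfolding field_bracket_pointwise ae by (rule bilinear_sum[OF point_bracket_bilinear])
      then show "field_bracket br e a a z
          = (\<Sum>p\<in>A \<times> A. (x (fst p) * x (snd p)) *\<^sub>R field_bracket br e (fst p) (snd p) z)"
        by (simp add: case_prod_unfold field_bracket_pointwise bilinear_lmul[OF point_bracket_bilinear]
            bilinear_rmul[OF point_bracket_bilinear] mult.commute)
    qed
    moreover have "continuous_on UNIV (field_bracket br e u w)" if "u \<in> A" "w \<in> A" for u w
      unfolding field_bracket_pointwise
      using point_bracket_bilinear[of br e, unfolded bilinear_conv_bounded_bilinear]
      by (rule bounded_bilinear.continuous_on) (intro gauge_field_regular A_sub that)+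
    ultimately have "?N a a = (\<Sum>p\<in>A \<times> A. x (fst p) * x (snd p) * ?N (fst p) (snd p))"
      by (simp only:) (rule L2_inner_sum_right; auto)
    then show ?thesis by (simp add: sum.cartesian_product case_prod_unfold)
  qed
  \<comment> \<open>A cut-off gauge field is fixed by the convolution, which therefore drops out of
    the bracket term.\<close>
  have "mode_cutoff \<Lambda> \<kappa> a = a" using a by (simp add: cutoff_gauge_fields_def)
  then have "boson_form br e \<Lambda> \<kappa> \<mu> \<Phi> v = of_real (L2_inner \<Lambda> f f)
      - 2 * \<i> * of_real (L2_inner \<Lambda> f (partial_deriv 0 a) + L2_inner \<Lambda> f (curl a))
      - 2 * \<i> * of_real (\<mu> * ?N a a)"
    by (simp add: boson_form_def case_prod_unfold a_def[symmetric] f_def[symmetric] algebra_simps)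
  also have "2 * \<i> * complex_of_real (\<mu> * ?N a a)
      = \<i> * of_real (\<Sum>u\<in>A. \<Sum>w\<in>A. x u * bracket_matrix \<mu> \<Phi> u w * x w)"
  proof -
    have "(\<Sum>u\<in>A. \<Sum>w\<in>A. x u * bracket_matrix \<mu> \<Phi> u w * x w)
        = \<mu> * (\<Sum>u\<in>A. \<Sum>w\<in>A. x u * x w * ?N u w) + \<mu> * (\<Sum>u\<in>A. \<Sum>w\<in>A. x u * x w * ?N w u)"
      by (simp add: bracket_matrix_def sum_distrib_left sum.distrib algebra_simps)
    also have "(\<Sum>u\<in>A. \<Sum>w\<in>A. x u * x w * ?N w u) = (\<Sum>u\<in>A. \<Sum>w\<in>A. x u * x w * ?N u w)"
      by (subst sum.swap) (simp add: mult_ac)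
    finally show ?thesis by (simp add: bb)
  qed
  finally have bf: "boson_form br e \<Lambda> \<kappa> \<mu> \<Phi> v = of_real (\<Sum>g\<in>F. y g * y g)
      - 2 * \<i> * of_real (\<Sum>u\<in>A. \<Sum>g\<in>F. x u * deriv_matrix g u * y g)
      - \<i> * of_real (\<Sum>u\<in>A. \<Sum>w\<in>A. x u * bracket_matrix \<mu> \<Phi> u w * x w)"
    unfolding ff fd .
  have mat: "(\<Sum>m\<in>A <+> F. \<Sum>n\<in>A <+> F. of_real (coord v m) * form_matrix \<mu> \<Phi> m n * of_real (coord v n))
      = (\<Sum>u\<in>A. \<Sum>w\<in>A. - \<i> * of_real (x u * bracket_matrix \<mu> \<Phi> u w * x w))
        + (\<Sum>u\<in>A. \<Sum>g\<in>F. - \<i> * of_real (x u * deriv_matrix g u * y g))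
        + ((\<Sum>g\<in>F. \<Sum>u\<in>A. - \<i> * of_real (x u * deriv_matrix g u * y g))
          + (\<Sum>g\<in>F. \<Sum>h\<in>F. if g = h then of_real (y g * y h) else 0))"
  proof -
    define T where "T m n = of_real (coord v m) * form_matrix \<mu> \<Phi> m n * of_real (coord v n)" for m n
    have "T (Inl u) (Inl w) = - \<i> * of_real (x u * bracket_matrix \<mu> \<Phi> u w * x w)"
      "T (Inl u) (Inr g) = - \<i> * of_real (x u * deriv_matrix g u * y g)"
      "T (Inr g) (Inl u) = - \<i> * of_real (x u * deriv_matrix g u * y g)"
      "T (Inr g) (Inr h) = (if g = h then of_real (y g * y h) else 0)" for u w g h
      by (simp_all add: T_def form_matrix_def x_def y_def mult_ac)
    then have "(\<Sum>m\<in>A <+> F. \<Sum>n\<in>A <+> F. T m n)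
        = (\<Sum>u\<in>A. \<Sum>w\<in>A. - \<i> * of_real (x u * bracket_matrix \<mu> \<Phi> u w * x w))
          + (\<Sum>u\<in>A. \<Sum>g\<in>F. - \<i> * of_real (x u * deriv_matrix g u * y g))
          + ((\<Sum>g\<in>F. \<Sum>u\<in>A. - \<i> * of_real (x u * deriv_matrix g u * y g))
            + (\<Sum>g\<in>F. \<Sum>h\<in>F. if g = h then of_real (y g * y h) else 0))"
      by (simp only: sum.Plus[OF finite_bases] o_def sum.distrib add_ac)
    then show ?thesis by (simp only: T_def)
  qed
  have imag: "(\<Sum>u\<in>B. \<Sum>w\<in>C. - \<i> * of_real (h u w)) = - \<i> * of_real (\<Sum>u\<in>B. \<Sum>w\<in>C. h u w)"
    for B C :: "(real^4 \<Rightarrow> 'g^3) set" and h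
    by (simp add: sum_distrib_left)
  have swap: "(\<Sum>g\<in>F. \<Sum>u\<in>A. x u * deriv_matrix g u * y g) = (\<Sum>u\<in>A. \<Sum>g\<in>F. x u * deriv_matrix g u * y g)"
    by (rule sum.swap)
  have diag: "(\<Sum>g\<in>F. \<Sum>h\<in>F. if g = h then complex_of_real (y g * y h) else 0)
      = of_real (\<Sum>g\<in>F. y g * y g)"
    using finite_bases by simp
  have arith: "p - 2 * \<i> * q - \<i> * r = - \<i> * r + - \<i> * q + (- \<i> * q + p)" for p q r :: complex
    by simp
  show ?thesis unfolding bf mat imag swap diag by (rule arith)
qed

text \<open>The bases are fixed before \<open>\<mu>\<close> and \<open>\<Phi>\<close>, so the
  constant of the saddle point estimate and the suprema of the basis fields are uniform. The
  propagator is a sum of entries of the inverse form matrix times products of two basis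
  fields.\<close>

lemma propagator_bound_aux:
  "\<exists>P\<ge>0. \<forall>\<mu> \<Phi> x y r s. cmod (propagator br e \<Lambda> \<kappa> \<mu> \<Phi> x y $ r $ s) \<le> P"
proof -
  let ?I = "A <+> F" and ?E = "\<lambda>m. components e (basis_pair m)"
  have finI: "finite ?I" using finite_bases by simp
  have bc: "continuous_on UNIV (fst (basis_pair m))" "continuous_on UNIV (snd (basis_pair m))"
    "periodic \<Lambda> (fst (basis_pair m))" "periodic \<Lambda> (snd (basis_pair m))" if "m \<in> ?I" for m
    using that gauge_field_regular(1,2)[OF A_sub] two_form_regular[OF F_sub] by (auto simp: periodic_def)
  have E_cont: "continuous_on UNIV (?E m)" if "m \<in> ?I" for m
    by (intro components_continuous bc that)
  have E_per: "periodic \<Lambda> (?E m)" if "m \<in> ?I" for m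
  proof -
    have shift: "fst (basis_pair m) (x + (2 * \<Lambda> $ i) *\<^sub>R axis i 1) = fst (basis_pair m) x"
      "snd (basis_pair m) (x + (2 * \<Lambda> $ i) *\<^sub>R axis i 1) = snd (basis_pair m) x" for x i
      using bc(3,4)[OF that] unfolding periodic_def by blast+
    show ?thesis unfolding periodic_def components_def shift by simp
  qed
  have z: "L2_inner \<Lambda> (\<lambda>_. 0) u = 0" "L2_inner \<Lambda> u (\<lambda>_. 0) = 0" for u :: "real^4 \<Rightarrow> 'g^3"
    by (simp_all add: L2_inner_def torus_integral_zero)
  have on: "L2_inner \<Lambda> u w = (if u = w then 1 else 0)" if "u \<in> A \<and> w \<in> A \<or> u \<in> F \<and> w \<in> F" for u w
    using A F that by (auto simp: L2_basis_def L2_orthonormal_def)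
  have E_on: "pairing \<Lambda> (?E m) (?E n) = (if m = n then 1 else 0)" if m: "m \<in> ?I" and n: "n \<in> ?I" for m n
    unfolding pairing_components[OF e bc(1,2)[OF m] bc(1,2)[OF n]]
    using m n by (auto simp: z on split: if_splits)
  have lincomb: "lincomb ?I ?E = (\<lambda>z x. \<Sum>m\<in>?I. z m *s ?E m x)"
    by (intro ext) (simp only: lincomb_def[where E = ?E, OF pos finI E_cont E_per E_on])
  have coords: "components e v = (\<lambda>x. \<Sum>m\<in>?I. of_real (coord v m) *s ?E m x)" if "v \<in> boson_space \<Lambda> \<kappa>" for v
  proof
    fix x
    have "components e (fst v, snd v) x = (\<Sum>m\<in>?I. of_real (coord v m) *s ?E m x)"
      unfolding coord_basis_space[OF that] by (rule components_expansion[OF finite_bases])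
    then show "components e v x = (\<Sum>m\<in>?I. of_real (coord v m) *s ?E m x)" by simp
  qed
  have coords_surj: "\<exists>v\<in>boson_space \<Lambda> \<kappa>. \<forall>m\<in>?I. coord v m = c m" for c
    by (rule bexI[of _ "(\<lambda>x. \<Sum>u\<in>A. c (Inl u) *\<^sub>R u x, \<lambda>x. \<Sum>f\<in>F. c (Inr f) *\<^sub>R f x)"])
      (auto simp: coord_def boson_space_def A_coefficient F_coefficient A_combination F_combination)
  have W: "complexified_space e \<Lambda> \<kappa> = range (\<lambda>z x. \<Sum>m\<in>?I. z m *s ?E m x)"
  proof (intro equalityI subsetI)
    fix w assume "w \<in> complexified_space e \<Lambda> \<kappa>"
    then obtain v v' where v: "v \<in> boson_space \<Lambda> \<kappa>" "v' \<in> boson_space \<Lambda> \<kappa>"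
      and w: "w = (\<lambda>x. components e v x + \<i> *s components e v' x)"
      unfolding complexified_space_def by blast
    have "w = (\<lambda>x. \<Sum>m\<in>?I. (of_real (coord v m) + \<i> * of_real (coord v' m)) *s ?E m x)"
      unfolding w coords[OF v(1)] coords[OF v(2)]
      by (simp add: fun_eq_iff vec_eq_iff ring_distribs sum.distrib sum_distrib_left mult.assoc)
    then show "w \<in> range (\<lambda>z x. \<Sum>m\<in>?I. z m *s ?E m x)"
      by (intro range_eqI[where x = "\<lambda>m. of_real (coord v m) + \<i> * of_real (coord v' m)"])
  next
    fix w assume "w \<in> range (\<lambda>z x. \<Sum>m\<in>?I. z m *s ?E m x)"
    then obtain c where w: "w = (\<lambda>x. \<Sum>m\<in>?I. c m *s ?E m x)" by blast
    obtain v where v: "v \<in> boson_space \<Lambda> \<kappa>" "\<forall>m\<in>?I. coord v m = Re (c m)" using coords_surj[of "\<lambda>m. Re (c m)"] by blast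
    obtain v' where v': "v' \<in> boson_space \<Lambda> \<kappa>" "\<forall>m\<in>?I. coord v' m = Im (c m)"
      using coords_surj[of "\<lambda>m. Im (c m)"] by blast
    have "w = (\<lambda>x. components e v x + \<i> *s components e v' x)"
    proof
      fix x
      have "w x = (\<Sum>m\<in>?I. (of_real (Re (c m)) + \<i> * of_real (Im (c m))) *s ?E m x)"
        unfolding w by (simp flip: complex_eq)
      also have "\<dots> = (\<Sum>m\<in>?I. (of_real (coord v m) + \<i> * of_real (coord v' m)) *s ?E m x)"
        using v(2) v'(2) by (intro sum.cong refl) simp
      also have "\<dots> = components e v x + \<i> *s components e v' x"
        unfolding coords[OF v(1)] coords[OF v'(1)]
        by (simp add: vec_eq_iff ring_distribs sum.distrib sum_distrib_left mult.assoc)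
      finally show "w x = components e v x + \<i> *s components e v' x" .
    qed
    then show "w \<in> complexified_space e \<Lambda> \<kappa>" unfolding complexified_space_def using v(1) v'(1) by blast
  qed
  obtain c where c: "\<forall>M :: (real^4 \<Rightarrow> 'g^3) \<Rightarrow> (real^4 \<Rightarrow> 'g^3) \<Rightarrow> real. \<forall>x y a f t.
    (\<forall>i\<in>A. \<forall>k\<in>A. M i k = M k i) \<longrightarrow>
    (\<forall>i\<in>A. - \<i> * (\<Sum>k\<in>A. of_real (M i k) * x k) - \<i> * (\<Sum>j\<in>F. of_real (deriv_matrix j i) * y j) = a i) \<longrightarrow>
    (\<forall>j\<in>F. - \<i> * (\<Sum>i\<in>A. of_real (deriv_matrix j i) * x i) + y j = f j) \<longrightarrow>
    (\<forall>i\<in>A. cmod (a i) \<le> t) \<longrightarrow> (\<forall>j\<in>F. cmod (f j) \<le> t) \<longrightarrow> 0 \<le> t \<longrightarrow>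
    (\<forall>i\<in>A. cmod (x i) \<le> c * t) \<and> (\<forall>j\<in>F. cmod (y j) \<le> c * t)"
    using saddle_point_bound[OF finite_bases, of deriv_matrix] deriv_matrix_injective by blast
  \<comment> \<open>Used twice: a zero right-hand side gives injectivity of the form matrix, and a
    unit vector as right-hand side bounds a column of its inverse.\<close>
  have solve: "cmod (z m) \<le> c * t"
    if eq: "\<And>m. m \<in> ?I \<Longrightarrow> (\<Sum>n\<in>?I. form_matrix \<mu> \<Phi> m n * z n) = w m"
      and w: "\<And>m. m \<in> ?I \<Longrightarrow> cmod (w m) \<le> t" and t: "0 \<le> t" and m: "m \<in> ?I" for z w \<mu> \<Phi> t m
  proof -
    have "\<forall>i\<in>A. \<forall>k\<in>A. bracket_matrix \<mu> \<Phi> i k = bracket_matrix \<mu> \<Phi> k i"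
      by (simp add: bracket_matrix_def add.commute)
    moreover have "\<forall>i\<in>A. - \<i> * (\<Sum>k\<in>A. of_real (bracket_matrix \<mu> \<Phi> i k) * z (Inl k))
        - \<i> * (\<Sum>j\<in>F. of_real (deriv_matrix j i) * z (Inr j)) = w (Inl i)"
    proof
      fix i assume i: "i \<in> A"
      show "- \<i> * (\<Sum>k\<in>A. of_real (bracket_matrix \<mu> \<Phi> i k) * z (Inl k))
          - \<i> * (\<Sum>j\<in>F. of_real (deriv_matrix j i) * z (Inr j)) = w (Inl i)"
        using eq[OF InlI[OF i]] unfolding sum.Plus[OF finite_bases]
        by (simp add: form_matrix_def sum_distrib_left sum_negf mult.assoc)
    qed
    moreover have "\<forall>j\<in>F. - \<i> * (\<Sum>i\<in>A. of_real (deriv_matrix j i) * z (Inl i)) + z (Inr j) = w (Inr j)"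
    proof
      fix j assume j: "j \<in> F"
      show "- \<i> * (\<Sum>i\<in>A. of_real (deriv_matrix j i) * z (Inl i)) + z (Inr j) = w (Inr j)"
        using eq[OF InrI[OF j]] j finite_bases unfolding sum.Plus[OF finite_bases]
        by (simp add: form_matrix_def sum_distrib_left sum_negf mult.assoc
            if_distrib[of "\<lambda>z. z * _"] cong: if_cong)
    qed
    moreover have "\<forall>i\<in>A. cmod (w (Inl i)) \<le> t" "\<forall>j\<in>F. cmod (w (Inr j)) \<le> t" using w by auto
    ultimately have "(\<forall>i\<in>A. cmod (z (Inl i)) \<le> c * t) \<and> (\<forall>j\<in>F. cmod (z (Inr j)) \<le> c * t)"
      using c[rule_format, of "bracket_matrix \<mu> \<Phi>" "\<lambda>i. z (Inl i)" "\<lambda>j. z (Inr j)"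
          "\<lambda>i. w (Inl i)" "\<lambda>j. w (Inr j)" t] t by simp
    then show ?thesis using m by auto
  qed
  have "\<exists>K. \<forall>x. norm (?E m x) \<le> K" if "m \<in> ?I" for m
    by (rule periodic_bounded[OF pos E_cont[OF that] E_per[OF that]])
  then obtain K where K: "\<And>m x. m \<in> ?I \<Longrightarrow> norm (?E m x) \<le> K m" by metis
  define P where "P = (\<Sum>m\<in>?I. \<Sum>k\<in>?I. \<bar>c\<bar> * (K m * K k))"
  have K0: "0 \<le> K m" if "m \<in> ?I" for m using K[OF that] norm_ge_zero order_trans by blast
  have "cmod (propagator br e \<Lambda> \<kappa> \<mu> \<Phi> x y $ r $ s) \<le> P" for \<mu> \<Phi> x y r s
  proof -
    let ?q = "form_matrix \<mu> \<Phi>"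
    have q_sym: "?q m n = ?q n m" if "m \<in> ?I" "n \<in> ?I" for m n
      by (auto simp: form_matrix_def bracket_matrix_def add.commute split: sum.split)
    have q_inj: "\<forall>m\<in>?I. z m = 0" if "\<And>m. m \<in> ?I \<Longrightarrow> (\<Sum>n\<in>?I. ?q m n * z n) = 0" for z
      using solve[of \<mu> \<Phi> z "\<lambda>_. 0" 0] that by simp
    obtain R where R: "\<And>m k. m \<in> ?I \<Longrightarrow> k \<in> ?I \<Longrightarrow> (\<Sum>n\<in>?I. ?q m n * R n k) = (if m = k then 1 else 0)"
      using injective_matrix_right_inverse[OF finI, of ?q] q_inj by blast
    have Rc: "cmod (R m k) \<le> \<bar>c\<bar>" if "m \<in> ?I" "k \<in> ?I" for m k
    proof -
      have "cmod (R m k) \<le> c * 1"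
        by (rule solve[of \<mu> \<Phi> "\<lambda>n. R n k" "\<lambda>m. if m = k then 1 else 0"]) (use R that in simp_all)
      then show ?thesis by simp
    qed
    have "propagator br e \<Lambda> \<kappa> \<mu> \<Phi> x y $ r $ s = (\<Sum>m\<in>?I. \<Sum>k\<in>?I. R m k * (?E m x $ r * ?E k y $ s))"
    proof -
      have W': "complexified_space e \<Lambda> \<kappa> = range (lincomb ?I ?E)" unfolding lincomb by (rule W)
      have coords': "components e v = lincomb ?I ?E (\<lambda>m. of_real (coord v m))"
        if "v \<in> boson_space \<Lambda> \<kappa>" for v
        unfolding lincomb by (rule coords[OF that])
      have "propagator br e \<Lambda> \<kappa> \<mu> \<Phi> = kernel_matrix ?I ?E R"
        by (rule propagator_eq_kernel_matrix[where E = ?E and q = ?q and rc = coord], rule pos,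
            rule finI, erule E_cont, erule E_per, rule E_on, assumption, assumption, rule W',
            rule q_sym, assumption, assumption, rule q_inj, simp only:, rule R, assumption, assumption,
            erule coords', rule coords_surj, erule boson_form_coord)
      moreover have "kernel_matrix ?I ?E R x y = (\<chi> r s. \<Sum>m\<in>?I. \<Sum>k\<in>?I. R m k * (?E m x $ r * ?E k y $ s))"
        by (rule kernel_matrix_def[where E = ?E and q = ?q and rc = coord and e = e and \<kappa> = \<kappa>
              and br = br and \<mu> = \<mu> and \<Phi> = \<Phi>], rule pos,
            rule finI, erule E_cont, erule E_per, rule E_on, assumption, assumption, rule W',
            rule q_sym, assumption, assumption, rule q_inj, simp only:, rule R, assumption, assumption,
            erule coords', rule coords_surj, erule boson_form_coord)
      ultimately show ?thesis by (simp only: vec_lambda_beta)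
    qed
    also have "cmod \<dots> \<le> P"
      unfolding P_def
    proof (intro sum_norm_le)
      fix m k assume mk: "m \<in> ?I" "k \<in> ?I"
      have "cmod (?E m x $ r) \<le> K m" "cmod (?E k y $ s) \<le> K k"
        using order_trans[OF Finite_Cartesian_Product.norm_nth_le K[OF mk(1)]] order_trans[OF Finite_Cartesian_Product.norm_nth_le K[OF mk(2)]] by simp_all
      then show "cmod (R m k * (?E m x $ r * ?E k y $ s)) \<le> \<bar>c\<bar> * (K m * K k)"
        unfolding norm_mult using Rc[OF mk] K0 mk by (intro mult_mono) auto
    qed
    finally show ?thesis .
  qed
  moreover have "0 \<le> P" unfolding P_def using K0 by (intro sum_nonneg mult_nonneg_nonneg) auto
  ultimately show ?thesis by blast
qed

end

lemma propagator_bound: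
  fixes br :: "'g::euclidean_space \<Rightarrow> 'g \<Rightarrow> 'g" and e :: "'n::finite \<Rightarrow> 'g"
  assumes "\<And>i. \<Lambda> $ i > 0" "\<kappa> > 0" "orthonormal_basis e"
  shows "\<exists>P\<ge>0. \<forall>\<mu> \<Phi> x y r s. cmod (propagator br e \<Lambda> \<kappa> \<mu> \<Phi> x y $ r $ s) \<le> P"
proof -
  obtain A where "L2_basis \<Lambda> (cutoff_gauge_fields \<Lambda> \<kappa> :: (real^4 \<Rightarrow> 'g^3) set) A"
    using trig_poly_space_basis[OF assms(1) cutoff_gauge_subspace[OF assms(1)]] cutoff_gauge_iff[OF assms(1)]
    by meson
  moreover obtain F where "L2_basis \<Lambda> (cutoff_two_form_fields \<Lambda> \<kappa> :: (real^4 \<Rightarrow> 'g^3) set) F"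
    using trig_poly_space_basis[OF assms(1) cutoff_two_form_subspace[OF assms(1)]] cutoff_two_form_iff[OF assms(1)]
    by meson
  ultimately show ?thesis using propagator_bound_aux[OF assms] by blast
qed

theorem theorem2:
  fixes br :: "'g::euclidean_space \<Rightarrow> 'g \<Rightarrow> 'g"
    and e :: "'n::finite \<Rightarrow> 'g"
    and \<Lambda> :: "real^4"
    and \<zeta> Z :: "real \<Rightarrow> real"
    and \<kappa> \<epsilon> :: real
  assumes "compact_simple_lie_algebra br"
    and "orthonormal_basis e"
    and "\<And>i. \<Lambda> $ i > 0"
    and "zeta_profile \<zeta>"
    and "Z_profile Z"
    and "\<kappa> > 0"
    and "\<And>i (m::int). \<kappa> \<noteq> pi * of_int m / \<Lambda> $ i"
    and "\<epsilon> > 0"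
  shows "\<exists>M :: nat \<Rightarrow> real.
    (\<forall>n. M n \<ge> 0) \<and>
    (\<forall>n (\<mu>::real) (\<Phi>::'g^3). cmod (Xi br e \<Lambda> \<zeta> Z \<kappa> \<epsilon> \<mu> \<Phi> n) \<le> M n) \<and>
    (\<forall>lam::complex. summable (\<lambda>n. M n * cmod lam ^ (2 * n)))"
proof -
  obtain K where K: "bounded_test K (delta_cutoff \<Lambda> \<zeta> \<epsilon>)" "bounded_test K (D_cutoff \<Lambda> Z \<epsilon>)"
    using cutoffs_bounded_test[OF assms(3,4,5,8)] by blast
  obtain P where P: "0 \<le> P" "\<And>\<mu> \<Phi> x y r s. cmod (propagator br e \<Lambda> \<kappa> \<mu> \<Phi> x y $ r $ s) \<le> P"
    using propagator_bound[OF assms(3,6,2), of br] by blast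
  show ?thesis by (rule Xi_series_bound[OF K P(2) P(1)])
qed

end
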